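(* Let $X$ be the blow-up of $\mathbb{P}^2 = \mathbb{CP}^2$ in $10$ very general points, let $E_1, \ldots, E_{10}$ be the exceptional divisors on $X$, and let $H$ be the pullback to $X$ of a line in $\mathbb{P}^2$. Then the divisor \[ H - \frac{4}{13} \sum_{i=1}^{10} E_i \] is nef on $X$.
   Context: Divisors are considered with real (here rational) coefficients. A divisor is nef if its intersection number with every irreducible curve on $X$ is $\geq 0$. "Very general" means that the 10-tuple of points lies outside a countable union of proper closed subvarieties of $(\mathbb{P}^2)^{10}$. *)

theory Defs
  imports "HOL-Analysis.Analysis"
begin

section \<open>The complex projective plane\<close>

definition proportional :: "complex^3 \<Rightarrow> complex^3 \<Rightarrow> bool" where
  "proportional u v \<longleftrightarrow> u \<noteq> 0 \<and> v \<noteq> 0 \<and> (\<exists>c. u = c *s v)"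

lemma part_equivp_proportional: "part_equivp proportional"
proof (rule part_equivpI)
  have "(1::complex^3) \<noteq> 0" by simp
  moreover have "(1::complex^3) = 1 *s 1" by simp
  ultimately show "\<exists>v. proportional v v"
    unfolding proportional_def by blast
  show "symp proportional"
  proof (rule sympI)
    fix u v assume uv: "proportional u v"
    then obtain c where c: "u = c *s v" and nz: "u \<noteq> 0" "v \<noteq> 0"
      unfolding proportional_def by blast
    then have "c \<noteq> 0" by auto
    then have "v = inverse c *s u" using c by (simp add: vector_smult_assoc)
    then show "proportional v u" using nz unfolding proportional_def by blast
  qed
  show "transp proportional"
    by (rule transpI) (auto simp: proportional_def vector_smult_assoc)
qed

quotient_type cp2 = "complex^3" / partial: proportional
  by (rule part_equivp_proportional)

text \<open>
  The type \<open>cp2\<close> also serves as the dual plane: a line is given by the coefficients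
  \<open>[a : b : c]\<close> of its equation.
\<close>

definition incident :: "cp2 \<Rightarrow> cp2 \<Rightarrow> bool" where
  "incident P L \<longleftrightarrow> (\<Sum>k\<in>UNIV. rep_cp2 L $ k * rep_cp2 P $ k) = 0"


section \<open>Zariski topology on products of planes\<close>

text \<open>
  A point of the product of copies of the plane indexed by \<open>'i\<close> is a function
  \<open>'i \<Rightarrow> cp2\<close>. The field being infinite, polynomials in the homogeneous coordinates are
  identified with polynomial functions.
\<close>

definition coords :: "('i \<Rightarrow> cp2) \<Rightarrow> 'i \<Rightarrow> complex^3" where
  "coords x = (\<lambda>i. rep_cp2 (x i))"

inductive polyfun :: "(('i \<Rightarrow> complex^3) \<Rightarrow> complex) \<Rightarrow> bool" where
  const: "polyfun (\<lambda>v. c)"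
| coord: "polyfun (\<lambda>v. v i $ k)"
| add: "polyfun F \<Longrightarrow> polyfun G \<Longrightarrow> polyfun (\<lambda>v. F v + G v)"
| mult: "polyfun F \<Longrightarrow> polyfun G \<Longrightarrow> polyfun (\<lambda>v. F v * G v)"

text \<open>Multihomogeneous polynomials of multidegree \<open>d\<close>:\<close>

definition multiform :: "('i::finite \<Rightarrow> nat) \<Rightarrow> (('i \<Rightarrow> complex^3) \<Rightarrow> complex) \<Rightarrow> bool" where
  "multiform d F \<longleftrightarrow> polyfun F \<and>
     (\<forall>c v. F (\<lambda>i. c i *s v i) = (\<Prod>i\<in>UNIV. c i ^ d i) * F v)"

definition zariski_closed :: "('i::finite \<Rightarrow> cp2) set \<Rightarrow> bool" where
  "zariski_closed Z \<longleftrightarrow>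
     (\<exists>S. (\<forall>F\<in>S. \<exists>d. multiform d F) \<and> Z = {x. \<forall>F\<in>S. F (coords x) = 0})"

definition zariski_irreducible :: "('i::finite \<Rightarrow> cp2) set \<Rightarrow> bool" where
  "zariski_irreducible Z \<longleftrightarrow> Z \<noteq> {} \<and>
     (\<forall>Z1 Z2. zariski_closed Z1 \<and> zariski_closed Z2 \<and> Z \<subseteq> Z1 \<union> Z2 \<longrightarrow> Z \<subseteq> Z1 \<or> Z \<subseteq> Z2)"

definition closed_irreducible :: "('i::finite \<Rightarrow> cp2) set \<Rightarrow> bool" where
  "closed_irreducible Z \<longleftrightarrow> zariski_closed Z \<and> zariski_irreducible Z"

definition near :: "('i::finite \<Rightarrow> cp2) set \<Rightarrow> ('i \<Rightarrow> cp2) \<Rightarrow> (('i \<Rightarrow> cp2) \<Rightarrow> bool) \<Rightarrow> bool" where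
  "near X x P \<longleftrightarrow> (\<exists>Z. zariski_closed Z \<and> x \<notin> Z \<and> (\<forall>y\<in>X - Z. P y))"

definition very_general :: "(('i::finite \<Rightarrow> cp2) \<Rightarrow> bool) \<Rightarrow> bool" where
  "very_general P \<longleftrightarrow>
     (\<exists>Z :: nat \<Rightarrow> ('i \<Rightarrow> cp2) set.
        (\<forall>n. zariski_closed (Z n) \<and> Z n \<noteq> UNIV) \<and> (\<forall>p. p \<notin> (\<Union>n. Z n) \<longrightarrow> P p))"


section \<open>Curves and intersection multiplicities on a smooth projective surface\<close>

text \<open>
  From here on \<open>X\<close> is meant to be a nonsingular irreducible closed surface in a product of
  planes. An irreducible curve is an irreducible closed subset of Krull dimension one.
\<close>

definition irreducible_curve :: "('i::finite \<Rightarrow> cp2) set \<Rightarrow> ('i \<Rightarrow> cp2) set \<Rightarrow> bool" where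
  "irreducible_curve X C \<longleftrightarrow> C \<subseteq> X \<and> closed_irreducible C \<and>
     (\<exists>Z. closed_irreducible Z \<and> Z \<subset> C) \<and>
     \<not> (\<exists>Z Z'. closed_irreducible Z \<and> closed_irreducible Z' \<and> Z \<subset> Z' \<and> Z' \<subset> C)"

text \<open>
  The local ring of \<open>X\<close> at \<open>x\<close> is the ring of all \<open>f\<close> with \<open>regular_at X x f\<close>, modulo
  those vanishing on a neighbourhood of \<open>x\<close> in \<open>X\<close>. We do not form this quotient but
  work with preimages of ideals.
\<close>

definition regular_at ::
  "('i::finite \<Rightarrow> cp2) set \<Rightarrow> ('i \<Rightarrow> cp2) \<Rightarrow> (('i \<Rightarrow> cp2) \<Rightarrow> complex) \<Rightarrow> bool" where
  "regular_at X x f \<longleftrightarrow>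
     (\<exists>d F G. multiform d F \<and> multiform d G \<and> G (coords x) \<noteq> 0 \<and>
        (\<forall>y\<in>X. G (coords y) \<noteq> 0 \<longrightarrow> f y = F (coords y) / G (coords y)))"

definition curve_ideal ::
  "('i::finite \<Rightarrow> cp2) set \<Rightarrow> ('i \<Rightarrow> cp2) set \<Rightarrow> ('i \<Rightarrow> cp2) \<Rightarrow> (('i \<Rightarrow> cp2) \<Rightarrow> complex) set" where
  "curve_ideal X C x = {f. regular_at X x f \<and> near C x (\<lambda>y. f y = 0)}"

text \<open>
  The dimension of the local ring at \<open>x\<close> modulo the sum of the ideals of \<open>C\<close> and \<open>C'\<close>,
  as the least cardinality of a spanning set; it is finite for distinct irreducible curves.
\<close>

definition local_intersection ::
  "('i::finite \<Rightarrow> cp2) set \<Rightarrow> ('i \<Rightarrow> cp2) set \<Rightarrow> ('i \<Rightarrow> cp2) set \<Rightarrow> ('i \<Rightarrow> cp2) \<Rightarrow> nat" where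
  "local_intersection X C C' x =
     (LEAST n. \<exists>B. finite B \<and> card B = n \<and> (\<forall>b\<in>B. regular_at X x b) \<and>
        (\<forall>f. regular_at X x f \<longrightarrow>
           (\<exists>c g h. g \<in> curve_ideal X C x \<and> h \<in> curve_ideal X C' x \<and>
              f = (\<lambda>y. (\<Sum>b\<in>B. c b * b y) + g y + h y))))"

definition curve_intersection ::
  "('i::finite \<Rightarrow> cp2) set \<Rightarrow> ('i \<Rightarrow> cp2) set \<Rightarrow> ('i \<Rightarrow> cp2) set \<Rightarrow> nat" where
  "curve_intersection X C C' = (\<Sum>x\<in>C \<inter> C'. local_intersection X C C' x)"


section \<open>Divisors with real coefficients\<close>

definition divisor :: "('i::finite \<Rightarrow> cp2) set \<Rightarrow> (('i \<Rightarrow> cp2) set \<Rightarrow> real) \<Rightarrow> bool" where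
  "divisor X D \<longleftrightarrow> finite {C. D C \<noteq> 0} \<and> (\<forall>C. D C \<noteq> 0 \<longrightarrow> irreducible_curve X C)"

definition prime_divisor :: "('i \<Rightarrow> cp2) set \<Rightarrow> ('i \<Rightarrow> cp2) set \<Rightarrow> real" where
  "prime_divisor C = (\<lambda>C'. if C' = C then 1 else 0)"

definition local_equation ::
  "('i::finite \<Rightarrow> cp2) set \<Rightarrow> ('i \<Rightarrow> cp2) set \<Rightarrow> ('i \<Rightarrow> cp2) \<Rightarrow> (('i \<Rightarrow> cp2) \<Rightarrow> complex) \<Rightarrow> bool" where
  "local_equation X C x h \<longleftrightarrow> regular_at X x h \<and>
     curve_ideal X C x =
       {f. regular_at X x f \<and> (\<exists>g. regular_at X x g \<and> near X x (\<lambda>y. f y = h y * g y))}"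

text \<open>
  The order of vanishing along \<open>C\<close> of a multiform \<open>F\<close> that does not vanish identically on \<open>X\<close>.
  A form \<open>G\<close> of the same multidegree with \<open>G x \<noteq> 0\<close> turns \<open>F\<close> into the regular function
  \<open>F / G = h^n g\<close> at \<open>x\<close>, where \<open>h\<close> is a local equation of \<open>C\<close> and \<open>g\<close> is not divisible
  by \<open>h\<close>; the exponent does not depend on any of the choices.
\<close>

definition order_along ::
  "('i::finite \<Rightarrow> cp2) set \<Rightarrow> ('i \<Rightarrow> cp2) set \<Rightarrow> (('i \<Rightarrow> complex^3) \<Rightarrow> complex) \<Rightarrow> nat" where
  "order_along X C F =
     (THE n. \<exists>x\<in>C. \<exists>d G h g. multiform d F \<and> multiform d G \<and> G (coords x) \<noteq> 0 \<and>
        local_equation X C x h \<and> regular_at X x g \<and> g \<notin> curve_ideal X C x \<and>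
        near X x (\<lambda>y. F (coords y) / G (coords y) = h y ^ n * g y))"

definition form_divisor ::
  "('i::finite \<Rightarrow> cp2) set \<Rightarrow> (('i \<Rightarrow> complex^3) \<Rightarrow> complex) \<Rightarrow> ('i \<Rightarrow> cp2) set \<Rightarrow> real" where
  "form_divisor X F = (\<lambda>C. if irreducible_curve X C then real (order_along X C F) else 0)"

text \<open>The divisors of the nonzero rational functions \<open>F / G\<close> on \<open>X\<close>:\<close>

definition principal_divisor :: "('i::finite \<Rightarrow> cp2) set \<Rightarrow> (('i \<Rightarrow> cp2) set \<Rightarrow> real) \<Rightarrow> bool" where
  "principal_divisor X D \<longleftrightarrow>
     (\<exists>d F G. multiform d F \<and> multiform d G \<and>
        (\<exists>x\<in>X. F (coords x) \<noteq> 0) \<and> (\<exists>x\<in>X. G (coords x) \<noteq> 0) \<and>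
        D = (\<lambda>C. form_divisor X F C - form_divisor X G C))"

definition linearly_equivalent ::
  "('i::finite \<Rightarrow> cp2) set \<Rightarrow> (('i \<Rightarrow> cp2) set \<Rightarrow> real) \<Rightarrow> (('i \<Rightarrow> cp2) set \<Rightarrow> real) \<Rightarrow> bool" where
  "linearly_equivalent X D D' \<longleftrightarrow>
     (\<exists>(n::nat) a P. (\<forall>k<n. principal_divisor X (P k)) \<and>
        D' = (\<lambda>C. D C + (\<Sum>k<n. a k * P k C)))"

text \<open>
  The intersection number of \<open>D\<close> with \<open>C\<close>: move \<open>D\<close> within its (real) linear equivalence
  class to a divisor \<open>D'\<close> not containing \<open>C\<close>, and add up local intersection multiplicities.
  Since principal divisors have degree zero on \<open>C\<close>, the number is independent of \<open>D'\<close>.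
\<close>

definition has_intersection_number ::
  "('i::finite \<Rightarrow> cp2) set \<Rightarrow> (('i \<Rightarrow> cp2) set \<Rightarrow> real) \<Rightarrow> ('i \<Rightarrow> cp2) set \<Rightarrow> real \<Rightarrow> bool" where
  "has_intersection_number X D C r \<longleftrightarrow>
     (\<exists>D'. divisor X D' \<and> linearly_equivalent X D D' \<and> D' C = 0 \<and>
        r = (\<Sum>C' | D' C' \<noteq> 0. D' C' * real (curve_intersection X C' C)))"

definition nef :: "('i::finite \<Rightarrow> cp2) set \<Rightarrow> (('i \<Rightarrow> cp2) set \<Rightarrow> real) \<Rightarrow> bool" where
  "nef X D \<longleftrightarrow> divisor X D \<and>
     (\<forall>C. irreducible_curve X C \<longrightarrow> (\<exists>r. has_intersection_number X D C r \<and> r \<ge> 0))"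


section \<open>The blow-up of the plane in finitely many points\<close>

text \<open>
  The blow-up of the plane in one point \<open>P\<close> consists of the pairs of a point and a line
  through it and \<open>P\<close> (the closure of the graph of the projection from \<open>P\<close>). The blow-up
  in distinct points \<open>p i\<close> is the fibre product of these over the plane: the coordinate
  \<open>None\<close> is the blow-down map, and the coordinate \<open>Some i\<close> is a line through \<open>p i\<close> and
  the image point.
\<close>

definition blowup :: "('i::finite \<Rightarrow> cp2) \<Rightarrow> ('i option \<Rightarrow> cp2) set" where
  "blowup p = {x. \<forall>i. incident (p i) (x (Some i)) \<and> incident (x None) (x (Some i))}"

definition exceptional :: "('i::finite \<Rightarrow> cp2) \<Rightarrow> 'i \<Rightarrow> ('i option \<Rightarrow> cp2) set" where
  "exceptional p i = {x \<in> blowup p. x None = p i}"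

definition line_pullback :: "('i::finite \<Rightarrow> cp2) \<Rightarrow> cp2 \<Rightarrow> ('i option \<Rightarrow> cp2) set \<Rightarrow> real" where
  "line_pullback p L = form_divisor (blowup p) (\<lambda>v. \<Sum>k\<in>UNIV. rep_cp2 L $ k * v None $ k)"

end

theory Submission
  imports Defs "HOL-Computational_Algebra.Field_as_Ring" "HOL-Computational_Algebra.Polynomial_Factorial"
    "HOL-Computational_Algebra.Fundamental_Theorem_Algebra" "Jordan_Normal_Form.Determinant"
    "HOL-Number_Theory.Cong"
begin

text \<open>
  An effective divisor not containing a curve \<open>C\<close> meets \<open>C\<close> nonnegatively, so it suffices to move
  \<open>H - 4/13 \<Sum> E\<close> to an effective divisor off \<open>C\<close>. If \<open>C = E i\<close>, trade \<open>- E i\<close> for the strict transform of a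
  line through \<open>p i\<close> minus a general line; the other \<open>E j\<close> do not meet \<open>C\<close>.

  Otherwise, for every pair of points there is a nonic with double points at the pair and triple points
  at the other eight, its coefficients being Cramer determinants in the coordinates of the points.
  For disjoint pairs the two nonics have no common zero on a fixed line, since the resultant of their
  restrictions is a multihomogeneous form in the points that is nonzero modulo 11 at one explicit
  configuration; so they have no common component. Hence the pairs whose nonic contains \<open>C\<close> intersect
  pairwise: they share a point or lie in a triangle. Averaging the nonics of the 36 pairs avoiding the
  common point, or of the 42 pairs outside the triangle, gives multiplicity at least
  \<open>9 \<cdot> 4/13\<close> at every point, and one ninth of this average is the required representative of \<open>H\<close>.

  Orders along curves are computed in affine charts isomorphic to open subsets of the \<open>(s, t)\<close>-plane, where
  the ideal of a curve is principal.
\<close>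

text \<open>A nonic has 55 coefficients, and two double and eight triple points impose 2 * 3 + 8 * 6
  = 54 conditions, so one nonic is expected for each of the 45 pairs. Averaged over all pairs the
  multiplicity at each point is 3 - 9/45 = 14/5, slightly above 9 * 4/13 = 36/13. This margin pays
  for the nonics that contain \<open>C\<close> and must be dropped: the averages left over are at
  least 3 - 8/36 = 25/9 for a common point and 3 - 9/42 = 39/14 for a triangle, and 25/9 exceeds
  36/13 by only 1/117. The obstacle is that a single nonic may be reducible, with unknown
  components. Hence nonics are compared only in pairs, and only on one line: a common component
  would have to meet the line, so one nonzero resultant excludes it. All choices of two disjoint
  pairs arise from one choice by relabelling the points, so one numerical configuration, relabelled,
  certifies all the resultants. Cramer determinants keep everything polynomial in the points even
  where the 54 conditions are dependent; there the determinants all vanish.\<close>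

no_notation Matrix.vec_index (infixl "$" 100)
hide_const (open) module.smult

section \<open>Vectors and points of the plane\<close>

lemma vec3_eq_iff: "(u :: complex^3) = v \<longleftrightarrow> u$1 = v$1 \<and> u$2 = v$2 \<and> u$3 = v$3"
  by (simp add: Finite_Cartesian_Product.vec_eq_iff forall_3)

text \<open>Bilinear, without complex conjugation, so that incidence is a polynomial condition on
  the coordinates.\<close>

definition dot :: "complex^3 \<Rightarrow> complex^3 \<Rightarrow> complex" where
  "dot u v = u$1 * v$1 + u$2 * v$2 + u$3 * v$3"

definition cross :: "complex^3 \<Rightarrow> complex^3 \<Rightarrow> complex^3" where
  "cross u v = vector [u$2 * v$3 - u$3 * v$2, u$3 * v$1 - u$1 * v$3, u$1 * v$2 - u$2 * v$1]"

lemma cross_component [simp]: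
  "cross u v $ 1 = u$2 * v$3 - u$3 * v$2"
  "cross u v $ 2 = u$3 * v$1 - u$1 * v$3"
  "cross u v $ 3 = u$1 * v$2 - u$2 * v$1"
  by (simp_all add: cross_def)

lemma dot_sum: "dot u v = (\<Sum>k\<in>UNIV. u$k * v$k)"
  by (simp add: dot_def sum_3)

lemma dot_algebra:
  "dot u (v + w) = dot u v + dot u w"
  "dot (u + v) w = dot u w + dot v w"
  "dot u (v - w) = dot u v - dot u w"
  "dot (u - v) w = dot u w - dot v w"
  "dot (c *s u) v = c * dot u v"
  "dot u (c *s v) = c * dot u v"
  by (simp_all add: dot_def algebra_simps)

lemma dot_zero [simp]: "dot 0 v = 0" "dot u 0 = 0"
  by (simp_all add: dot_def)

lemma dot_commute: "dot u v = dot v u"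
  by (simp add: dot_def mult.commute)

lemma dot_cross_self [simp]:
  "dot u (cross u v) = 0" "dot v (cross u v) = 0" "dot (cross u v) u = 0" "dot (cross u v) v = 0"
  by (simp_all add: dot_def algebra_simps)

lemma cross_linear:
  "cross u (v + w) = cross u v + cross u w"
  "cross u (c *s v) = c *s cross u v"
  "cross (c *s u) v = c *s cross u v"
  "cross u u = 0"
  by (simp_all add: vec3_eq_iff algebra_simps)

lemma cross_anticommute: "cross v u = - cross u v"
  by (simp add: vec3_eq_iff algebra_simps)

text \<open>Two lines through \<open>a\<close> meet in \<open>a\<close>. Read dually in
  \<open>chart_exists\<close>, it shows that two points chosen on a line span that line.\<close>

lemma cross_cross_left: "cross (cross a b) (cross a c) = dot a (cross b c) *s a"
  by (simp add: vec3_eq_iff dot_def algebra_simps)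

lemma cross_eq_0_imp_scale:
  assumes "cross u v = 0" "u \<noteq> 0"
  shows "\<exists>c. v = c *s u"
proof -
  obtain k where k: "u $ k \<noteq> 0" using assms(2) by (auto simp: vec3_eq_iff)
  have e: "u$2 * v$3 = u$3 * v$2" "u$3 * v$1 = u$1 * v$3" "u$1 * v$2 = u$2 * v$1"
    using assms(1) by (simp_all add: vec3_eq_iff)
  have sc: "d = c / a * b" if "a * d = b * c" "a \<noteq> 0" for a b c d :: complex
    using that by (metis nonzero_mult_div_cancel_left times_divide_eq_left mult.commute)
  have "k = 1 \<or> k = 2 \<or> k = 3" using exhaust_3 by blast
  then have "v = (v $ k / u $ k) *s u"
  proof (elim disjE)
    assume "k = 1"
    then have "u $ 1 \<noteq> 0" using k by simp
    then show ?thesis unfolding \<open>k = 1\<close> vec3_eq_iff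
      using sc[OF e(3)] sc[OF e(2)[symmetric]] by simp
  next
    assume "k = 2"
    then have "u $ 2 \<noteq> 0" using k by simp
    then show ?thesis unfolding \<open>k = 2\<close> vec3_eq_iff
      using sc[OF e(1)] sc[OF e(3)[symmetric]] by simp
  next
    assume "k = 3"
    then have "u $ 3 \<noteq> 0" using k by simp
    then show ?thesis unfolding \<open>k = 3\<close> vec3_eq_iff
      using sc[OF e(2)] sc[OF e(1)[symmetric]] by simp
  qed
  then show ?thesis by blast
qed

text \<open>Cramer's rule; the crossed vectors are the dual basis up to the factor \<open>dot u (cross v w)\<close>.\<close>

lemma cramer3:
  "dot u (cross v w) *s x =
     dot (cross v w) x *s u + dot (cross w u) x *s v + dot (cross u v) x *s w"
  by (simp add: vec3_eq_iff dot_def algebra_simps)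

lemma cramer3_dual:
  "dot u (cross v w) *s x = dot x u *s cross v w + dot x v *s cross w u + dot x w *s cross u v"
  by (simp add: vec3_eq_iff dot_def algebra_simps)

lemma dot_nonzero_exists: "u \<noteq> 0 \<Longrightarrow> \<exists>v. dot v u \<noteq> 0"
proof -
  assume "u \<noteq> 0"
  then obtain k where k: "u $ k \<noteq> 0" by (auto simp: vec3_eq_iff)
  have "dot (axis k 1) u = u $ k"
    unfolding dot_sum by (simp add: axis_def if_distrib[where f="\<lambda>x. x * _"] sum.delta cong: if_cong)
  with k show ?thesis by metis
qed

text \<open>A point of the rational normal curve outside finitely many planes.\<close>

lemma dot_avoid:
  assumes "finite A" "0 \<notin> A"
  shows "\<exists>v. \<forall>a\<in>A. dot v a \<noteq> 0"
proof -
  define q where "q a = [:a$1, a$2, a$3:]" for a :: "complex^3"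
  have "finite (\<Union>a\<in>A. {z. poly (q a) z = 0})"
  proof (intro finite_UN_I assms(1))
    fix a assume "a \<in> A"
    then have "a \<noteq> 0" using assms(2) by auto
    then have "q a \<noteq> 0" by (auto simp: q_def vec3_eq_iff)
    then show "finite {z. poly (q a) z = 0}" by (rule poly_roots_finite)
  qed
  then obtain z where z: "z \<notin> (\<Union>a\<in>A. {z. poly (q a) z = 0})"
    using ex_new_if_finite infinite_UNIV_char_0 by blast
  have "dot (vector [1, z, z^2]) a \<noteq> 0" if "a \<in> A" for a
    using z that by (auto simp: q_def dot_def algebra_simps power2_eq_square)
  then show ?thesis by blast
qed

section \<open>Points of the plane and their representatives\<close>

lemma Quotient_cp2: "Quotient3 proportional abs_cp2 rep_cp2"
  by (rule Quotient3_cp2)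

lemma rep_nonzero [simp]: "rep_cp2 P \<noteq> 0"
  using Quotient3_rep_reflp[OF Quotient_cp2, of P] by (simp add: proportional_def)

text \<open>A representative is fixed only up to a nonzero scalar. Coordinates are therefore always
  compared up to one scalar per factor, which preserves the vanishing of forms and the quotients of
  forms of equal multidegree.\<close>

lemma rep_abs:
  assumes "v \<noteq> 0"
  shows "\<exists>c. c \<noteq> 0 \<and> rep_cp2 (abs_cp2 v) = c *s v"
proof -
  have "proportional v v" using assms by (auto simp: proportional_def intro!: exI[of _ 1])
  then have "proportional (rep_cp2 (abs_cp2 v)) v"
    by (rule Quotient3_rep_abs[OF Quotient_cp2])
  then show ?thesis by (auto simp: proportional_def)
qed

lemma cp2_eqI: "rep_cp2 P = c *s rep_cp2 Q \<Longrightarrow> P = Q"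
proof -
  assume "rep_cp2 P = c *s rep_cp2 Q"
  then have "proportional (rep_cp2 P) (rep_cp2 Q)" by (auto simp: proportional_def)
  then show ?thesis by (simp add: Quotient3_rel_rep[OF Quotient_cp2])
qed

lemma abs_cp2_eqI: "rep_cp2 P = c *s v \<Longrightarrow> abs_cp2 v = P"
proof -
  assume a: "rep_cp2 P = c *s v"
  then have n: "v \<noteq> 0" "c \<noteq> 0" using rep_nonzero[of P] by auto
  obtain d where d: "d \<noteq> 0" "rep_cp2 (abs_cp2 v) = d *s v" using rep_abs n by blast
  then have "rep_cp2 (abs_cp2 v) = (d / c) *s rep_cp2 P" using a n by (simp add: vector_smult_assoc)
  then show ?thesis by (rule cp2_eqI)
qed

lemma incident_dot: "incident P L \<longleftrightarrow> dot (rep_cp2 L) (rep_cp2 P) = 0"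
  by (simp add: incident_def dot_sum)

section \<open>Polynomial functions and multiforms\<close>

lemma polyfun_uminus: "polyfun F \<Longrightarrow> polyfun (\<lambda>v. - F v)"
  using polyfun.mult[OF polyfun.const[of "-1"]] by simp

lemma polyfun_diff: "polyfun F \<Longrightarrow> polyfun G \<Longrightarrow> polyfun (\<lambda>v. F v - G v)"
  using polyfun.add[OF _ polyfun_uminus] by simp

lemma polyfun_prod: "(\<And>i. i \<in> A \<Longrightarrow> polyfun (F i)) \<Longrightarrow> polyfun (\<lambda>v. \<Prod>i\<in>A. F i v)"
  by (induction A rule: infinite_finite_induct) (auto intro: polyfun.intros)

lemma polyfun_dot: "polyfun (\<lambda>v. dot a (v i))"
  unfolding dot_def by (intro polyfun.intros)

lemma polyfun_subst:
  assumes "polyfun F" "\<And>i k. polyfun (\<lambda>v. \<Phi> v i $ k)"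
  shows "polyfun (\<lambda>v. F (\<Phi> v))"
  using assms(1) by induction (auto intro: polyfun.intros assms(2))

lemma polyfun_tendsto:
  assumes "polyfun F" "\<And>i. (\<lambda>n. X n i) \<longlonglongrightarrow> L i"
  shows "(\<lambda>n. F (X n)) \<longlonglongrightarrow> F L"
  using assms(1)
  by induction (auto intro!: tendsto_intros assms(2))

lemma polyfun_poly:
  assumes "polyfun F" "\<And>i k. \<exists>q. \<forall>t. \<gamma> t i $ k = poly q t"
  shows "\<exists>q. \<forall>t. F (\<gamma> t) = poly q t"
  using assms(1)
proof induction
  case (const c)
  show ?case by (rule exI[of _ "[:c:]"]) simp
next
  case (coord i k)
  show ?case by (rule assms(2))
next
  case (add F G)
  then obtain p q where "\<forall>t. F (\<gamma> t) = poly p t" "\<forall>t. G (\<gamma> t) = poly q t" by blast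
  then show ?case by (intro exI[of _ "p + q"]) simp
next
  case (mult F G)
  then obtain p q where "\<forall>t. F (\<gamma> t) = poly p t" "\<forall>t. G (\<gamma> t) = poly q t" by blast
  then show ?case by (intro exI[of _ "p * q"]) simp
qed

lemma polyfun_line_poly:
  assumes "polyfun F"
  shows "\<exists>q. \<forall>t. F (\<lambda>i. a i + t *s b i) = poly q t"
proof (rule polyfun_poly[OF assms])
  fix i k
  show "\<exists>q. \<forall>t. (a i + t *s b i) $ k = poly q t"
    by (rule exI[of _ "[:a i $ k, b i $ k:]"]) simp
qed

text \<open>On the line joining \<open>a\<close> and \<open>b\<close> both functions are nonzero
  polynomials in one variable, so their product has a non-root.\<close>

lemma polyfun_generic2:
  assumes F: "polyfun F" "F a \<noteq> 0" and G: "polyfun G" "G b \<noteq> 0"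
  shows "\<exists>v. F v \<noteq> 0 \<and> G v \<noteq> 0"
proof -
  let ?c = "\<lambda>t i. a i + t *s (b i - a i)"
  obtain p q where p: "\<And>t. F (?c t) = poly p t" and q: "\<And>t. G (?c t) = poly q t"
    using polyfun_line_poly[OF F(1)] polyfun_line_poly[OF G(1)] by meson
  have "poly p 0 \<noteq> 0" using F(2) p[of 0] by simp
  moreover have "poly q 1 \<noteq> 0" using G(2) q[of 1] by simp
  ultimately have "p * q \<noteq> 0" by auto
  then have "finite {t. poly (p * q) t = 0}" by (rule poly_roots_finite)
  then obtain t where "poly (p * q) t \<noteq> 0"
    using ex_new_if_finite[OF infinite_UNIV_char_0] by blast
  then have "poly p t \<noteq> 0 \<and> poly q t \<noteq> 0" by simp
  then show ?thesis unfolding p[symmetric] q[symmetric] by (intro exI[of _ "?c t"])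
qed

lemma polyfun_generic:
  assumes "finite S" "\<And>F. F \<in> S \<Longrightarrow> polyfun F" "\<And>F. F \<in> S \<Longrightarrow> \<exists>v. F v \<noteq> 0"
  shows "\<exists>v. \<forall>F\<in>S. F v \<noteq> 0"
  using assms
proof (induction S)
  case empty
  then show ?case by simp
next
  case (insert F S)
  then obtain a where a: "\<forall>F\<in>S. F a \<noteq> 0" by auto
  obtain b where b: "F b \<noteq> 0" using insert.prems(2)[of F] by auto
  have pr: "polyfun (\<lambda>v. \<Prod>G\<in>S. G v)" using insert.prems by (intro polyfun_prod) auto
  have "(\<Prod>G\<in>S. G a) \<noteq> 0" using a insert.hyps by simp
  then obtain v where "(\<Prod>G\<in>S. G v) \<noteq> 0" "F v \<noteq> 0"
    using polyfun_generic2[of "\<lambda>v. \<Prod>G\<in>S. G v" a F b] pr b insert.prems(1)[of F] by auto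
  then show ?case using insert.hyps by auto
qed

lemma multiform_polyfun: "multiform d F \<Longrightarrow> polyfun F"
  by (simp add: multiform_def)

lemma multiform_scale: "multiform d F \<Longrightarrow> F (\<lambda>i. c i *s v i) = (\<Prod>i\<in>UNIV. c i ^ d i) * F v"
  by (simp add: multiform_def)

lemma multiform_scale_0_iff:
  fixes F :: "('i::finite \<Rightarrow> complex^3) \<Rightarrow> complex"
  assumes "multiform d F" "\<And>i. c i \<noteq> 0"
  shows "F (\<lambda>i. c i *s v i) = 0 \<longleftrightarrow> F v = 0"
  using assms by (simp add: multiform_scale)

lemma multiform_const: "multiform (\<lambda>_. 0) (\<lambda>v. c)"
  by (simp add: multiform_def polyfun.const)

lemma multiform_zero: "multiform d (\<lambda>v. 0)"
  by (simp add: multiform_def polyfun.const)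

lemma multiform_add: "multiform d F \<Longrightarrow> multiform d G \<Longrightarrow> multiform d (\<lambda>v. F v + G v)"
  by (auto simp: multiform_def polyfun.add distrib_left)

lemma multiform_diff: "multiform d F \<Longrightarrow> multiform d G \<Longrightarrow> multiform d (\<lambda>v. F v - G v)"
  by (auto simp: multiform_def polyfun_diff right_diff_distrib)

lemma multiform_mult:
  "multiform d F \<Longrightarrow> multiform e G \<Longrightarrow> multiform (\<lambda>i. d i + e i) (\<lambda>v. F v * G v)"
  by (auto simp: multiform_def polyfun.mult power_add prod.distrib)

lemma multiform_cmult: "multiform d F \<Longrightarrow> multiform d (\<lambda>v. c * F v)"
  using multiform_mult[OF multiform_const] by simp

lemma multiform_sum:
  "(\<And>j. j \<in> A \<Longrightarrow> multiform d (F j)) \<Longrightarrow> multiform d (\<lambda>v. \<Sum>j\<in>A. F j v)"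
  by (induction A rule: infinite_finite_induct) (auto intro: multiform_zero multiform_add)

lemma multiform_prod:
  "(\<And>j. j \<in> A \<Longrightarrow> multiform (d j) (F j)) \<Longrightarrow> multiform (\<lambda>i. \<Sum>j\<in>A. d j i) (\<lambda>v. \<Prod>j\<in>A. F j v)"
  by (induction A rule: infinite_finite_induct) (auto intro: multiform_const multiform_mult)

lemma multiform_power: "multiform d F \<Longrightarrow> multiform (\<lambda>i. n * d i) (\<lambda>v. F v ^ n)"
proof (induction n)
  case 0
  then show ?case using multiform_const by simp
next
  case (Suc n)
  then have "multiform (\<lambda>i. d i + n * d i) (\<lambda>v. F v * F v ^ n)" by (intro multiform_mult) auto
  then show ?case by simp
qed

definition unit_deg :: "'i \<Rightarrow> 'i \<Rightarrow> nat" where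
  "unit_deg i = (\<lambda>j. if j = i then 1 else 0)"

lemma multiform_dot:
  fixes i :: "'i::finite"
  shows "multiform (unit_deg i) (\<lambda>v. dot a (v i))"
proof -
  have "(\<Prod>j\<in>UNIV. c j ^ unit_deg i j) = c i" for c :: "'i \<Rightarrow> complex"
  proof -
    have "(\<Prod>j\<in>UNIV. c j ^ unit_deg i j) = (\<Prod>j\<in>UNIV. if j = i then c j else 1)"
      by (rule prod.cong) (auto simp: unit_deg_def)
    then show ?thesis by simp
  qed
  then show ?thesis by (simp add: multiform_def polyfun_dot dot_algebra)
qed

text \<open>Doubling the single factor \<open>i\<close> multiplies the value both by
  \<open>2 ^ d i\<close> and by \<open>2 ^ e i\<close>. This is what makes the multidegrees hidden
  in two order witnesses of the same form agree.\<close>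

lemma multiform_degree_unique:
  fixes F :: "('i::finite \<Rightarrow> complex^3) \<Rightarrow> complex"
  assumes "multiform d F" "multiform e F" "F v \<noteq> 0"
  shows "d = e"
proof
  fix i
  define c where "c j = (if j = i then 2 else 1 :: complex)" for j :: 'i
  have pr: "(\<Prod>j\<in>UNIV. c j ^ d j) = 2 ^ d i" for d :: "'i \<Rightarrow> nat"
  proof -
    have "(\<Prod>j\<in>UNIV. c j ^ d j) = (\<Prod>j\<in>UNIV. if j = i then 2 ^ d j else 1)"
      by (rule prod.cong) (auto simp: c_def)
    then show ?thesis by simp
  qed
  have "2 ^ d i * F v = 2 ^ e i * F v"
    using multiform_scale[OF assms(1), of c v] multiform_scale[OF assms(2), of c v] unfolding pr by (rule trans[OF sym])
  then have "(2::complex) ^ d i = 2 ^ e i" using assms(3) by (metis mult_right_cancel)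
  then have "of_nat (2 ^ d i) = (of_nat (2 ^ e i) :: complex)" by simp
  then show "d i = e i" unfolding of_nat_eq_iff by simp
qed

text \<open>A product of powers of linear forms. It supplies denominators of any prescribed
  multidegree that do not vanish at a given point.\<close>

lemma multiform_nonvanishing_exists:
  fixes x :: "'i::finite \<Rightarrow> complex^3" and d :: "'i \<Rightarrow> nat"
  assumes "\<And>i. x i \<noteq> 0"
  shows "\<exists>G. multiform d G \<and> G x \<noteq> 0"
proof -
  have "\<forall>i. \<exists>a. dot a (x i) \<noteq> 0" using assms dot_nonzero_exists by blast
  then obtain a where a: "\<And>i. dot (a i) (x i) \<noteq> 0" by metis
  have "multiform (\<lambda>j. \<Sum>i\<in>UNIV. d i * unit_deg i j) (\<lambda>v. \<Prod>i\<in>UNIV. dot (a i) (v i) ^ d i)"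
    by (intro multiform_prod multiform_power multiform_dot)
  moreover have "(\<Sum>i\<in>UNIV. d i * unit_deg i j) = d j" for j :: 'i
    by (simp add: unit_deg_def if_distrib[where f="\<lambda>x. _ * x"] cong: if_cong)
  ultimately show ?thesis using a by (intro exI[of _ "\<lambda>v. \<Prod>i\<in>UNIV. dot (a i) (v i) ^ d i"]) simp
qed

section \<open>Zariski closed sets\<close>

lemma coords_nonzero [simp]: "coords x i \<noteq> 0"
  by (simp add: coords_def)

definition vanishes :: "(('i::finite \<Rightarrow> complex^3) \<Rightarrow> complex) \<Rightarrow> ('i \<Rightarrow> cp2) set \<Rightarrow> bool" where
  "vanishes F C \<longleftrightarrow> (\<forall>y\<in>C. F (coords y) = 0)"

lemma zariski_closed_form: "multiform d F \<Longrightarrow> zariski_closed {x. F (coords x) = 0}"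
  unfolding zariski_closed_def by (intro exI[of _ "{F}"]) auto

lemma zariski_closed_not_mem:
  assumes "zariski_closed Z" "x \<notin> Z"
  shows "\<exists>d F. multiform d F \<and> F (coords x) \<noteq> 0 \<and> vanishes F Z"
proof -
  obtain S where S: "\<forall>F\<in>S. \<exists>d. multiform d F" "Z = {x. \<forall>F\<in>S. F (coords x) = 0}"
    using assms(1) unfolding zariski_closed_def by blast
  then obtain F where F: "F \<in> S" "F (coords x) \<noteq> 0" using assms(2) by auto
  moreover have "vanishes F Z" using F(1) S(2) by (simp add: vanishes_def)
  ultimately show ?thesis using S(1) by blast
qed

lemma zariski_closed_Inter:
  assumes "\<And>Z. Z \<in> \<Z> \<Longrightarrow> zariski_closed Z"
  shows "zariski_closed (\<Inter>\<Z>)"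
proof -
  have "\<forall>Z\<in>\<Z>. \<exists>S. (\<forall>F\<in>S. \<exists>d. multiform d F) \<and> Z = {x. \<forall>F\<in>S. F (coords x) = 0}"
    using assms unfolding zariski_closed_def by blast
  from bchoice[OF this] obtain S where
    "\<forall>Z\<in>\<Z>. (\<forall>F\<in>S Z. \<exists>d. multiform d F) \<and> Z = {x. \<forall>F\<in>S Z. F (coords x) = 0}" ..
  then have S: "\<And>Z F. Z \<in> \<Z> \<Longrightarrow> F \<in> S Z \<Longrightarrow> \<exists>d. multiform d F"
      "\<And>Z x. Z \<in> \<Z> \<Longrightarrow> x \<in> Z \<longleftrightarrow> (\<forall>F\<in>S Z. F (coords x) = 0)"
    by blast+
  show ?thesis unfolding zariski_closed_def
  proof (intro exI[of _ "\<Union>(S ` \<Z>)"] conjI)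
    show "\<forall>F\<in>\<Union> (S ` \<Z>). \<exists>d. multiform d F" using S(1) by blast
    show "\<Inter> \<Z> = {x. \<forall>F\<in>\<Union> (S ` \<Z>). F (coords x) = 0}" using S(2) by blast
  qed
qed

lemma zariski_closed_Int: "zariski_closed A \<Longrightarrow> zariski_closed B \<Longrightarrow> zariski_closed (A \<inter> B)"
  using zariski_closed_Inter[of "{A, B}"] by auto

lemma zariski_closed_empty: "zariski_closed {}"
  using zariski_closed_form[OF multiform_const[of 1]] by simp

lemma zariski_closed_Un:
  assumes "zariski_closed A" "zariski_closed B"
  shows "zariski_closed (A \<union> B)"
proof -
  obtain S where S: "\<forall>F\<in>S. \<exists>d. multiform d F" "A = {x. \<forall>F\<in>S. F (coords x) = 0}"
    using assms(1) unfolding zariski_closed_def by blast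
  obtain T where T: "\<forall>F\<in>T. \<exists>d. multiform d F" "B = {x. \<forall>F\<in>T. F (coords x) = 0}"
    using assms(2) unfolding zariski_closed_def by blast
  define P where "P = (\<lambda>(F, G) v. F v * G v) ` (S \<times> T)"
  have P1: "\<exists>d. multiform d H" if HP: "H \<in> P" for H
  proof -
    obtain F G where FG: "F \<in> S" "G \<in> T" "H = (\<lambda>v. F v * G v)" using HP by (auto simp: P_def)
    then obtain d e where "multiform d F" "multiform e G" using S(1) T(1) by blast
    then show ?thesis unfolding FG(3) using multiform_mult by (intro exI[of _ "\<lambda>i. d i + e i"])
  qed
  have P2: "(\<forall>H\<in>P. H (coords x) = 0) \<longleftrightarrow> (\<forall>F\<in>S. \<forall>G\<in>T. F (coords x) * G (coords x) = 0)" for x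
    by (simp add: P_def)
  have "x \<in> A \<union> B \<longleftrightarrow> (\<forall>H\<in>P. H (coords x) = 0)" for x
    unfolding P2 S(2) T(2) mult_eq_0_iff by blast
  then have "A \<union> B = {x. \<forall>H\<in>P. H (coords x) = 0}" by blast
  then show ?thesis unfolding zariski_closed_def using P1 by (intro exI[of _ P]) simp
qed

lemma zariski_closed_UN:
  assumes "finite I" "\<And>i. i \<in> I \<Longrightarrow> zariski_closed (A i)"
  shows "zariski_closed (\<Union>i\<in>I. A i)"
  using assms by (induction I) (auto intro: zariski_closed_empty zariski_closed_Un)

text \<open>The vectors \<open>cross (rep_cp2 P) a\<close> are the lines through \<open>P\<close>; a
  point that lies on all of them is \<open>P\<close>.\<close>

lemma zariski_closed_component: "zariski_closed {x :: 'i::finite \<Rightarrow> cp2. x i = P}"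
proof -
  let ?S = "(\<lambda>a (v :: 'i \<Rightarrow> complex^3). dot (cross (rep_cp2 P) a) (v i)) ` UNIV"
  show ?thesis unfolding zariski_closed_def
  proof (intro exI[of _ ?S] conjI)
    show "\<forall>F\<in>?S. \<exists>d. multiform d F" using multiform_dot by blast
    show "{x. x i = P} = {x. \<forall>F\<in>?S. F (coords x) = 0}"
    proof (intro equalityI subsetI)
      fix x assume "x \<in> {x. \<forall>F\<in>?S. F (coords x) = 0}"
      then have x: "dot (cross (rep_cp2 P) a) (rep_cp2 (x i)) = 0" for a
        by (auto simp: coords_def)
      have "dot a (cross (rep_cp2 (x i)) (rep_cp2 P)) = 0" for a
        using x[of a] by (simp add: dot_def algebra_simps)
      then have "cross (rep_cp2 P) (rep_cp2 (x i)) = 0"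
        using dot_nonzero_exists cross_anticommute by (metis neg_equal_0_iff_equal)
      then have "\<exists>c. rep_cp2 (x i) = c *s rep_cp2 P" by (rule cross_eq_0_imp_scale) simp
      then have "x i = P" using cp2_eqI by blast
      then show "x \<in> {x. x i = P}" by simp
    qed (auto simp: coords_def)
  qed
qed

lemma zariski_closed_point: "zariski_closed {x :: 'i::finite \<Rightarrow> cp2}"
proof -
  have "{x} = \<Inter>((\<lambda>i. {y. y i = x i}) ` UNIV)" by auto
  also have "zariski_closed \<dots>" by (intro zariski_closed_Inter) (auto intro: zariski_closed_component)
  finally show ?thesis .
qed

lemma closed_irreducible_point: "closed_irreducible {x :: 'i::finite \<Rightarrow> cp2}"
  unfolding closed_irreducible_def zariski_irreducible_def using zariski_closed_point by blast

lemma irreducible_UnD: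
  "zariski_irreducible C \<Longrightarrow> zariski_closed A \<Longrightarrow> zariski_closed B \<Longrightarrow> C \<subseteq> A \<union> B \<Longrightarrow> C \<subseteq> A \<or> C \<subseteq> B"
  unfolding zariski_irreducible_def by blast

lemma irreducible_subset_UN:
  assumes "zariski_irreducible C" "finite I" "\<And>i. i \<in> I \<Longrightarrow> zariski_closed (A i)" "C \<subseteq> (\<Union>i\<in>I. A i)"
  shows "\<exists>i\<in>I. C \<subseteq> A i"
  using assms(2-4)
proof (induction I)
  case empty
  then show ?case using assms(1) by (auto simp: zariski_irreducible_def)
next
  case (insert i I)
  have "C \<subseteq> A i \<union> (\<Union>i\<in>I. A i)" using insert.prems by auto
  moreover have "zariski_closed (A i)" "zariski_closed (\<Union>i\<in>I. A i)"
    using insert by (auto intro: zariski_closed_UN)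
  ultimately have "C \<subseteq> A i \<or> C \<subseteq> (\<Union>i\<in>I. A i)"
    using irreducible_UnD[OF assms(1)] by blast
  then show ?case using insert by auto
qed

lemma irreducible_finite_singleton:
  assumes "zariski_irreducible C" "finite C"
  shows "\<exists>x. C = {x}"
proof -
  have "\<exists>x\<in>C. C \<subseteq> {x}"
    using irreducible_subset_UN[OF assms, of "\<lambda>x. {x}"] zariski_closed_point by auto
  then show ?thesis by blast
qed

lemma irreducible_vanishes_mult:
  assumes "zariski_irreducible C" "multiform d F" "multiform e G" "vanishes (\<lambda>v. F v * G v) C"
  shows "vanishes F C \<or> vanishes G C"
proof -
  have "C \<subseteq> {x. F (coords x) = 0} \<union> {x. G (coords x) = 0}" using assms(4) by (auto simp: vanishes_def)
  then have "C \<subseteq> {x. F (coords x) = 0} \<or> C \<subseteq> {x. G (coords x) = 0}"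
    by (rule irreducible_UnD[OF assms(1) zariski_closed_form[OF assms(2)] zariski_closed_form[OF assms(3)]])
  then show ?thesis by (auto simp: vanishes_def)
qed

text \<open>Nonempty open subsets of an irreducible set are dense. Identities between regular
  functions are checked below off the zeros of the denominators and then extended in this
  way.\<close>

lemma irreducible_vanishes_off:
  assumes "zariski_irreducible C" "multiform d F" "zariski_closed Z" "\<not> C \<subseteq> Z"
    "\<And>y. y \<in> C \<Longrightarrow> y \<notin> Z \<Longrightarrow> F (coords y) = 0"
  shows "vanishes F C"
proof -
  have "C \<subseteq> {x. F (coords x) = 0} \<union> Z" using assms(5) by auto
  then have "C \<subseteq> {x. F (coords x) = 0}"
    using irreducible_UnD[OF assms(1) zariski_closed_form[OF assms(2)] assms(3)] assms(4) by blast
  then show ?thesis by (auto simp: vanishes_def)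
qed

section \<open>Bivariate polynomials\<close>

text \<open>The outer variable of a \<open>complex poly poly\<close> is \<open>t\<close>, the inner one \<open>s\<close>.\<close>

definition ev :: "complex poly poly \<Rightarrow> complex \<Rightarrow> complex \<Rightarrow> complex" where
  "ev q s t = poly (poly q [:t:]) s"

lemma ev_simps [simp]:
  "ev 0 s t = 0" "ev 1 s t = 1"
  "ev (p + q) s t = ev p s t + ev q s t"
  "ev (p - q) s t = ev p s t - ev q s t"
  "ev (- p) s t = - ev p s t"
  "ev (p * q) s t = ev p s t * ev q s t"
  "ev (p ^ n) s t = ev p s t ^ n"
  "ev (pCons c q) s t = poly c s + t * ev q s t"
  "ev (smult c q) s t = poly c s * ev q s t"
  by (simp_all add: ev_def)

text \<open>Over the ring of polynomials in \<open>s\<close>, a nonzero \<open>q\<close> has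
  finitely many roots, whereas every constant \<open>[:t:]\<close> would be one.\<close>

lemma ev_eq_0_imp:
  assumes "\<And>s t. ev q s t = 0"
  shows "q = 0"
proof (rule ccontr)
  assume "q \<noteq> 0"
  then have fin: "finite {z. poly q z = 0}" by (rule poly_roots_finite)
  have "poly q [:t:] = 0" for t
    using assms unfolding ev_def by (metis poly_all_0_iff_0)
  then have "range (\<lambda>t. [:t:]) \<subseteq> {z. poly q z = 0}" by auto
  then have "finite (range (\<lambda>t::complex. [:t:]))" using fin finite_subset by blast
  moreover have "inj (\<lambda>t::complex. [:t:])" by (simp add: inj_on_def)
  ultimately show False using finite_imageD infinite_UNIV_char_0 by blast
qed

lemma polyfun_ev:
  assumes "polyfun F" "\<And>i k. \<exists>q. \<forall>s t. \<gamma> s t i $ k = ev q s t"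
  shows "\<exists>q. \<forall>s t. F (\<gamma> s t) = ev q s t"
  using assms(1)
proof induction
  case (const c)
  show ?case by (rule exI[of _ "[:[:c:]:]"]) simp
next
  case (coord i k)
  show ?case by (rule assms(2))
next
  case (add F G)
  then obtain p q where "\<forall>s t. F (\<gamma> s t) = ev p s t" "\<forall>s t. G (\<gamma> s t) = ev q s t" by blast
  then show ?case by (intro exI[of _ "p + q"]) simp
next
  case (mult F G)
  then obtain p q where "\<forall>s t. F (\<gamma> s t) = ev p s t" "\<forall>s t. G (\<gamma> s t) = ev q s t" by blast
  then show ?case by (intro exI[of _ "p * q"]) simp
qed

lemma poly_comp_ev: "\<exists>q. \<forall>s t. ev q s t = poly c (ev X s t)"
proof (induction c)
  case 0
  show ?case by (rule exI[of _ 0]) simp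
next
  case (pCons a c)
  then obtain q where "\<forall>s t. ev q s t = poly c (ev X s t)" by blast
  then show ?case by (intro exI[of _ "[:[:a:]:] + X * q"]) simp
qed

definition vanishing_ideal :: "(complex \<times> complex) set \<Rightarrow> complex poly poly set" where
  "vanishing_ideal V = {q. \<forall>(s, t)\<in>V. ev q s t = 0}"

lemma vanishing_ideal_memD: "q \<in> vanishing_ideal V \<Longrightarrow> (s, t) \<in> V \<Longrightarrow> ev q s t = 0"
  by (auto simp: vanishing_ideal_def)

lemma vanishing_ideal_mult: "q \<in> vanishing_ideal V \<Longrightarrow> p * q \<in> vanishing_ideal V"
  by (auto simp: vanishing_ideal_def split: prod.splits)

lemma vanishing_ideal_diff:
  "q \<in> vanishing_ideal V \<Longrightarrow> p \<in> vanishing_ideal V \<Longrightarrow> p - q \<in> vanishing_ideal V"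
  by (auto simp: vanishing_ideal_def split: prod.splits)

definition prime_set :: "(complex \<times> complex) set \<Rightarrow> bool" where
  "prime_set V \<longleftrightarrow> V \<noteq> {} \<and>
     (\<forall>p q. p * q \<in> vanishing_ideal V \<longrightarrow> p \<in> vanishing_ideal V \<or> q \<in> vanishing_ideal V)"

text \<open>Over the complex numbers \<open>c\<close> splits into linear factors, and a prime ideal
  that contains the product of the \<open>X - a\<close> over the roots contains one of them. So a
  function that is algebraic over the constants is constant on \<open>V\<close>.\<close>

lemma prime_set_value:
  assumes V: "prime_set V"
  shows "c \<noteq> 0 \<Longrightarrow> (\<forall>(s, t)\<in>V. poly c (ev X s t) = 0) \<Longrightarrow> \<exists>a. \<forall>(s, t)\<in>V. ev X s t = a"
proof (induction "degree c" arbitrary: c)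
  case 0
  then obtain k where "c = [:k:]" by (metis degree_eq_zeroE)
  with 0 V show ?case by (auto simp: prime_set_def)
next
  case (Suc n)
  then have "\<not> constant (poly c)" by (simp add: constant_degree)
  then obtain a where "poly c a = 0" using fundamental_theorem_of_algebra by blast
  then obtain c' where c': "c = [:-a, 1:] * c'" by (auto simp: poly_eq_0_iff_dvd)
  have n0: "c' \<noteq> 0" using c' Suc.prems(1) by auto
  then have "degree c = degree [:-a, 1:] + degree c'"
    unfolding c' by (intro degree_mult_eq) auto
  then have n: "c' \<noteq> 0" "degree c' = n" using Suc.hyps(2) n0 by auto
  obtain q where q: "\<forall>s t. ev q s t = poly c' (ev X s t)" using poly_comp_ev by blast
  have "(X - [:[:a:]:]) * q \<in> vanishing_ideal V"
    using Suc.prems(2) c' q by (auto simp: vanishing_ideal_def algebra_simps split: prod.splits)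
  then consider "X - [:[:a:]:] \<in> vanishing_ideal V" | "q \<in> vanishing_ideal V"
    using V unfolding prime_set_def by blast
  then show ?case
  proof cases
    case 1
    then show ?thesis by (intro exI[of _ a]) (auto simp: vanishing_ideal_def split: prod.splits)
  next
    case 2
    then have "\<forall>(s, t)\<in>V. poly c' (ev X s t) = 0" using q by (auto simp: vanishing_ideal_def)
    then show ?thesis using Suc.hyps(1)[of c'] n by auto
  qed
qed

lemma prime_elem_linear: "prime_elem [:[:- a, 1:]:]" for a :: complex
proof -
  have "irreducible [:- a, 1:]" by (rule irreducible_linear_field_poly) simp
  then have "prime_elem [:- a, 1:]" by (rule irreducible_imp_prime_elem)
  then show ?thesis by (simp add: prime_elem_const_poly_iff)
qed

text \<open>A form of Gauss's lemma. The linear factors of \<open>c\<close> are removed one at a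
  time: each is a prime in \<open>s\<close> alone that does not divide \<open>f\<close>, so it
  divides the cofactor \<open>q\<close>.\<close>

lemma dvd_strip_const:
  fixes f g :: "complex poly poly"
  assumes nd: "\<And>a. \<not> [:[:- a, 1:]:] dvd f"
  shows "c \<noteq> 0 \<Longrightarrow> smult c g = f * q \<Longrightarrow> f dvd g"
proof (induction "degree c" arbitrary: c q)
  case 0
  then obtain k where k: "c = [:k:]" by (metis degree_eq_zeroE)
  with 0 have "k \<noteq> 0" by auto
  then have "[:1 / k:] * c = 1" using k by (simp add: one_pCons)
  then have "smult [:1 / k:] (smult c g) = g" by (simp only: smult_smult smult_1_left)
  then have "g = f * smult [:1 / k:] q" using 0 by simp
  then show ?case by (rule dvdI)
next
  case (Suc n)
  then have "\<not> constant (poly c)" by (simp add: constant_degree)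
  then obtain a where "poly c a = 0" using fundamental_theorem_of_algebra by blast
  then obtain c' where c': "c = [:-a, 1:] * c'" by (auto simp: poly_eq_0_iff_dvd)
  have n0: "c' \<noteq> 0" using c' Suc.prems(1) by auto
  then have "degree c = degree [:-a, 1:] + degree c'"
    unfolding c' by (intro degree_mult_eq) auto
  then have n: "c' \<noteq> 0" "degree c' = n" using Suc.hyps(2) n0 by auto
  have "f * q = [:[:- a, 1:]:] * smult c' g" using Suc.prems(2) c' by simp
  then have "[:[:- a, 1:]:] dvd f * q" by (metis dvd_triv_left)
  then have "[:[:- a, 1:]:] dvd q"
    using prime_elem_dvd_mult_iff[OF prime_elem_linear] nd by blast
  then obtain q' where q': "q = [:[:- a, 1:]:] * q'" by (rule dvdE)
  have "[:[:- a, 1:]:] * smult c' g = [:[:- a, 1:]:] * (f * q')"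
    using \<open>f * q = _\<close> q' by (simp only: mult.left_commute)
  then have "smult c' g = f * q'" by (subst (asm) mult_left_cancel) auto
  then show ?case using Suc.hyps(1)[of c'] n by auto
qed

text \<open>Height-one primes are principal: pseudo-division by an element of least degree in \<open>t\<close>.\<close>

lemma prime_set_principal:
  assumes V: "prime_set V" and ns: "\<And>a b. V \<noteq> {(a, b)}" and nz: "p \<in> vanishing_ideal V" "p \<noteq> 0"
  shows "\<exists>f. f \<noteq> 0 \<and> (\<forall>q. q \<in> vanishing_ideal V \<longleftrightarrow> f dvd q)"
proof (cases "\<exists>c. c \<noteq> 0 \<and> [:c:] \<in> vanishing_ideal V")
  case True
  then obtain c where c: "c \<noteq> 0" "[:c:] \<in> vanishing_ideal V" by blast
  have "\<forall>(s, t)\<in>V. poly c (ev [:[:0, 1:]:] s t) = 0"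
    using c(2) by (auto simp: vanishing_ideal_def)
  then have "\<exists>a. \<forall>(s, t)\<in>V. ev [:[:0, 1:]:] s t = a" by (rule prime_set_value[OF V c(1)])
  \<comment> \<open>\<open>V\<close> lies on the line \<open>s = a\<close>, and the generator of its
    ideal will be \<open>s - a\<close>.\<close>
  then obtain a where a: "\<And>s t. (s, t) \<in> V \<Longrightarrow> s = a" by auto
  have "[:[:-a, 1:]:] dvd q" if q: "q \<in> vanishing_ideal V" for q
  proof -
    define g where "g = map_poly (\<lambda>c. poly c a) q"
    have g: "poly g t = ev q a t" for t
      unfolding g_def by (induction q) (auto simp: map_poly_pCons)
    \<comment> \<open>\<open>g\<close> is the restriction of \<open>q\<close> to the line
      \<open>s = a\<close>. If it were nonzero, \<open>t\<close> too would take a single value on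
      \<open>V\<close>, and \<open>V\<close> would be a point.\<close>
    have "g = 0"
    proof (rule ccontr)
      assume "g \<noteq> 0"
      moreover have "\<forall>(s, t)\<in>V. poly g (ev [:0, 1:] s t) = 0"
        using q a by (auto simp: g dest: vanishing_ideal_memD)
      ultimately have "\<exists>b. \<forall>(s, t)\<in>V. ev [:0, 1:] s t = b" by (rule prime_set_value[OF V])
      then obtain b where "\<And>s t. (s, t) \<in> V \<Longrightarrow> t = b" by auto
      then have "V \<subseteq> {(a, b)}" using a by auto
      then have "V = {(a, b)}" using V by (auto simp: prime_set_def)
      then show False using ns by blast
    qed
    then have "poly (coeff q n) a = 0" for n
      by (metis coeff_0 coeff_map_poly g_def poly_0)
    then have "[:- a, 1:] dvd coeff q n" for n by (simp add: poly_eq_0_iff_dvd)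
    then show ?thesis by (simp add: const_poly_dvd_iff)
  qed
  moreover have "q \<in> vanishing_ideal V" if "[:[:-a, 1:]:] dvd q" for q
    using that a by (auto simp: vanishing_ideal_def elim!: dvdE)
  ultimately show ?thesis by (intro exI[of _ "[:[:-a, 1:]:]"]) auto
next
  case False
  let ?S = "vanishing_ideal V - {0}"
  have "\<exists>n. \<exists>f\<in>?S. degree f = n" using nz by blast
  define n where "n = (LEAST n. \<exists>f\<in>?S. degree f = n)"
  have "\<exists>f\<in>?S. degree f = n" unfolding n_def by (rule LeastI_ex) fact
  then have ex: "\<exists>m. \<exists>f\<in>?S. degree f = n \<and> degree (lead_coeff f) = m" by blast
  have n_le: "n \<le> degree f" if "f \<in> ?S" for f
    unfolding n_def using that by (intro Least_le) blast
  \<comment> \<open>Among the elements of least degree in \<open>t\<close>, the least degree of the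
    leading coefficient rules out a factor \<open>s - a\<close>: primality would allow it to be
    cancelled, giving a smaller element.\<close>
  define m where "m = (LEAST m. \<exists>f\<in>?S. degree f = n \<and> degree (lead_coeff f) = m)"
  have "\<exists>f\<in>?S. degree f = n \<and> degree (lead_coeff f) = m" unfolding m_def by (rule LeastI_ex) fact
  then obtain f where f: "f \<in> vanishing_ideal V" "f \<noteq> 0" "degree f = n" "degree (lead_coeff f) = m"
    by blast
  have m_le: "m \<le> degree (lead_coeff f)" if "f \<in> ?S" "degree f = n" for f
    unfolding m_def using that by (intro Least_le) blast
  have nd: "\<not> [:[:- a, 1:]:] dvd f" for a
  proof
    assume "[:[:- a, 1:]:] dvd f"
    then obtain f' where f': "f = [:[:- a, 1:]:] * f'" by (rule dvdE)
    have "[:- a, 1:] \<noteq> 0" by simp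
    then have "[:[:- a, 1:]:] \<notin> vanishing_ideal V" using False by blast
    then have "f' \<in> vanishing_ideal V" using f(1) f' V unfolding prime_set_def by blast
    moreover have "f' \<noteq> 0" "degree f' = n" using f f' by auto
    moreover have "lead_coeff f = [:- a, 1:] * lead_coeff f'" using f' by simp
    then have "degree (lead_coeff f) = Suc (degree (lead_coeff f'))"
      using \<open>f' \<noteq> 0\<close> by (simp add: degree_mult_eq del: mult_pCons_left)
    ultimately show False using m_le[of f'] f(4) by auto
  qed
  have "f dvd q" if q: "q \<in> vanishing_ideal V" for q
  proof -
    obtain a b where ab: "a \<noteq> 0" "smult a q = f * b + pseudo_mod q f"
      and r: "pseudo_mod q f = 0 \<or> degree (pseudo_mod q f) < degree f"
      using pseudo_mod[of f q] f(2) by blast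
    have "pseudo_mod q f = [:a:] * q - b * f" using ab(2) by simp
    then have "pseudo_mod q f \<in> vanishing_ideal V"
      using vanishing_ideal_diff vanishing_ideal_mult q f(1) by metis
    then have "pseudo_mod q f = 0" using r n_le f(3) by fastforce
    then show ?thesis using dvd_strip_const[OF nd ab(1)] ab(2) by simp
  qed
  moreover have "q \<in> vanishing_ideal V" if "f dvd q" for q
    using that f(1) vanishing_ideal_mult by (metis dvdE mult.commute)
  ultimately show ?thesis using f(2) by blast
qed

lemma principal_prime_elem:
  assumes "prime_set V" "f \<noteq> 0" "\<And>q. q \<in> vanishing_ideal V \<longleftrightarrow> f dvd q"
  shows "prime_elem f"
proof (rule prime_elemI)
  show "f \<noteq> 0" by fact
  show "\<not> is_unit f"
  proof
    assume "is_unit f"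
    then have "1 \<in> vanishing_ideal V" using assms(3) by blast
    then show False using assms(1) by (auto simp: vanishing_ideal_def prime_set_def)
  qed
  show "f dvd a \<or> f dvd b" if "f dvd a * b" for a b
    using that assms(1,3) unfolding prime_set_def by blast
qed

section \<open>Regular functions\<close>

lemma regular_ratio:
  "multiform d F \<Longrightarrow> multiform d G \<Longrightarrow> G (coords x) \<noteq> 0 \<Longrightarrow>
    regular_at X x (\<lambda>y. F (coords y) / G (coords y))"
  unfolding regular_at_def by blast

lemma regular_const: "regular_at X x (\<lambda>y. c)"
  using regular_ratio[OF multiform_const[of c] multiform_const[of 1]] by simp

lemma regular_add:
  assumes "regular_at X x f" "regular_at X x g"
  shows "regular_at X x (\<lambda>y. f y + g y)"
proof -
  obtain d F G where f: "multiform d F" "multiform d G" "G (coords x) \<noteq> 0"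
      "\<forall>y\<in>X. G (coords y) \<noteq> 0 \<longrightarrow> f y = F (coords y) / G (coords y)"
    using assms(1) unfolding regular_at_def by blast
  obtain e F' G' where g: "multiform e F'" "multiform e G'" "G' (coords x) \<noteq> 0"
      "\<forall>y\<in>X. G' (coords y) \<noteq> 0 \<longrightarrow> g y = F' (coords y) / G' (coords y)"
    using assms(2) unfolding regular_at_def by blast
  show ?thesis unfolding regular_at_def
  proof (intro exI conjI)
    show "multiform (\<lambda>i. d i + e i) (\<lambda>v. F v * G' v + G v * F' v)"
      by (intro multiform_add multiform_mult f g)
    show "multiform (\<lambda>i. d i + e i) (\<lambda>v. G v * G' v)"
      by (intro multiform_mult f g)
  qed (use f g in \<open>auto simp: field_simps\<close>)
qed

lemma regular_mult:
  assumes "regular_at X x f" "regular_at X x g"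
  shows "regular_at X x (\<lambda>y. f y * g y)"
proof -
  obtain d F G where f: "multiform d F" "multiform d G" "G (coords x) \<noteq> 0"
      "\<forall>y\<in>X. G (coords y) \<noteq> 0 \<longrightarrow> f y = F (coords y) / G (coords y)"
    using assms(1) unfolding regular_at_def by blast
  obtain e F' G' where g: "multiform e F'" "multiform e G'" "G' (coords x) \<noteq> 0"
      "\<forall>y\<in>X. G' (coords y) \<noteq> 0 \<longrightarrow> g y = F' (coords y) / G' (coords y)"
    using assms(2) unfolding regular_at_def by blast
  show ?thesis unfolding regular_at_def
  proof (intro exI conjI)
    show "multiform (\<lambda>i. d i + e i) (\<lambda>v. F v * F' v)"
      by (intro multiform_mult f g)
    show "multiform (\<lambda>i. d i + e i) (\<lambda>v. G v * G' v)"
      by (intro multiform_mult f g)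
  qed (use f g in auto)
qed

lemma regular_inverse:
  assumes "regular_at X x f" "x \<in> X" "f x \<noteq> 0"
  shows "regular_at X x (\<lambda>y. 1 / f y)"
proof -
  obtain d F G where f: "multiform d F" "multiform d G" "G (coords x) \<noteq> 0"
      "\<forall>y\<in>X. G (coords y) \<noteq> 0 \<longrightarrow> f y = F (coords y) / G (coords y)"
    using assms(1) unfolding regular_at_def by blast
  \<comment> \<open>The inverse is written as \<open>G * G / (F * G)\<close>: with the extra factor
    \<open>G\<close>, a nonzero denominator guarantees that \<open>f = F / G\<close> holds at the
    point.\<close>
  show ?thesis unfolding regular_at_def
  proof (intro exI conjI)
    show "multiform (\<lambda>i. d i + d i) (\<lambda>v. G v * G v)"
      by (intro multiform_mult f)
    show "multiform (\<lambda>i. d i + d i) (\<lambda>v. F v * G v)"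
      by (intro multiform_mult f)
  qed (use f assms in auto)
qed

lemma regular_ev:
  assumes "regular_at X x \<sigma>" "regular_at X x \<tau>"
  shows "regular_at X x (\<lambda>y. ev q (\<sigma> y) (\<tau> y))"
proof (induction q)
  case 0
  show ?case by (simp add: regular_const)
next
  case (pCons c q)
  have "regular_at X x (\<lambda>y. poly c (\<sigma> y))"
    by (induction c) (simp_all add: regular_const regular_add regular_mult assms)
  then show ?case using pCons by (simp add: regular_add regular_mult assms)
qed

section \<open>The order along a curve is well defined\<close>

text \<open>Vanishing on \<open>C\<close> near one point \<open>x\<close> spreads over
  \<open>C\<close> by density. The numerator is thus a global form vanishing on \<open>C\<close>,
  which can be carried to the local ring at another point.\<close>

lemma curve_ideal_numerator:
  assumes C: "zariski_irreducible C" "C \<subseteq> X" "x \<in> C"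
    and f: "near C x (\<lambda>y. f y = 0)"
      "\<And>y. y \<in> X \<Longrightarrow> B (coords y) \<noteq> 0 \<Longrightarrow> f y = A (coords y) / B (coords y)"
      "multiform d A" "multiform e B" "B (coords x) \<noteq> 0"
  shows "vanishes A C"
proof -
  obtain Z where Z: "zariski_closed Z" "x \<notin> Z" "\<forall>y\<in>C - Z. f y = 0"
    using f(1) unfolding near_def by blast
  show ?thesis
  proof (rule irreducible_vanishes_off[OF C(1) f(3)])
    show "zariski_closed (Z \<union> {y. B (coords y) = 0})"
      by (intro zariski_closed_Un Z(1) zariski_closed_form[OF f(4)])
    show "\<not> C \<subseteq> Z \<union> {y. B (coords y) = 0}" using Z(2) f(5) C(3) by auto
    fix y assume y: "y \<in> C" "y \<notin> Z \<union> {y. B (coords y) = 0}"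
    then have "f y = 0" "B (coords y) \<noteq> 0" using Z(3) by auto
    then show "A (coords y) = 0" using f(2)[of y] y C(2) by auto
  qed
qed

lemma ratio_in_curve_ideal:
  assumes "multiform d A" "multiform d B" "B (coords x) \<noteq> 0" "vanishes A C"
  shows "(\<lambda>y. A (coords y) / B (coords y)) \<in> curve_ideal X C x"
proof -
  have "near C x (\<lambda>y. A (coords y) / B (coords y) = 0)"
    unfolding near_def using assms(4) zariski_closed_empty by (intro exI[of _ "{}"]) (auto simp: vanishes_def)
  then show ?thesis using regular_ratio[OF assms(1-3)] by (simp add: curve_ideal_def)
qed

lemma local_equation_in_ideal: "local_equation X C x h \<Longrightarrow> h \<in> curve_ideal X C x"
proof -
  assume h: "local_equation X C x h"
  have "near X x (\<lambda>y. h y = h y * 1)"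
    unfolding near_def using zariski_closed_empty by (intro exI[of _ "{}"]) auto
  then show ?thesis using h regular_const[of X x 1] unfolding local_equation_def by blast
qed

lemma local_equationD:
  assumes "local_equation X C x h" "f \<in> curve_ideal X C x"
  shows "\<exists>k Z. regular_at X x k \<and> zariski_closed Z \<and> x \<notin> Z \<and> (\<forall>y\<in>X - Z. f y = h y * k y)"
proof -
  have "f \<in> {f. regular_at X x f \<and> (\<exists>g. regular_at X x g \<and> near X x (\<lambda>y. f y = h y * g y))}"
    using assms unfolding local_equation_def by blast
  then obtain k where k: "regular_at X x k" "near X x (\<lambda>y. f y = h y * k y)" by blast
  from k(2) obtain Z where "zariski_closed Z" "x \<notin> Z" "\<forall>y\<in>X - Z. f y = h y * k y"
    unfolding near_def by (elim exE conjE)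
  then show ?thesis using k(1) by blast
qed

definition order_witness ::
  "('i::finite \<Rightarrow> cp2) set \<Rightarrow> ('i \<Rightarrow> cp2) set \<Rightarrow> (('i \<Rightarrow> complex^3) \<Rightarrow> complex) \<Rightarrow> nat \<Rightarrow> bool" where
  "order_witness X C F n \<longleftrightarrow> (\<exists>x\<in>C. \<exists>d G h g. multiform d F \<and> multiform d G \<and> G (coords x) \<noteq> 0 \<and>
        local_equation X C x h \<and> regular_at X x g \<and> g \<notin> curve_ideal X C x \<and>
        near X x (\<lambda>y. F (coords y) / G (coords y) = h y ^ n * g y))"

lemma order_along_witness: "order_along X C F = (THE n. order_witness X C F n)"
  unfolding order_along_def order_witness_def by simp

text \<open>
  Two witnesses may live at different points of \<open>C\<close>; they are compared at a general point of \<open>C\<close>,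
  where both local equations divide each other.
\<close>

lemma order_witness_not_less:
  fixes X :: "('i::finite \<Rightarrow> cp2) set"
  assumes X: "zariski_irreducible X" and C: "closed_irreducible C" "C \<subseteq> X" "\<not> X \<subseteq> C"
    and F: "\<not> vanishes F X"
    and w: "order_witness X C F n" "order_witness X C F n'"
  shows "\<not> n < n'"
proof
  assume less: "n < n'"
  have Ci: "zariski_irreducible C" and Cc: "zariski_closed C"
    using C(1) by (auto simp: closed_irreducible_def)
  obtain x d G h g Z where w1: "x \<in> C" "multiform d F" "multiform d G" "G (coords x) \<noteq> 0"
    "local_equation X C x h" "regular_at X x g" "g \<notin> curve_ideal X C x"
    and Z: "zariski_closed Z" "x \<notin> Z" "\<And>y. y \<in> X \<Longrightarrow> y \<notin> Z \<Longrightarrow> F (coords y) / G (coords y) = h y ^ n * g y"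
    using w(1) unfolding order_witness_def near_def by blast
  obtain x' d' G' h' g' Z' where w2: "x' \<in> C" "multiform d' F" "multiform d' G'" "G' (coords x') \<noteq> 0"
    "local_equation X C x' h'" "regular_at X x' g'" "g' \<notin> curve_ideal X C x'"
    and Z': "zariski_closed Z'" "x' \<notin> Z'"
      "\<And>y. y \<in> X \<Longrightarrow> y \<notin> Z' \<Longrightarrow> F (coords y) / G' (coords y) = h' y ^ n' * g' y"
    using w(2) unfolding order_witness_def near_def by blast
  have xX: "x \<in> X" "x' \<in> X" using w1(1) w2(1) C(2) by auto
  have dd: "d' = d" using F w1(2) w2(2) multiform_degree_unique unfolding vanishes_def by blast
  have h'I: "h' \<in> curve_ideal X C x'" using w2(5) by (rule local_equation_in_ideal)
  then obtain e A B where AB: "multiform e A" "multiform e B" "B (coords x') \<noteq> 0"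
    "\<And>y. y \<in> X \<Longrightarrow> B (coords y) \<noteq> 0 \<Longrightarrow> h' y = A (coords y) / B (coords y)"
    unfolding curve_ideal_def regular_at_def by blast
  have AC: "vanishes A C"
    by (rule curve_ideal_numerator[OF Ci C(2) w2(1) _ AB(4) AB(1,2,3)])
       (use h'I in \<open>simp_all add: curve_ideal_def\<close>)
  \<comment> \<open>The numerator \<open>A\<close> of \<open>h'\<close> is carried from
    \<open>x'\<close> to \<open>x\<close> by a new denominator \<open>B2\<close>; at
    \<open>x\<close> it is divisible by \<open>h\<close>.\<close>
  obtain B2 where B2: "multiform e B2" "B2 (coords x) \<noteq> 0"
    using multiform_nonvanishing_exists[of "coords x" e] by auto
  have "(\<lambda>y. A (coords y) / B2 (coords y)) \<in> curve_ideal X C x"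
    by (rule ratio_in_curve_ideal[OF AB(1) B2 AC])
  then obtain k Y where k: "regular_at X x k"
    and Y: "zariski_closed Y" "x \<notin> Y" "\<And>y. y \<in> X \<Longrightarrow> y \<notin> Y \<Longrightarrow> A (coords y) / B2 (coords y) = h y * k y"
    using local_equationD[OF w1(5)] by blast
  have hI: "h \<in> curve_ideal X C x" using w1(5) by (rule local_equation_in_ideal)
  then obtain eh H1 H2 where H: "multiform eh H1" "multiform eh H2" "H2 (coords x) \<noteq> 0"
    "\<And>y. y \<in> X \<Longrightarrow> H2 (coords y) \<noteq> 0 \<Longrightarrow> h y = H1 (coords y) / H2 (coords y)"
    unfolding curve_ideal_def regular_at_def by blast
  have HC: "vanishes H1 C"
    by (rule curve_ideal_numerator[OF Ci C(2) w1(1) _ H(4) H(1,2,3)])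
       (use hI in \<open>simp_all add: curve_ideal_def\<close>)
  obtain ek K1 K2 where K: "multiform ek K1" "multiform ek K2" "K2 (coords x) \<noteq> 0"
    "\<And>y. y \<in> X \<Longrightarrow> K2 (coords y) \<noteq> 0 \<Longrightarrow> k y = K1 (coords y) / K2 (coords y)"
    using k unfolding regular_at_def by blast
  obtain eg M1 M2 where M: "multiform eg M1" "multiform eg M2" "M2 (coords x) \<noteq> 0"
    "\<And>y. y \<in> X \<Longrightarrow> M2 (coords y) \<noteq> 0 \<Longrightarrow> g y = M1 (coords y) / M2 (coords y)"
    using w1(6) unfolding regular_at_def by blast
  obtain eg' N1 N2 where N: "multiform eg' N1" "multiform eg' N2" "N2 (coords x') \<noteq> 0"
    "\<And>y. y \<in> X \<Longrightarrow> N2 (coords y) \<noteq> 0 \<Longrightarrow> g' y = N1 (coords y) / N2 (coords y)"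
    using w2(6) unfolding regular_at_def by blast
  define W1 where "W1 = Z \<union> Y \<union> {y. G (coords y) = 0} \<union> {y. B2 (coords y) = 0} \<union> {y. H2 (coords y) = 0}
    \<union> {y. K2 (coords y) = 0} \<union> {y. M2 (coords y) = 0}"
  define W2 where "W2 = Z' \<union> {y. G' (coords y) = 0} \<union> {y. B (coords y) = 0} \<union> {y. N2 (coords y) = 0}"
  have W1: "zariski_closed W1" "x \<notin> W1"
    unfolding W1_def using Z Y w1 B2 H K M by (auto intro!: zariski_closed_Un zariski_closed_form)
  have W2: "zariski_closed W2" "x' \<notin> W2"
    unfolding W2_def using Z' w2 AB N by (auto intro!: zariski_closed_Un zariski_closed_form)
  have CW: "\<not> C \<subseteq> W1 \<union> W2"
    using irreducible_UnD[OF Ci W1(1) W2(1)] W1(2) W2(2) w1(1) w2(1) by blast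
  \<comment> \<open>If the numerator of \<open>h\<close> vanished on \<open>X\<close>, then
    \<open>h\<close> and all its multiples would vanish near \<open>x\<close>. But a form that
    vanishes on \<open>C\<close> and not on \<open>X\<close> gives a nonzero element of the ideal of
    \<open>C\<close> at \<open>x\<close>.\<close>
  have HX: "\<not> vanishes H1 X"
  proof
    assume H0: "vanishes H1 X"
    obtain z where z: "z \<in> X" "z \<notin> C" using C(3) by blast
    obtain e P where P: "multiform e P" "P (coords z) \<noteq> 0" "vanishes P C"
      using zariski_closed_not_mem[OF Cc z(2)] by blast
    obtain Q where Q: "multiform e Q" "Q (coords x) \<noteq> 0"
      using multiform_nonvanishing_exists[of "coords x" e] by auto
    have "(\<lambda>y. P (coords y) / Q (coords y)) \<in> curve_ideal X C x"
      by (rule ratio_in_curve_ideal[OF P(1) Q P(3)])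
    then obtain l U where U: "zariski_closed U" "x \<notin> U"
        "\<And>y. y \<in> X \<Longrightarrow> y \<notin> U \<Longrightarrow> P (coords y) / Q (coords y) = h y * l y"
      using local_equationD[OF w1(5)] by blast
    have "vanishes P X"
    proof (rule irreducible_vanishes_off[OF X P(1)])
      show "zariski_closed (U \<union> {y. Q (coords y) = 0} \<union> {y. H2 (coords y) = 0})"
        using U(1) Q(1) H(2) by (auto intro!: zariski_closed_Un zariski_closed_form)
      show "\<not> X \<subseteq> U \<union> {y. Q (coords y) = 0} \<union> {y. H2 (coords y) = 0}"
        using U(2) Q(2) H(3) xX by auto
      fix y assume y: "y \<in> X" "y \<notin> U \<union> {y. Q (coords y) = 0} \<union> {y. H2 (coords y) = 0}"
      then have "h y = 0" using H(4)[of y] H0 by (auto simp: vanishes_def)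
      then show "P (coords y) = 0" using U(3)[of y] y by auto
    qed
    then show False using P(2) z(1) by (simp add: vanishes_def)
  qed
  define r where "r = n' - n"
  have r: "n' = n + r" "r > 0" using less by (auto simp: r_def)
  \<comment> \<open>Equating the two expressions for \<open>F\<close> and cancelling
    \<open>h ^ n\<close> gives \<open>G * g = G' * h ^ r * (k * B2 / B) ^ n' * g'\<close>. Clearing
    all denominators turns the difference of the two sides into the form \<open>\<Delta>\<close>,
    which vanishes on \<open>X\<close>. On \<open>C\<close> the second summand is zero because
    \<open>H1\<close> vanishes there and \<open>r > 0\<close>; this forces \<open>M1\<close>, the
    numerator of \<open>g\<close>, to vanish on \<open>C\<close>.\<close>
  define \<Delta> where "\<Delta> v = M1 v * G v * B v ^ n' * H2 v ^ r * K2 v ^ n' * N2 v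
      - M2 v * G' v * B2 v ^ n' * H1 v ^ r * K1 v ^ n' * N1 v" for v
  have \<Delta>: "\<exists>d. multiform d \<Delta>"
  proof -
    let ?D = "\<lambda>i. eg i + d i + n' * e i + r * eh i + n' * ek i + eg' i"
    have "multiform ?D (\<lambda>v. M1 v * G v * B v ^ n' * H2 v ^ r * K2 v ^ n' * N2 v)"
      by (intro multiform_mult multiform_power M(1) w1(3) AB(2) H(2) K(2) N(2))
    moreover have "multiform ?D (\<lambda>v. M2 v * G' v * B2 v ^ n' * H1 v ^ r * K1 v ^ n' * N1 v)"
      by (intro multiform_mult multiform_power M(2) w2(3)[unfolded dd] B2(1) H(1) K(1) N(1))
    ultimately have "multiform ?D \<Delta>" unfolding \<Delta>_def by (rule multiform_diff)
    then show ?thesis by blast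
  qed
  have \<Delta>X: "vanishes \<Delta> X"
  proof -
    obtain dl where dl: "multiform dl \<Delta>" using \<Delta> by blast
    show ?thesis
    proof (rule irreducible_vanishes_off[OF X dl])
      show "zariski_closed ((W1 \<union> W2) \<union> {y. H1 (coords y) = 0})"
        using W1 W2 H(1) by (auto intro!: zariski_closed_Un zariski_closed_form)
      show "\<not> X \<subseteq> (W1 \<union> W2) \<union> {y. H1 (coords y) = 0}"
      proof
        assume "X \<subseteq> (W1 \<union> W2) \<union> {y. H1 (coords y) = 0}"
        then have "X \<subseteq> W1 \<union> W2 \<or> X \<subseteq> {y. H1 (coords y) = 0}"
          using W1 W2 H(1) by (intro irreducible_UnD[OF X]) (auto intro!: zariski_closed_Un zariski_closed_form)
        then show False using CW C(2) HX by (auto simp: vanishes_def)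
      qed
      fix y assume y: "y \<in> X" "y \<notin> W1 \<union> W2 \<union> {y. H1 (coords y) = 0}"
      let ?c = "coords y"
      have nz: "G ?c \<noteq> 0" "B2 ?c \<noteq> 0" "H2 ?c \<noteq> 0" "K2 ?c \<noteq> 0" "M2 ?c \<noteq> 0" "G' ?c \<noteq> 0" "B ?c \<noteq> 0"
        "N2 ?c \<noteq> 0" "H1 ?c \<noteq> 0" "y \<notin> Z" "y \<notin> Z'" "y \<notin> Y"
        using y by (auto simp: W1_def W2_def)
      have e1: "F ?c = G ?c * (h y ^ n * g y)" using Z(3)[OF y(1) nz(10)] nz by (simp add: field_simps)
      have e2: "F ?c = G' ?c * (h' y ^ n' * g' y)" using Z'(3)[OF y(1) nz(11)] nz by (simp add: field_simps)
      have h': "h' y = h y * k y * B2 ?c / B ?c"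
        using AB(4)[OF y(1) nz(7)] Y(3)[OF y(1) nz(12)] nz by (simp add: field_simps)
      have h: "h y = H1 ?c / H2 ?c" and kk: "k y = K1 ?c / K2 ?c" and gg: "g y = M1 ?c / M2 ?c"
        and gg': "g' y = N1 ?c / N2 ?c"
        using H(4) K(4) M(4) N(4) y(1) nz by auto
      have h0: "h y \<noteq> 0" using h nz by simp
      have "h y ^ n * (G ?c * g y) = h y ^ n * (G' ?c * (h y ^ r * (k y * B2 ?c / B ?c) ^ n' * g' y))"
        using e1 e2 unfolding h' by (simp add: r(1) power_add power_mult_distrib power_divide field_simps)
      then have "G ?c * g y = G' ?c * (h y ^ r * (k y * B2 ?c / B ?c) ^ n' * g' y)" using h0 by simp
      then show "\<Delta> ?c = 0"
        using nz unfolding \<Delta>_def h kk gg gg' by (simp add: power_mult_distrib power_divide field_simps)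
    qed
  qed
  have "vanishes M1 C"
  proof (rule irreducible_vanishes_off[OF Ci M(1) _ CW])
    show "zariski_closed (W1 \<union> W2)" using W1 W2 by (intro zariski_closed_Un)
    fix y assume y: "y \<in> C" "y \<notin> W1 \<union> W2"
    let ?c = "coords y"
    have nz: "G ?c \<noteq> 0" "H2 ?c \<noteq> 0" "K2 ?c \<noteq> 0" "B ?c \<noteq> 0" "N2 ?c \<noteq> 0"
      using y by (auto simp: W1_def W2_def)
    have "H1 ?c = 0" using HC y by (simp add: vanishes_def)
    moreover have "\<Delta> ?c = 0" using \<Delta>X y C(2) by (auto simp: vanishes_def)
    ultimately show "M1 ?c = 0" using nz r(2) by (simp add: \<Delta>_def power_0_left)
  qed
  then have "g y = 0" if "y \<in> C" "M2 (coords y) \<noteq> 0" for y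
    using M(4)[of y] that C(2) by (auto simp: vanishes_def)
  then have "near C x (\<lambda>y. g y = 0)"
    unfolding near_def using zariski_closed_form[OF M(2)] M(3)
    by (intro exI[of _ "{y. M2 (coords y) = 0}"]) auto
  then have "g \<in> curve_ideal X C x" using w1(6) by (simp add: curve_ideal_def)
  then show False using w1(7) by simp
qed

lemma order_along_eqI:
  assumes "zariski_irreducible X" "closed_irreducible C" "C \<subseteq> X" "\<not> X \<subseteq> C" "\<not> vanishes F X"
    "order_witness X C F n"
  shows "order_along X C F = n"
  unfolding order_along_witness
proof (rule the_equality)
  show "order_witness X C F n" by fact
  show "m = n" if "order_witness X C F m" for m
    using order_witness_not_less[OF assms(1-5) assms(6) that]
      order_witness_not_less[OF assms(1-5) that assms(6)] by simp
qed

section \<open>Geometry of the blow-up\<close>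

lemma perp_scale:
  assumes "dot L u = 0" "dot L v = 0" "cross u v \<noteq> 0"
  shows "\<exists>c. L = c *s cross u v"
proof (rule cross_eq_0_imp_scale[OF _ assms(3)])
  have "cross (cross u v) L = dot L u *s v - dot L v *s u"
    by (simp add: vec3_eq_iff dot_def algebra_simps)
  then show "cross (cross u v) L = 0" using assms by simp
qed

lemma cross_rep_nonzero: "P \<noteq> Q \<Longrightarrow> cross (rep_cp2 P) (rep_cp2 Q) \<noteq> 0"
proof
  assume "P \<noteq> Q" "cross (rep_cp2 P) (rep_cp2 Q) = 0"
  then obtain c where "rep_cp2 Q = c *s rep_cp2 P" using cross_eq_0_imp_scale[OF _ rep_nonzero] by blast
  then show False using cp2_eqI \<open>P \<noteq> Q\<close> by blast
qed

lemma multiform_dot2: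
  "multiform (\<lambda>k. unit_deg i k + unit_deg j k) (\<lambda>v. dot (v i) (v j))"
proof -
  have c: "w $ k = dot (axis k 1) w" for w :: "complex^3" and k
    unfolding dot_sum by (simp add: axis_def if_distrib[where f="\<lambda>x. x * _"] sum.delta cong: if_cong)
  have "(\<lambda>v. dot (v i) (v j)) = (\<lambda>v. dot (axis 1 1) (v i) * dot (axis 1 1) (v j)
      + dot (axis 2 1) (v i) * dot (axis 2 1) (v j) + dot (axis 3 1) (v i) * dot (axis 3 1) (v j))"
    unfolding c[symmetric] by (rule ext) (simp add: dot_def)
  moreover have "multiform (\<lambda>k. unit_deg i k + unit_deg j k) \<dots>"
    by (intro multiform_add multiform_mult multiform_dot)
  ultimately show ?thesis by simp
qed

lemma zariski_closed_dot: "zariski_closed {x. dot a (coords x i) = 0}"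
  using zariski_closed_form[OF multiform_dot[of i a]] .

lemma zariski_closed_dot2: "zariski_closed {x. dot (coords x i) (coords x j) = 0}"
  using zariski_closed_form[OF multiform_dot2[of i j]] .

definition point_of :: "('k \<Rightarrow> complex^3) \<Rightarrow> 'k \<Rightarrow> cp2" where
  "point_of u = (\<lambda>k. abs_cp2 (u k))"

lemma coords_point_of:
  assumes "\<And>k. u k \<noteq> 0"
  shows "\<exists>c. (\<forall>k. c k \<noteq> 0) \<and> coords (point_of u) = (\<lambda>k. c k *s u k)"
proof -
  have "\<forall>k. \<exists>c. c \<noteq> 0 \<and> rep_cp2 (abs_cp2 (u k)) = c *s u k" using assms rep_abs by blast
  then obtain c where "\<And>k. c k \<noteq> 0 \<and> rep_cp2 (abs_cp2 (u k)) = c k *s u k" by metis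
  then show ?thesis by (intro exI[of _ c]) (simp add: coords_def point_of_def)
qed

lemma form_point_of_0_iff:
  fixes u :: "'k::finite \<Rightarrow> complex^3"
  assumes "multiform d F" "\<And>k. u k \<noteq> 0"
  shows "F (coords (point_of u)) = 0 \<longleftrightarrow> F u = 0"
proof -
  obtain c where c: "(\<forall>k. c k \<noteq> 0) \<and> coords (point_of u) = (\<lambda>k. c k *s u k)"
    using coords_point_of[of u, OF assms(2)] ..
  show ?thesis unfolding conjunct2[OF c] by (rule multiform_scale_0_iff[OF assms(1)]) (use c in blast)
qed

lemma form_coords_0_iff:
  fixes u :: "'k::finite \<Rightarrow> complex^3"
  assumes "multiform d F" "\<And>k. \<exists>c. coords x k = c *s u k"
  shows "F (coords x) = 0 \<longleftrightarrow> F u = 0"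
proof -
  obtain c where c: "\<And>k. coords x k = c k *s u k" using assms(2) by metis
  have "c k \<noteq> 0" for k using c[of k] coords_nonzero[of x k] by auto
  moreover have "coords x = (\<lambda>k. c k *s u k)" using c by (rule ext)
  ultimately show ?thesis using multiform_scale_0_iff[OF assms(1), of c u] by (simp only: not_False_eq_True)
qed

lemma eq_point_of: "(\<And>k. \<exists>c. coords x k = c *s u k) \<Longrightarrow> x = point_of u"
  by (rule ext) (metis abs_cp2_eqI coords_def point_of_def)

lemma irreducible_curveD:
  assumes "irreducible_curve Y C"
  shows "C \<subseteq> Y" "closed_irreducible C" "zariski_closed C" "zariski_irreducible C"
  using assms by (simp_all add: irreducible_curve_def closed_irreducible_def)

section \<open>Parametrisations and irreducibility of the blow-up\<close>

locale blown_up_plane =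
  fixes p :: "'i::finite \<Rightarrow> cp2"
  assumes inj: "inj p"
begin

definition w :: "'i \<Rightarrow> complex^3" where "w i = rep_cp2 (p i)"

abbreviation X where "X \<equiv> blowup p"
abbreviation E where "E \<equiv> exceptional p"

lemma w_nonzero [simp]: "w i \<noteq> 0"
  by (simp add: w_def)

lemma cross_w_nonzero: "i \<noteq> j \<Longrightarrow> cross (w i) (w j) \<noteq> 0"
  unfolding w_def using inj by (intro cross_rep_nonzero) (auto dest: injD)

lemma mem_blowup:
  "x \<in> X \<longleftrightarrow> (\<forall>i. dot (coords x (Some i)) (w i) = 0 \<and> dot (coords x (Some i)) (coords x None) = 0)"
  by (simp add: blowup_def incident_dot coords_def w_def)

lemma mem_E: "x \<in> E i \<longleftrightarrow> x \<in> X \<and> x None = p i"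
  by (auto simp: exceptional_def)

lemma E_subset: "E i \<subseteq> X" by (auto simp: mem_E)

lemma zariski_closed_X: "zariski_closed X"
proof -
  have "X = \<Inter>(range (\<lambda>i. {x. dot (w i) (coords x (Some i)) = 0} \<inter> {x. dot (coords x (Some i)) (coords x None) = 0}))"
    by (auto simp: mem_blowup dot_commute)
  moreover have "zariski_closed (\<Inter>(range (\<lambda>i. {x. dot (w i) (coords x (Some i)) = 0} \<inter> {x. dot (coords x (Some i)) (coords x None) = 0})))"
    using zariski_closed_Int[OF zariski_closed_dot zariski_closed_dot2] by (intro zariski_closed_Inter) auto
  ultimately show ?thesis by simp
qed

lemma zariski_closed_E: "zariski_closed (E i)"
proof -
  have "E i = X \<inter> {x. x None = p i}" by (auto simp: mem_E)
  then show ?thesis using zariski_closed_Int[OF zariski_closed_X zariski_closed_component] by simp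
qed

text \<open>The inverse \<open>gpar\<close> of the blow-down map off the exceptional curves, and the
  parametrisation \<open>epar\<close> of an exceptional curve by the lines through \<open>p i\<close>.\<close>

definition gpar :: "complex^3 \<Rightarrow> 'i option \<Rightarrow> complex^3" where
  "gpar v k = (case k of None \<Rightarrow> v | Some i \<Rightarrow> cross (w i) v)"

definition epar :: "'i \<Rightarrow> complex^3 \<Rightarrow> 'i option \<Rightarrow> complex^3" where
  "epar i L k = (case k of None \<Rightarrow> w i | Some j \<Rightarrow> if j = i then L else cross (w j) (w i))"

lemma gpar_simps [simp]: "gpar v None = v" "gpar v (Some i) = cross (w i) v"
  by (simp_all add: gpar_def)

lemma epar_simps [simp]:
  "epar i L None = w i" "epar i L (Some i) = L" "j \<noteq> i \<Longrightarrow> epar i L (Some j) = cross (w j) (w i)"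
  by (simp_all add: epar_def)

lemma line_through:
  assumes "x \<in> X" "x None \<noteq> p j"
  shows "\<exists>c. coords x (Some j) = c *s cross (w j) (coords x None)"
proof (rule perp_scale)
  show "dot (coords x (Some j)) (w j) = 0" "dot (coords x (Some j)) (coords x None) = 0"
    using assms(1) by (auto simp: mem_blowup)
  show "cross (w j) (coords x None) \<noteq> 0"
    unfolding w_def coords_def using assms(2) by (intro cross_rep_nonzero) auto
qed

lemma coords_gpar:
  assumes "x \<in> X" "x None \<notin> range p"
  shows "\<exists>c. coords x k = c *s gpar (coords x None) k"
proof (cases k)
  case None
  then show ?thesis by (intro exI[of _ 1]) simp
next
  case (Some j)
  then show ?thesis using line_through[OF assms(1), of j] assms(2) by auto
qed

lemma coords_epar:
  assumes "x \<in> E i"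
  shows "\<exists>c. coords x k = c *s epar i (coords x (Some i)) k"
proof -
  have x: "x \<in> X" "x None = p i" using assms by (auto simp: mem_E)
  have n: "coords x None = w i" using x by (simp add: coords_def w_def)
  show ?thesis
  proof (cases k)
    case None
    then show ?thesis using n by (intro exI[of _ 1]) simp
  next
    case (Some j)
    show ?thesis
    proof (cases "j = i")
      case True
      then show ?thesis using Some by (intro exI[of _ 1]) simp
    next
      case False
      then have "x None \<noteq> p j" using x inj by (auto dest: injD)
      then show ?thesis using line_through[OF x(1), of j] Some False n by auto
    qed
  qed
qed

lemma point_of_gpar:
  assumes "\<And>i. cross (w i) v \<noteq> 0"
  shows "point_of (gpar v) \<in> X" "point_of (gpar v) None \<notin> range p" "gpar v k \<noteq> 0"
proof -
  have nz: "gpar v k \<noteq> 0" for k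
  proof (cases k)
    case None
    have "v \<noteq> 0"
    proof
      fix i assume "v = 0"
      then have "cross (w i) v = 0" by (simp add: vec3_eq_iff)
      then show False using assms by blast
    qed
    then show ?thesis using None by simp
  qed (use assms in auto)
  show "gpar v k \<noteq> 0" by (rule nz)
  obtain c where "(\<forall>k. c k \<noteq> 0) \<and> coords (point_of (gpar v)) = (\<lambda>k. c k *s gpar v k)"
    using coords_point_of[of "gpar v", OF nz] ..
  then have c: "\<And>k. c k \<noteq> 0" "\<And>k. coords (point_of (gpar v)) k = c k *s gpar v k"
    by simp_all
  show "point_of (gpar v) \<in> X" by (simp add: mem_blowup c(2) dot_algebra)
  show "point_of (gpar v) None \<notin> range p"
  proof
    assume "point_of (gpar v) None \<in> range p"
    then obtain i where "point_of (gpar v) None = p i" by auto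
    then have "w i = c None *s v" using c(2)[of None] by (simp add: coords_def w_def)
    then have "cross (w i) v = c None *s cross v v" by (metis cross_linear(3))
    then have "cross (w i) v = 0" by (simp add: cross_linear)
    then show False using assms by simp
  qed
qed

lemma point_of_epar:
  assumes "L \<noteq> 0" "dot L (w i) = 0"
  shows "point_of (epar i L) \<in> E i" "epar i L k \<noteq> 0"
proof -
  have nz: "epar i L k \<noteq> 0" for k
    using assms cross_w_nonzero by (cases k) (auto simp: epar_def)
  show "epar i L k \<noteq> 0" by (rule nz)
  obtain c where "(\<forall>k. c k \<noteq> 0) \<and> coords (point_of (epar i L)) = (\<lambda>k. c k *s epar i L k)"
    using coords_point_of[of "epar i L", OF nz] ..
  then have c: "\<And>k. c k \<noteq> 0" "\<And>k. coords (point_of (epar i L)) k = c k *s epar i L k"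
    by simp_all
  have "dot (epar i L (Some j)) (w j) = 0 \<and> dot (epar i L (Some j)) (w i) = 0" for j
    using assms by (cases "j = i") auto
  then have "point_of (epar i L) \<in> X" by (simp add: mem_blowup c(2) dot_algebra)
  moreover have "point_of (epar i L) None = p i"
    using c(2)[of None] by (intro cp2_eqI[of _ "c None"]) (simp add: coords_def w_def)
  ultimately show "point_of (epar i L) \<in> E i" by (simp add: mem_E)
qed

lemma gpar_poly: "\<exists>q. \<forall>t. gpar (a + t *s b) k $ m = poly q t"
proof (cases k)
  case None
  then show ?thesis by (intro exI[of _ "[:a $ m, b $ m:]"]) simp
next
  case (Some j)
  show ?thesis
    using Some by (intro exI[of _ "[:cross (w j) a $ m, cross (w j) b $ m:]"]) (simp add: cross_linear)
qed

text \<open>Points of exceptional curves are limits of general points.\<close>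

lemma form_gpar_nonzero:
  assumes F: "multiform d F" and x: "x \<in> X" "F (coords x) \<noteq> 0"
  shows "\<exists>v. F (gpar v) \<noteq> 0"
proof (cases "x None \<in> range p")
  case False
  have "F (coords x) = 0 \<longleftrightarrow> F (gpar (coords x None)) = 0"
    by (rule form_coords_0_iff[OF F]) (rule coords_gpar[OF x(1) False])
  then show ?thesis using x(2) by auto
next
  case True
  then obtain i where i: "x None = p i" by auto
  then have xE: "x \<in> E i" using x(1) by (simp add: mem_E)
  define L where "L = coords x (Some i)"
  have L: "L \<noteq> 0" "dot L (w i) = 0" using x(1) by (auto simp: L_def mem_blowup)
  obtain a where a: "dot a (w i) \<noteq> 0" using dot_nonzero_exists[of "w i"] by auto
  \<comment> \<open>The direction of the line \<open>L\<close> at \<open>p i\<close>: moving from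
    \<open>w i\<close> along \<open>q\<close> approaches the given point \<open>x\<close> of the
    exceptional curve.\<close>
  define q where "q = cross L a"
  have "cross (w i) q = dot a (w i) *s L - dot L (w i) *s a"
    by (simp add: q_def vec3_eq_iff dot_def algebra_simps)
  then have cq: "cross (w i) q = dot a (w i) *s L" using L(2) by simp
  \<comment> \<open>The coordinate \<open>Some i\<close> of \<open>gpar (w i + t *s q)\<close> is
    \<open>t\<close> times \<open>cross (w i) q\<close>. Dropping the factor \<open>t\<close>
    extends the path to \<open>t = 0\<close>, where it reaches \<open>x\<close>.\<close>
  define \<gamma> where "\<gamma> t k = (if k = Some i then cross (w i) q else gpar (w i + t *s q) k)" for t k
  have "\<exists>r. \<forall>t. \<gamma> t k $ m = poly r t" for k m
  proof (cases "k = Some i")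
    case True
    then show ?thesis by (intro exI[of _ "[:cross (w i) q $ m:]"]) (simp add: \<gamma>_def)
  next
    case False
    then show ?thesis using gpar_poly[of "w i" q k m] by (simp add: \<gamma>_def)
  qed
  then obtain r where r: "\<And>t. F (\<gamma> t) = poly r t"
    using polyfun_poly[OF multiform_polyfun[OF F], of \<gamma>] by auto
  have "\<exists>c. coords x k = c *s \<gamma> 0 k" for k
  proof (cases "k = Some i")
    case True
    then show ?thesis using a cq by (intro exI[of _ "1 / dot a (w i)"]) (simp add: \<gamma>_def L_def vector_smult_assoc)
  next
    case False
    then have "epar i (coords x (Some i)) k = gpar (w i) k" by (cases k) auto
    then show ?thesis using coords_epar[OF xE, of k] False by (simp add: \<gamma>_def)
  qed
  then have "F (\<gamma> 0) \<noteq> 0" using form_coords_0_iff[OF F, of x "\<gamma> 0"] x(2) by simp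
  then have "r \<noteq> 0" using r[of 0] by auto
  then have "[:0, 1:] * r \<noteq> 0" by simp
  then have "finite {t. poly ([:0, 1:] * r) t = 0}" by (rule poly_roots_finite)
  then obtain t where t: "poly ([:0, 1:] * r) t \<noteq> 0"
    using ex_new_if_finite[OF infinite_UNIV_char_0] by blast
  then have t: "t \<noteq> 0" "F (\<gamma> t) \<noteq> 0" using r by auto
  define c where "c k = (if k = Some i then t else 1)" for k
  have "gpar (w i + t *s q) = (\<lambda>k. c k *s \<gamma> t k)"
    by (rule ext) (auto simp: c_def \<gamma>_def cross_linear)
  moreover have "F (\<lambda>k. c k *s \<gamma> t k) \<noteq> 0"
    using multiform_scale_0_iff[OF F, of c "\<gamma> t"] t by (simp add: c_def)
  ultimately show ?thesis by metis
qed

lemma cross_nonzero_exists: "u \<noteq> 0 \<Longrightarrow> \<exists>b. cross u b \<noteq> 0"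
proof (rule ccontr)
  assume u: "u \<noteq> 0" and "\<not> (\<exists>b. cross u b \<noteq> 0)"
  then have "cross u (vector [1,0,0]) = 0" "cross u (vector [0,1,0]) = 0" by blast+
  then show False using u by (simp add: vec3_eq_iff)
qed

lemma generic_point:
  assumes fin: "finite S" and mf: "\<And>F. F \<in> S \<Longrightarrow> \<exists>d. multiform d F"
    and nv: "\<And>F. F \<in> S \<Longrightarrow> \<not> vanishes F X"
  shows "\<exists>v. (\<forall>i. cross (w i) v \<noteq> 0) \<and> (\<forall>F\<in>S. F (gpar v) \<noteq> 0)"
proof -
  obtain b where b: "\<And>i. cross (w i) (b i) \<noteq> 0"
    using cross_nonzero_exists[OF w_nonzero] by metis
  have "\<forall>i. \<exists>a. dot a (cross (w i) (b i)) \<noteq> 0" using dot_nonzero_exists[OF b] by blast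
  then obtain a where ab: "\<And>i. dot (a i) (cross (w i) (b i)) \<noteq> 0" by metis
  \<comment> \<open>A single vector is regarded as a function on \<open>unit\<close>, so that
    \<open>polyfun_generic\<close> applies. The linear forms in \<open>T\<close> keep the vector
    away from all \<open>w i\<close>.\<close>
  define T where "T = range (\<lambda>i (v :: unit \<Rightarrow> complex^3). dot (cross (a i) (w i)) (v ()))
    \<union> (\<lambda>F v. F (gpar (v ()))) ` S"
  have dc: "dot (cross (a i) (w i)) v = dot (a i) (cross (w i) v)" for i v
    by (simp add: dot_def algebra_simps)
  have "finite T" using fin by (simp add: T_def)
  moreover have "polyfun G" if G: "G \<in> T" for G
  proof -
    consider i where "G = (\<lambda>v. dot (cross (a i) (w i)) (v ()))" | F where "F \<in> S" "G = (\<lambda>v. F (gpar (v ())))"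
      using G unfolding T_def by blast
    then show ?thesis
    proof cases
      case 1
      then show ?thesis by (simp add: polyfun_dot)
    next
      case 2
      then have pF: "polyfun F" using mf multiform_polyfun by blast
      have "polyfun (\<lambda>v :: unit \<Rightarrow> complex^3. gpar (v ()) k $ m)" for k m
      proof (cases k)
        case None
        then show ?thesis by (simp add: polyfun.coord)
      next
        case (Some j)
        have "m = 1 \<or> m = 2 \<or> m = 3" using exhaust_3 by blast
        then show ?thesis using Some
          by (elim disjE) (simp_all, (intro polyfun_diff polyfun.intros)+)
      qed
      then show ?thesis unfolding 2(2) by (rule polyfun_subst[OF pF])
    qed
  qed
  moreover have "\<exists>v. G v \<noteq> 0" if G: "G \<in> T" for G
  proof -
    consider i where "G = (\<lambda>v. dot (cross (a i) (w i)) (v ()))" | F where "F \<in> S" "G = (\<lambda>v. F (gpar (v ())))"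
      using G unfolding T_def by blast
    then show ?thesis
    proof cases
      case 1
      then show ?thesis using ab[of i] dc by (intro exI[of _ "\<lambda>_. b i"]) simp
    next
      case 2
      then obtain d x where "multiform d F" "x \<in> X" "F (coords x) \<noteq> 0"
        using mf nv unfolding vanishes_def by blast
      then obtain v where "F (gpar v) \<noteq> 0" using form_gpar_nonzero by blast
      then show ?thesis using 2 by (intro exI[of _ "\<lambda>_. v"]) simp
    qed
  qed
  ultimately obtain v where v: "\<And>G. G \<in> T \<Longrightarrow> G v \<noteq> 0" using polyfun_generic[of T] by blast
  have "cross (w i) (v ()) \<noteq> 0" for i
  proof -
    have "(\<lambda>v :: unit \<Rightarrow> complex^3. dot (cross (a i) (w i)) (v ())) \<in> T" by (auto simp: T_def)
    from v[OF this] show ?thesis using dc by auto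
  qed
  moreover have "F (gpar (v ())) \<noteq> 0" if "F \<in> S" for F
  proof -
    have "(\<lambda>v :: unit \<Rightarrow> complex^3. F (gpar (v ()))) \<in> T" using that by (auto simp: T_def)
    from v[OF this] show ?thesis .
  qed
  ultimately show ?thesis by blast
qed

lemma generic_point_X:
  assumes "finite S" "\<And>F. F \<in> S \<Longrightarrow> \<exists>d. multiform d F" "\<And>F. F \<in> S \<Longrightarrow> \<not> vanishes F X"
  shows "\<exists>x\<in>X. x None \<notin> range p \<and> (\<forall>F\<in>S. F (coords x) \<noteq> 0)"
proof -
  obtain v where v: "\<forall>i. cross (w i) v \<noteq> 0" "\<forall>F\<in>S. F (gpar v) \<noteq> 0"
    using generic_point[OF assms] by blast
  have "F (coords (point_of (gpar v))) \<noteq> 0" if F: "F \<in> S" for F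
  proof -
    obtain d where "multiform d F" using assms(2) F by blast
    then show ?thesis using form_point_of_0_iff[of d F "gpar v"] point_of_gpar(3) v F by blast
  qed
  then show ?thesis using point_of_gpar(1,2) v(1) by blast
qed

text \<open>Two proper closed subsets covering \<open>X\<close> would give two forms, neither
  vanishing on \<open>X\<close>, without a common point of nonvanishing, contrary to
  \<open>generic_point_X\<close>.\<close>

lemma irreducible_X: "zariski_irreducible X"
  unfolding zariski_irreducible_def
proof (intro conjI allI impI)
  show "X \<noteq> {}" using generic_point_X[of "{}"] by auto
  fix Z1 Z2 :: "('i option \<Rightarrow> cp2) set"
  assume Z: "zariski_closed Z1 \<and> zariski_closed Z2 \<and> X \<subseteq> Z1 \<union> Z2"
  show "X \<subseteq> Z1 \<or> X \<subseteq> Z2"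
  proof (rule ccontr)
    assume "\<not> (X \<subseteq> Z1 \<or> X \<subseteq> Z2)"
    then obtain x y where x: "x \<in> X" "x \<notin> Z1" and y: "y \<in> X" "y \<notin> Z2" by blast
    obtain d F where F: "multiform d F" "F (coords x) \<noteq> 0" "vanishes F Z1"
      using zariski_closed_not_mem x Z by blast
    obtain e G where G: "multiform e G" "G (coords y) \<noteq> 0" "vanishes G Z2"
      using zariski_closed_not_mem y Z by blast
    have "\<exists>z\<in>X. z None \<notin> range p \<and> (\<forall>H\<in>{F, G}. H (coords z) \<noteq> 0)"
      by (rule generic_point_X) (use F G x y in \<open>auto simp: vanishes_def\<close>)
    then obtain z where "z \<in> X" "F (coords z) \<noteq> 0" "G (coords z) \<noteq> 0" by auto
    then show False using Z F(3) G(3) by (auto simp: vanishes_def)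
  qed
qed

section \<open>The exceptional curves\<close>

lemma E_eqI:
  assumes "x \<in> E i" "y \<in> E i" "coords x (Some i) = c *s coords y (Some i)"
  shows "x = y"
proof
  fix k
  have e: "\<exists>c. epar i (coords x (Some i)) k = c *s epar i (coords y (Some i)) k"
  proof (cases "k = Some i")
    case True
    then show ?thesis using assms(3) by auto
  next
    case False
    then have "epar i (coords x (Some i)) k = 1 *s epar i (coords y (Some i)) k"
      by (auto simp: epar_def split: option.split)
    then show ?thesis by blast
  qed
  obtain a b where a: "coords x k = a *s epar i (coords x (Some i)) k"
    and b: "coords y k = b *s epar i (coords y (Some i)) k"
    using coords_epar assms by meson
  obtain c' where c': "epar i (coords x (Some i)) k = c' *s epar i (coords y (Some i)) k" using e by blast
  have "b \<noteq> 0" using b coords_nonzero[of y k] by auto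
  then have "coords x k = (a * c' / b) *s coords y k"
    using a b c' by (simp add: vector_smult_assoc)
  then show "x k = y k" unfolding coords_def by (rule cp2_eqI)
qed

lemma E_line: "x \<in> E i \<Longrightarrow> dot (coords x (Some i)) (w i) = 0"
  by (auto simp: mem_E mem_blowup)

lemma epar_line_poly: "\<exists>q. \<forall>t. epar i (a + t *s b) k $ m = poly q t"
proof (cases "k = Some i")
  case True
  then show ?thesis by (intro exI[of _ "[:a $ m, b $ m:]"]) simp
next
  case False
  then have "epar i (a + t *s b) k = epar i 0 k" for t by (auto simp: epar_def split: option.split)
  then show ?thesis by (intro exI[of _ "[:epar i 0 k $ m:]"]) simp
qed

lemma form_epar_poly:
  assumes "multiform d F"
  shows "\<exists>q. \<forall>t. F (epar i (a + t *s b)) = poly q t"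
  by (rule polyfun_poly[OF multiform_polyfun[OF assms]]) (rule epar_line_poly)

lemma form_E_0_iff:
  assumes "multiform d F" "x \<in> E i"
  shows "F (coords x) = 0 \<longleftrightarrow> F (epar i (coords x (Some i))) = 0"
  by (rule form_coords_0_iff[OF assms(1)]) (rule coords_epar[OF assms(2)])

text \<open>\<open>E i\<close> is a projective line, the pencil of lines through \<open>p i\<close>.
  Forms that separate \<open>x\<close> and \<open>y\<close> from the two closed sets become nonzero
  polynomials in \<open>t\<close> on the line of vectors from the representative of \<open>x\<close>
  to that of \<open>y\<close>.\<close>

lemma irreducible_E: "zariski_irreducible (E i)"
  unfolding zariski_irreducible_def
proof (intro conjI allI impI)
  obtain L where "cross (w i) L \<noteq> 0" using cross_nonzero_exists[OF w_nonzero] by blast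
  then have "point_of (epar i (cross (w i) L)) \<in> E i" by (intro point_of_epar) auto
  then show "E i \<noteq> {}" by auto
  fix Z1 Z2 :: "('i option \<Rightarrow> cp2) set"
  assume Z: "zariski_closed Z1 \<and> zariski_closed Z2 \<and> E i \<subseteq> Z1 \<union> Z2"
  show "E i \<subseteq> Z1 \<or> E i \<subseteq> Z2"
  proof (rule ccontr)
    assume "\<not> (E i \<subseteq> Z1 \<or> E i \<subseteq> Z2)"
    then obtain x y where x: "x \<in> E i" "x \<notin> Z1" and y: "y \<in> E i" "y \<notin> Z2" by blast
    obtain d F where F: "multiform d F" "F (coords x) \<noteq> 0" "vanishes F Z1"
      using zariski_closed_not_mem x Z by blast
    obtain e G where G: "multiform e G" "G (coords y) \<noteq> 0" "vanishes G Z2"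
      using zariski_closed_not_mem y Z by blast
    define a b where "a = coords x (Some i)" and "b = coords y (Some i) - coords x (Some i)"
    obtain q where q: "\<And>t. F (epar i (a + t *s b)) = poly q t" using form_epar_poly[OF F(1)] by blast
    obtain r where r: "\<And>t. G (epar i (a + t *s b)) = poly r t" using form_epar_poly[OF G(1)] by blast
    have "poly q 0 \<noteq> 0" using q[of 0] F(2) form_E_0_iff[OF F(1) x(1)] by (simp add: a_def)
    moreover have "poly r 1 \<noteq> 0" using r[of 1] G(2) form_E_0_iff[OF G(1) y(1)] by (simp add: a_def b_def)
    ultimately have "q * r \<noteq> 0" by auto
    then have "finite {t. poly (q * r) t = 0}" by (rule poly_roots_finite)
    then obtain t where "poly (q * r) t \<noteq> 0"
      using ex_new_if_finite[OF infinite_UNIV_char_0] by blast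
    then have t: "F (epar i (a + t *s b)) \<noteq> 0" "G (epar i (a + t *s b)) \<noteq> 0" using q r by auto
    have perp: "dot (a + t *s b) (w i) = 0"
      using E_line[OF x(1)] E_line[OF y(1)] by (simp add: a_def b_def dot_algebra)
    show False
    proof (cases "a + t *s b = 0")
      case False
      let ?z = "point_of (epar i (a + t *s b))"
      have z: "?z \<in> E i" "\<And>k. epar i (a + t *s b) k \<noteq> 0" using point_of_epar[OF False perp] by auto
      have "F (coords ?z) \<noteq> 0" "G (coords ?z) \<noteq> 0"
        using form_point_of_0_iff[OF F(1) z(2)] form_point_of_0_iff[OF G(1) z(2)] t by auto
      then show False using Z F(3) G(3) z(1) by (auto simp: vanishes_def)
    next
      case True
      \<comment> \<open>The line of vectors passes through the origin only if the two
        representatives are proportional, that is, if \<open>x = y\<close>.\<close>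
      have "(1 - t) *s coords x (Some i) + t *s coords y (Some i) = a + t *s b"
        by (simp add: a_def b_def vec3_eq_iff algebra_simps)
      then have e: "(1 - t) *s coords x (Some i) = (- t) *s coords y (Some i)"
        unfolding True by (simp add: eq_neg_iff_add_eq_0)
      have "t \<noteq> 1"
      proof
        assume "t = 1"
        then have "- coords y (Some i) = 0" using e by simp
        then show False by simp
      qed
      then have "coords x (Some i) = (1 / (1 - t)) *s ((1 - t) *s coords x (Some i))"
        by (subst vector_smult_assoc) simp
      then have "coords x (Some i) = (1 / (1 - t) * - t) *s coords y (Some i)"
        unfolding e by (simp add: vector_smult_assoc)
      then have "x = y" by (rule E_eqI[OF x(1) y(1)])
      then show False using x y Z by blast
    qed
  qed
qed

lemma closed_irreducible_E: "closed_irreducible (E i)"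
  by (simp add: closed_irreducible_def zariski_closed_E irreducible_E)

text \<open>With \<open>x\<close> outside \<open>Z\<close> and \<open>y\<close> in \<open>Z\<close>,
  the vectors \<open>a + t *s b\<close> parametrise \<open>E i\<close> without \<open>y\<close>. A
  form that vanishes on \<open>Z\<close> but not at \<open>x\<close> leaves finitely many values of
  \<open>t\<close>.\<close>

lemma closed_proper_E_finite:
  assumes "zariski_closed Z" "Z \<subset> E i"
  shows "finite Z"
proof (cases "Z = {}")
  case False
  then obtain y where y: "y \<in> Z" "y \<in> E i" using assms(2) by blast
  obtain x where x: "x \<in> E i" "x \<notin> Z" using assms(2) by blast
  obtain d F where F: "multiform d F" "F (coords x) \<noteq> 0" "vanishes F Z"
    using zariski_closed_not_mem[OF assms(1) x(2)] by blast
  define a b where "a = coords x (Some i)" and "b = coords y (Some i)"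
  have a: "a \<noteq> 0" "dot a (w i) = 0" and b: "b \<noteq> 0" "dot b (w i) = 0"
    using E_line[OF x(1)] E_line[OF y(2)] by (auto simp: a_def b_def)
  have ab: "cross a b \<noteq> 0"
  proof
    assume "cross a b = 0"
    then obtain c where "b = c *s a" using cross_eq_0_imp_scale a(1) by blast
    then have "y = x" unfolding a_def b_def by (rule E_eqI[OF y(2) x(1)])
    then show False using x y by simp
  qed
  obtain k where k: "w i = k *s cross a b"
    using perp_scale[of "w i" a b, OF _ _ ab] a(2) b(2) unfolding dot_commute[of _ "w i"] by blast
  have k0: "k \<noteq> 0"
  proof
    assume "k = 0"
    then have "w i = 0" unfolding k by simp
    then show False by simp
  qed
  \<comment> \<open>\<open>u\<close> completes \<open>a\<close>, \<open>b\<close> to a basis; by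
    Cramer's rule every line through \<open>p i\<close> is then a combination of \<open>a\<close>
    and \<open>b\<close>.\<close>
  obtain u where u: "dot u (cross a b) \<noteq> 0" using dot_nonzero_exists[OF ab] by blast
  obtain q where q: "\<And>t. F (epar i (a + t *s b)) = poly q t" using form_epar_poly[OF F(1)] by blast
  have "poly q 0 \<noteq> 0" using q[of 0] F(2) form_E_0_iff[OF F(1) x(1)] by (simp add: a_def)
  then have "finite {t. poly q t = 0}" by (intro poly_roots_finite) auto
  then have fin: "finite (insert y ((\<lambda>t. point_of (epar i (a + t *s b))) ` {t. poly q t = 0}))" by simp
  have "z \<in> insert y ((\<lambda>t. point_of (epar i (a + t *s b))) ` {t. poly q t = 0})" if z: "z \<in> Z" for z
  proof -
    have zE: "z \<in> E i" using z assms(2) by blast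
    define L where "L = coords z (Some i)"
    have "k * dot L (cross a b) = 0" using E_line[OF zE] unfolding k L_def dot_algebra .
    then have "dot L (cross a b) = 0" using k0 by simp
    then have "dot u (cross a b) *s L = dot (cross b u) L *s a + dot (cross u a) L *s b"
      using cramer3[of u a b L] unfolding dot_commute[of "cross a b" L] by simp
    then have "(1 / dot u (cross a b)) *s (dot u (cross a b) *s L)
        = (1 / dot u (cross a b)) *s (dot (cross b u) L *s a + dot (cross u a) L *s b)" by simp
    moreover have "(1 / dot u (cross a b)) *s (dot u (cross a b) *s L) = L"
      using u by (subst vector_smult_assoc) simp
    moreover define \<alpha> \<beta> where "\<alpha> = 1 / dot u (cross a b) * dot (cross b u) L"
      and "\<beta> = 1 / dot u (cross a b) * dot (cross u a) L"
    ultimately have L: "L = \<alpha> *s a + \<beta> *s b"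
      unfolding vector_smult_assoc vector_add_ldistrib by argo
    show ?thesis
    proof (cases "\<alpha> = 0")
      case True
      then have "coords z (Some i) = \<beta> *s coords y (Some i)" using L unfolding L_def b_def by simp
      then have "z = y" by (rule E_eqI[OF zE y(2)])
      then show ?thesis by simp
    next
      case False
      then have L': "L = \<alpha> *s (a + (\<beta> / \<alpha>) *s b)"
        unfolding L vector_add_ldistrib by (subst vector_smult_assoc) simp
      have c: "\<exists>c. coords z k = c *s epar i (a + (\<beta> / \<alpha>) *s b) k" for k
      proof (cases "k = Some i")
        case True
        have "coords z k = \<alpha> *s epar i (a + (\<beta> / \<alpha>) *s b) k"
          using L' unfolding L_def True epar_simps .
        then show ?thesis by (rule exI)
      next
        case k: False
        then have eq: "epar i (coords z (Some i)) k = epar i (a + (\<beta> / \<alpha>) *s b) k"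
          by (cases k) (simp_all add: epar_def)
        show ?thesis using coords_epar[OF zE, of k] unfolding eq .
      qed
      have "F (coords z) = 0" using F(3) z by (simp add: vanishes_def)
      then have "poly q (\<beta> / \<alpha>) = 0" unfolding q[symmetric] form_coords_0_iff[OF F(1) c] .
      then have r: "\<beta> / \<alpha> \<in> {t. poly q t = 0}" by (rule CollectI)
      have "z = point_of (epar i (a + (\<beta> / \<alpha>) *s b))" by (rule eq_point_of[OF c])
      then show ?thesis by (rule insertI2[OF image_eqI[OF _ r]])
    qed
  qed
  then show ?thesis by (intro finite_subset[OF subsetI fin])
qed simp

lemma closed_irreducible_proper_E:
  assumes "closed_irreducible Z" "Z \<subset> E i"
  shows "\<exists>x. Z = {x}"
  using assms closed_proper_E_finite irreducible_finite_singleton unfolding closed_irreducible_def by blast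

lemma E_nonempty: "E i \<noteq> {}"
  using irreducible_E by (simp add: zariski_irreducible_def)

lemma E_two_points: "\<exists>x\<in>E i. E i \<noteq> {x}"
proof -
  obtain a where a: "cross (w i) a \<noteq> 0" using cross_nonzero_exists[OF w_nonzero] by blast
  obtain u where u: "dot u (cross (w i) a) \<noteq> 0" using dot_nonzero_exists[OF a] by blast
  let ?A = "cross (w i) a" and ?B = "cross (w i) u"
  have B: "?B \<noteq> 0"
  proof
    assume "?B = 0"
    then obtain c where "u = c *s w i" using cross_eq_0_imp_scale[OF _ w_nonzero] by blast
    then show False using u by (simp add: dot_algebra)
  qed
  have e: "point_of (epar i ?A) \<in> E i" "point_of (epar i ?B) \<in> E i"
    "\<And>k. epar i ?A k \<noteq> 0" "\<And>k. epar i ?B k \<noteq> 0"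
    using point_of_epar[of ?A i] point_of_epar[of ?B i] a B by auto
  have "point_of (epar i ?A) \<noteq> point_of (epar i ?B)"
  proof
    assume eq: "point_of (epar i ?A) = point_of (epar i ?B)"
    have "dot u (epar i ?B (Some i)) = 0" by simp
    then have "dot u (coords (point_of (epar i ?B)) (Some i)) = 0"
      using form_point_of_0_iff[OF multiform_dot[of "Some i" u] e(4)] by simp
    then have "dot u (coords (point_of (epar i ?A)) (Some i)) = 0" using eq by simp
    then have "dot u (epar i ?A (Some i)) = 0"
      using form_point_of_0_iff[OF multiform_dot[of "Some i" u] e(3)] by simp
    then show False using u by simp
  qed
  then show ?thesis using e by blast
qed

lemma irreducible_curve_E: "irreducible_curve X (E i)"
  unfolding irreducible_curve_def
proof (intro conjI notI)
  show "E i \<subseteq> X" by (rule E_subset)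
  show "closed_irreducible (E i)" by (rule closed_irreducible_E)
  obtain x where x: "x \<in> E i" "E i \<noteq> {x}" using E_two_points by blast
  then have "{x} \<subset> E i" by blast
  then show "\<exists>Z. closed_irreducible Z \<and> Z \<subset> E i" using closed_irreducible_point by blast
  assume "\<exists>Z Z'. closed_irreducible Z \<and> closed_irreducible Z' \<and> Z \<subset> Z' \<and> Z' \<subset> E i"
  then obtain Z Z' where Z: "closed_irreducible Z" "closed_irreducible Z'" "Z \<subset> Z'" "Z' \<subset> E i" by blast
  then obtain y where "Z' = {y}" using closed_irreducible_proper_E by blast
  then have "Z = {}" using Z(3) by blast
  then show False using Z(1) by (simp add: closed_irreducible_def zariski_irreducible_def)
qed

lemma curve_infinite:
  assumes "irreducible_curve X C"
  shows "infinite C"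
proof
  assume "finite C"
  then obtain x where x: "C = {x}"
    using irreducible_finite_singleton[OF irreducible_curveD(4)[OF assms]] by blast
  obtain Z where Z: "closed_irreducible Z" "Z \<subset> C" using assms unfolding irreducible_curve_def by blast
  then have "Z = {}" using x by blast
  then show False using Z(1) by (simp add: closed_irreducible_def zariski_irreducible_def)
qed

lemma curve_subset_E:
  assumes "irreducible_curve X C" "C \<subseteq> E i"
  shows "C = E i"
proof (rule ccontr)
  assume "C \<noteq> E i"
  then have "finite C"
    using closed_proper_E_finite[OF irreducible_curveD(3)[OF assms(1)]] assms(2) by blast
  then show False using curve_infinite[OF assms(1)] by simp
qed

text \<open>\<open>X\<close> contains the chain of a point, an exceptional curve and
  \<open>X\<close> itself, which is too long for a set of dimension one.\<close>

lemma curve_proper: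
  assumes "irreducible_curve X C"
  shows "\<not> X \<subseteq> C"
proof
  assume "X \<subseteq> C"
  then have CX: "C = X" using assms by (auto simp: irreducible_curve_def)
  fix i
  obtain x where x: "x \<in> E i" "E i \<noteq> {x}" using E_two_points by blast
  obtain y where y: "y \<in> X" "y None \<notin> range p" using generic_point_X[of "{}"] by blast
  have "{x} \<subset> E i" using x by blast
  moreover have "y \<notin> E i" using y by (auto simp: mem_E)
  then have "E i \<subset> C" using y CX E_subset by blast
  moreover have "\<not> (\<exists>Z Z'. closed_irreducible Z \<and> closed_irreducible Z' \<and> Z \<subset> Z' \<and> Z' \<subset> C)"
    using assms by (simp add: irreducible_curve_def)
  ultimately show False using closed_irreducible_point[of x] closed_irreducible_E[of i] by blast
qed

lemma curve_order_eqI: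
  assumes "irreducible_curve X C" "\<not> vanishes F X" "order_witness X C F n"
  shows "order_along X C F = n"
proof (rule order_along_eqI[OF irreducible_X _ _ curve_proper[OF assms(1)] assms(2,3)])
  show "closed_irreducible C" "C \<subseteq> X" using assms(1) by (auto simp: irreducible_curve_def)
qed

end

section \<open>Affine charts of the blow-up\<close>

lemma ev_ext: "(\<And>s t. ev p s t = ev q s t) \<Longrightarrow> p = q"
  using ev_eq_0_imp[of "p - q"] by simp

text \<open>
  The chart around a point of \<open>E i\<close>: the point \<open>w i + s (u1 + t u2)\<close> lies on the line through
  \<open>p i\<close> with slope \<open>t\<close>, and \<open>E i\<close> is given by \<open>s = 0\<close>. The lines \<open>\<kappa> j\<close> through the other \<open>p j\<close>
  are removed, so that the lines \<open>Some j\<close> are determined by the image point.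
\<close>

locale chart = blown_up_plane p for p :: "'i::finite \<Rightarrow> cp2" +
  fixes i :: 'i and u1 u2 :: "complex^3" and \<kappa> :: "'i \<Rightarrow> complex^3"
  assumes det: "dot (w i) (cross u1 u2) \<noteq> 0" and \<kappa>: "j \<noteq> i \<Longrightarrow> dot (\<kappa> j) (w j) = 0"
begin

definition \<psi> :: "complex \<Rightarrow> complex \<Rightarrow> 'i option \<Rightarrow> complex^3" where
  "\<psi> s t k = (case k of None \<Rightarrow> w i + s *s (u1 + t *s u2)
     | Some j \<Rightarrow> if j = i then cross (w i) (u1 + t *s u2) else cross (w j) (w i + s *s (u1 + t *s u2)))"

lemma \<psi>_simps:
  "\<psi> s t None = w i + s *s (u1 + t *s u2)"
  "\<psi> s t (Some i) = cross (w i) (u1 + t *s u2)"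
  "j \<noteq> i \<Longrightarrow> \<psi> s t (Some j) = cross (w j) (\<psi> s t None)"
  by (simp_all add: \<psi>_def)

text \<open>Up to the common factor \<open>dot (w i) (cross u1 u2)\<close>, the basis dual to
  \<open>w i\<close>, \<open>u1\<close>, \<open>u2\<close>. In particular \<open>l0 = 0\<close> is
  the line at infinity of the chart.\<close>

abbreviation (input) l0 where "l0 \<equiv> cross u1 u2"
abbreviation (input) l1 where "l1 \<equiv> cross u2 (w i)"
abbreviation (input) l2 where "l2 \<equiv> cross (w i) u1"

text \<open>A common denominator of the chart coordinates \<open>\<sigma>\<close> and
  \<open>\<tau>\<close>.\<close>

definition H :: "('i option \<Rightarrow> complex^3) \<Rightarrow> complex" where
  "H v = dot l0 (v None) * dot u2 (v (Some i))"

definition G0 :: "('i option \<Rightarrow> complex^3) \<Rightarrow> complex" where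
  "G0 v = H v * (\<Prod>j\<in>UNIV - {i}. dot (\<kappa> j) (v None))"

definition \<sigma> :: "('i option \<Rightarrow> cp2) \<Rightarrow> complex" where
  "\<sigma> y = dot l1 (coords y None) / dot l0 (coords y None)"

text \<open>On \<open>cross (w i) (u1 + t *s u2)\<close> the forms \<open>dot u1\<close> and
  \<open>dot u2\<close> take the values \<open>- t\<close> and \<open>1\<close> times the
  determinant, hence the sign.\<close>

definition \<tau> :: "('i option \<Rightarrow> cp2) \<Rightarrow> complex" where
  "\<tau> y = - dot u1 (coords y (Some i)) / dot u2 (coords y (Some i))"

definition U where "U = {y \<in> X. G0 (coords y) \<noteq> 0}"

lemma multiform_H: "multiform (\<lambda>k. unit_deg None k + unit_deg (Some i) k) H"
  unfolding H_def by (intro multiform_mult multiform_dot)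

lemma multiform_G0: "\<exists>d. multiform d G0"
proof -
  have "multiform (\<lambda>k. (unit_deg None k + unit_deg (Some i) k) + (\<Sum>j\<in>UNIV - {i}. unit_deg None k)) G0"
    unfolding G0_def by (intro multiform_mult multiform_prod multiform_dot multiform_H)
  then show ?thesis by blast
qed

lemma zariski_closed_G0: "zariski_closed {y. G0 (coords y) = 0}"
  using multiform_G0 zariski_closed_form by blast

lemma U_D:
  assumes "y \<in> U"
  shows "y \<in> X" "dot l0 (coords y None) \<noteq> 0" "dot u2 (coords y (Some i)) \<noteq> 0"
    "j \<noteq> i \<Longrightarrow> dot (\<kappa> j) (coords y None) \<noteq> 0" "H (coords y) \<noteq> 0" "G0 (coords y) \<noteq> 0"
  using assms by (auto simp: U_def G0_def H_def)

lemma dot_l: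
  "dot l0 (w i) = dot (w i) (cross u1 u2)" "dot l0 u1 = 0" "dot l0 u2 = 0"
  "dot l1 (w i) = 0" "dot l1 u1 = dot (w i) (cross u1 u2)" "dot l1 u2 = 0"
  "dot u2 (cross (w i) (u1 + t *s u2)) = dot (w i) (cross u1 u2)"
  "dot u1 (cross (w i) (u1 + t *s u2)) = - t * dot (w i) (cross u1 u2)"
  by (simp_all add: dot_def algebra_simps)

text \<open>Cramer's rule expands the image point in the basis \<open>w i\<close>,
  \<open>u1\<close>, \<open>u2\<close>. Its incidence with the line \<open>Some i\<close> says that
  the ratio of the last two coordinates is the slope \<open>\<tau> y\<close>; the remaining lines
  are determined because the image point is none of the other \<open>p j\<close>.\<close>

lemma U_coords:
  assumes y: "y \<in> U"
  shows "\<exists>c. coords y k = c *s \<psi> (\<sigma> y) (\<tau> y) k"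
proof -
  define v L D where "v = coords y None" and "L = coords y (Some i)" and "D = dot (w i) (cross u1 u2)"
  have D: "D \<noteq> 0" using det by (simp add: D_def)
  have nz: "dot l0 v \<noteq> 0" "dot u2 L \<noteq> 0" using U_D[OF y] by (simp_all add: v_def L_def)
  have L: "dot L (w i) = 0" "dot L v = 0" using U_D(1)[OF y] by (auto simp: mem_blowup L_def v_def)
  have \<sigma>: "dot l1 v = \<sigma> y * dot l0 v" using nz by (simp add: \<sigma>_def v_def)
  have \<tau>: "dot u1 L = - \<tau> y * dot u2 L" using nz by (simp add: \<tau>_def L_def)
  have cr: "D *s v = dot l0 v *s w i + dot l1 v *s u1 + dot l2 v *s u2"
    unfolding D_def by (rule cramer3)
  have gen: "b * (c - t * a) = 0" if "a * (- t * b) + c * b = 0" for a b c t :: complex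
  proof -
    have "b * (c - t * a) = a * (- t * b) + c * b" by (simp add: algebra_simps)
    then show ?thesis unfolding that .
  qed
  have "dot L (D *s v) = dot l1 v * dot u1 L + dot l2 v * dot u2 L"
    unfolding cr using L(1) by (simp add: dot_algebra dot_commute[of L])
  then have "dot l1 v * (- \<tau> y * dot u2 L) + dot l2 v * dot u2 L = 0"
    using L(2) \<tau> by (simp add: dot_algebra)
  then have "dot u2 L * (dot l2 v - \<tau> y * dot l1 v) = 0" by (rule gen)
  then have l2: "dot l2 v = \<tau> y * dot l1 v" using nz by simp
  have "D *s v = dot l0 v *s \<psi> (\<sigma> y) (\<tau> y) None"
    unfolding cr l2 \<sigma> \<psi>_simps by (simp add: vec3_eq_iff algebra_simps)
  then have "(1 / D) *s (D *s v) = (dot l0 v / D) *s \<psi> (\<sigma> y) (\<tau> y) None"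
    by (simp add: vector_smult_assoc)
  moreover have "(1 / D) *s (D *s v) = v" using D by (subst vector_smult_assoc) simp
  ultimately have v: "v = (dot l0 v / D) *s \<psi> (\<sigma> y) (\<tau> y) None" by argo
  show ?thesis
  proof (cases k)
    case None
    then show ?thesis using v unfolding v_def by blast
  next
    case (Some j)
    show ?thesis
    proof (cases "j = i")
      case True
      have "dot u2 (cross (w i) (u1 + \<tau> y *s u2)) \<noteq> 0" using D unfolding dot_l D_def .
      then have "cross (w i) (u1 + \<tau> y *s u2) \<noteq> 0" by auto
      moreover have "dot L (u1 + \<tau> y *s u2) = 0" using \<tau> by (simp add: dot_algebra dot_commute[of L])
      ultimately have "\<exists>c. L = c *s cross (w i) (u1 + \<tau> y *s u2)" using perp_scale L(1) by blast
      then show ?thesis unfolding Some True \<psi>_simps L_def .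
    next
      case False
      have "y None \<noteq> p j"
      proof
        assume "y None = p j"
        then have "dot (\<kappa> j) (coords y None) = 0" using \<kappa>[OF False] by (simp add: coords_def w_def)
        then show False using U_D(4)[OF y False] by simp
      qed
      then obtain c where "coords y (Some j) = c *s cross (w j) v"
        using line_through[OF U_D(1)[OF y]] unfolding v_def by blast
      also have "cross (w j) v = (dot l0 v / D) *s \<psi> (\<sigma> y) (\<tau> y) (Some j)"
        unfolding \<psi>_simps(3)[OF False] cross_linear(2)[symmetric] v[symmetric] ..
      finally have "coords y (Some j) = (c * (dot l0 v / D)) *s \<psi> (\<sigma> y) (\<tau> y) (Some j)"
        by (simp only: vector_smult_assoc)
      then show ?thesis unfolding Some by (rule exI)
    qed
  qed
qed

text \<open>The converse of \<open>U_coords\<close>: together they identify \<open>U\<close> with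
  the open subset of the \<open>(s, t)\<close>-plane on which \<open>G0 (\<psi> s t)\<close> is
  nonzero.\<close>

lemma \<psi>_point:
  assumes G: "G0 (\<psi> s t) \<noteq> 0"
  shows "\<psi> s t k \<noteq> 0" "point_of (\<psi> s t) \<in> U" "\<sigma> (point_of (\<psi> s t)) = s" "\<tau> (point_of (\<psi> s t)) = t"
proof -
  have g: "dot l0 (\<psi> s t None) \<noteq> 0" "dot u2 (\<psi> s t (Some i)) \<noteq> 0"
    "\<And>j. j \<noteq> i \<Longrightarrow> dot (\<kappa> j) (\<psi> s t None) \<noteq> 0"
    using G by (auto simp: G0_def H_def)
  have nz: "\<psi> s t k \<noteq> 0" for k
  proof (cases k)
    case None
    then show ?thesis using g(1) by auto
  next
    case (Some j)
    show ?thesis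
    proof (cases "j = i")
      case True
      then show ?thesis using g(2) Some by auto
    next
      case False
      have "cross (w j) (\<psi> s t None) \<noteq> 0"
      proof
        assume "cross (w j) (\<psi> s t None) = 0"
        then obtain c where "\<psi> s t None = c *s w j" using cross_eq_0_imp_scale[OF _ w_nonzero] by blast
        then have "dot (\<kappa> j) (\<psi> s t None) = 0" using \<kappa>[OF False] by (simp add: dot_algebra)
        then show False using g(3)[OF False] by simp
      qed
      then show ?thesis unfolding Some \<psi>_simps(3)[OF False] .
    qed
  qed
  show "\<psi> s t k \<noteq> 0" by (rule nz)
  obtain c where "(\<forall>k. c k \<noteq> 0) \<and> coords (point_of (\<psi> s t)) = (\<lambda>k. c k *s \<psi> s t k)"
    using coords_point_of[of "\<psi> s t", OF nz] ..
  then have c: "\<And>k. c k \<noteq> 0" "\<And>k. coords (point_of (\<psi> s t)) k = c k *s \<psi> s t k" by simp_all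
  have "dot (\<psi> s t (Some j)) (w j) = 0 \<and> dot (\<psi> s t (Some j)) (\<psi> s t None) = 0" for j
  proof (cases "j = i")
    case True
    have "dot (cross a q) a = 0 \<and> dot (cross a q) (a + s *s q) = 0" for a q
      by (simp add: dot_def algebra_simps)
    then show ?thesis unfolding True \<psi>_simps(1,2) .
  next
    case False
    then show ?thesis unfolding \<psi>_simps(3)[OF False] by simp
  qed
  then have X: "point_of (\<psi> s t) \<in> X" by (simp add: mem_blowup c(2) dot_algebra)
  obtain d where "multiform d G0" using multiform_G0 by blast
  then have "G0 (coords (point_of (\<psi> s t))) \<noteq> 0" using form_point_of_0_iff[of d G0 "\<psi> s t"] nz G by blast
  then show "point_of (\<psi> s t) \<in> U" using X by (simp add: U_def)
  have "dot l0 (\<psi> s t None) = dot (w i) (cross u1 u2)" "dot l1 (\<psi> s t None) = s * dot (w i) (cross u1 u2)"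
    unfolding \<psi>_simps dot_algebra dot_l by simp_all
  then show "\<sigma> (point_of (\<psi> s t)) = s"
    using det c(1)[of None] by (simp add: \<sigma>_def c(2) dot_algebra)
  show "\<tau> (point_of (\<psi> s t)) = t"
    using det c(1)[of "Some i"] unfolding \<tau>_def c(2) dot_algebra \<psi>_simps dot_l by simp
qed

lemma \<psi>_poly: "\<exists>q. \<forall>s t. \<psi> s t k $ m = ev q s t"
proof -
  have N: "\<exists>q. \<forall>s t. \<psi> s t None $ m = ev q s t" for m
    by (rule exI[of _ "[:[:w i $ m, u1 $ m:], [:0, u2 $ m:]:]"]) (simp add: \<psi>_simps algebra_simps)
  show ?thesis
  proof (cases k)
    case None
    then show ?thesis using N by simp
  next
    case (Some j)
    show ?thesis
    proof (cases "j = i")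
      case True
      show ?thesis unfolding Some True \<psi>_simps
        by (rule exI[of _ "[:[:cross (w i) u1 $ m:], [:cross (w i) u2 $ m:]:]"]) (simp add: cross_linear)
    next
      case False
      obtain q where q: "\<And>m s t. \<psi> s t None $ m = ev (q m) s t" using N by metis
      have m: "m = 1 \<or> m = 2 \<or> m = 3" using exhaust_3 by blast
      define r where "r a b = smult [:w j $ a:] (q b) - smult [:w j $ b:] (q a)" for a b
      have r: "ev (r a b) s t = w j $ a * \<psi> s t None $ b - w j $ b * \<psi> s t None $ a" for a b s t
        by (simp add: r_def q)
      have "\<exists>q. \<forall>s t. cross (w j) (\<psi> s t None) $ m = ev q s t"
        using m by (elim disjE) (simp_all only: cross_component r[symmetric], blast+)
      then show ?thesis unfolding Some \<psi>_simps(3)[OF False] .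
    qed
  qed
qed

text \<open>The expression of a form in the chart coordinates; \<open>ev_ext\<close> makes the
  choice unique.\<close>

definition pull :: "(('i option \<Rightarrow> complex^3) \<Rightarrow> complex) \<Rightarrow> complex poly poly" where
  "pull F = (SOME q. \<forall>s t. F (\<psi> s t) = ev q s t)"

lemma ev_pull: "multiform d F \<Longrightarrow> ev (pull F) s t = F (\<psi> s t)"
proof -
  assume "multiform d F"
  then have "\<exists>q. \<forall>s t. F (\<psi> s t) = ev q s t"
    by (intro polyfun_ev[OF multiform_polyfun, of d F \<psi>] \<psi>_poly)
  then have "\<forall>s t. F (\<psi> s t) = ev (pull F) s t" unfolding pull_def by (rule someI_ex)
  then show ?thesis by simp
qed

lemma pull_mult: "multiform d F \<Longrightarrow> multiform e G \<Longrightarrow> pull (\<lambda>v. F v * G v) = pull F * pull G"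
  by (rule ev_ext) (simp add: ev_pull ev_pull[OF multiform_mult])

lemma form_U_0_iff: "multiform d F \<Longrightarrow> y \<in> U \<Longrightarrow> F (coords y) = 0 \<longleftrightarrow> ev (pull F) (\<sigma> y) (\<tau> y) = 0"
  unfolding ev_pull by (rule form_coords_0_iff[OF _ U_coords])

text \<open>Numerator and denominator have the same multidegree, so the scalars between
  \<open>coords y\<close> and \<open>\<psi>\<close> cancel.\<close>

lemma ratio_U:
  assumes A: "multiform d A" and B: "multiform d B" and y: "y \<in> U"
  shows "A (coords y) / B (coords y) = ev (pull A) (\<sigma> y) (\<tau> y) / ev (pull B) (\<sigma> y) (\<tau> y)"
proof -
  obtain c where c: "\<And>k. coords y k = c k *s \<psi> (\<sigma> y) (\<tau> y) k" using U_coords[OF y] by metis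
  have "c k \<noteq> 0" for k using c[of k] coords_nonzero[of y k] by auto
  then have pr: "(\<Prod>k\<in>UNIV. c k ^ d k) \<noteq> 0" by simp
  have eq: "coords y = (\<lambda>k. c k *s \<psi> (\<sigma> y) (\<tau> y) k)" using c by (rule ext)
  show ?thesis
    unfolding eq multiform_scale[OF A] multiform_scale[OF B] ev_pull[OF A] ev_pull[OF B]
    by (rule mult_divide_mult_cancel_left[OF pr])
qed

text \<open>Polynomials in the chart coordinates are quotients of multiforms by powers of \<open>H\<close>.\<close>

definition chart_fraction :: "(('i option \<Rightarrow> cp2) \<Rightarrow> complex) \<Rightarrow> bool" where
  "chart_fraction f \<longleftrightarrow> (\<exists>A N. multiform (\<lambda>k. N * (unit_deg None k + unit_deg (Some i) k)) A \<and>
     (\<forall>y. H (coords y) \<noteq> 0 \<longrightarrow> f y = A (coords y) / H (coords y) ^ N))"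

lemma chart_fractionI:
  "multiform (\<lambda>k. N * (unit_deg None k + unit_deg (Some i) k)) A \<Longrightarrow>
    (\<And>y. H (coords y) \<noteq> 0 \<Longrightarrow> f y = A (coords y) / H (coords y) ^ N) \<Longrightarrow> chart_fraction f"
  unfolding chart_fraction_def by blast

lemma chart_fraction_const: "chart_fraction (\<lambda>y. c)"
  by (rule chart_fractionI[of 0 "\<lambda>v. c"]) (simp_all add: multiform_const)

lemma chart_fraction_add: "chart_fraction f \<Longrightarrow> chart_fraction g \<Longrightarrow> chart_fraction (\<lambda>y. f y + g y)"
proof -
  assume "chart_fraction f" "chart_fraction g"
  then obtain A N B M where A: "multiform (\<lambda>k. N * (unit_deg None k + unit_deg (Some i) k)) A"
      "\<And>y. H (coords y) \<noteq> 0 \<Longrightarrow> f y = A (coords y) / H (coords y) ^ N"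
    and B: "multiform (\<lambda>k. M * (unit_deg None k + unit_deg (Some i) k)) B"
      "\<And>y. H (coords y) \<noteq> 0 \<Longrightarrow> g y = B (coords y) / H (coords y) ^ M"
    unfolding chart_fraction_def by blast
  show ?thesis
  proof (rule chart_fractionI[of "N + M" "\<lambda>v. A v * H v ^ M + H v ^ N * B v"])
    show "multiform (\<lambda>k. (N + M) * (unit_deg None k + unit_deg (Some i) k)) (\<lambda>v. A v * H v ^ M + H v ^ N * B v)"
      unfolding distrib_right[of N M]
      by (intro multiform_add multiform_mult multiform_power A(1) B(1) multiform_H)
    show "f y + g y = (A (coords y) * H (coords y) ^ M + H (coords y) ^ N * B (coords y)) / H (coords y) ^ (N + M)"
      if "H (coords y) \<noteq> 0" for y
      using that by (simp add: A(2) B(2) power_add add_frac_eq)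
  qed
qed

lemma chart_fraction_mult: "chart_fraction f \<Longrightarrow> chart_fraction g \<Longrightarrow> chart_fraction (\<lambda>y. f y * g y)"
proof -
  assume "chart_fraction f" "chart_fraction g"
  then obtain A N B M where A: "multiform (\<lambda>k. N * (unit_deg None k + unit_deg (Some i) k)) A"
      "\<And>y. H (coords y) \<noteq> 0 \<Longrightarrow> f y = A (coords y) / H (coords y) ^ N"
    and B: "multiform (\<lambda>k. M * (unit_deg None k + unit_deg (Some i) k)) B"
      "\<And>y. H (coords y) \<noteq> 0 \<Longrightarrow> g y = B (coords y) / H (coords y) ^ M"
    unfolding chart_fraction_def by blast
  show ?thesis
  proof (rule chart_fractionI[of "N + M" "\<lambda>v. A v * B v"])
    show "multiform (\<lambda>k. (N + M) * (unit_deg None k + unit_deg (Some i) k)) (\<lambda>v. A v * B v)"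
      unfolding distrib_right[of N M] by (intro multiform_mult A(1) B(1))
    show "f y * g y = A (coords y) * B (coords y) / H (coords y) ^ (N + M)"
      if "H (coords y) \<noteq> 0" for y
      using that by (simp add: A(2) B(2) power_add)
  qed
qed

lemma chart_fraction_\<sigma>: "chart_fraction \<sigma>"
proof (rule chart_fractionI[of 1 "\<lambda>v. dot l1 (v None) * dot u2 (v (Some i))"])
  show "multiform (\<lambda>k. 1 * (unit_deg None k + unit_deg (Some i) k)) (\<lambda>v. dot l1 (v None) * dot u2 (v (Some i)))"
    unfolding mult_1 by (intro multiform_mult multiform_dot)
qed (auto simp: \<sigma>_def H_def)

lemma chart_fraction_\<tau>: "chart_fraction \<tau>"
proof (rule chart_fractionI[of 1 "\<lambda>v. dot l0 (v None) * (- 1 * dot u1 (v (Some i)))"])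
  show "multiform (\<lambda>k. 1 * (unit_deg None k + unit_deg (Some i) k)) (\<lambda>v. dot l0 (v None) * (- 1 * dot u1 (v (Some i))))"
    unfolding mult_1 by (intro multiform_mult multiform_cmult multiform_dot)
qed (auto simp: \<tau>_def H_def)

lemma chart_fraction_ev: "chart_fraction (\<lambda>y. ev q (\<sigma> y) (\<tau> y))"
proof (induction q)
  case 0
  show ?case by (simp add: chart_fraction_const)
next
  case (pCons c q)
  have "chart_fraction (\<lambda>y. poly c (\<sigma> y))"
    by (induction c) (simp_all add: chart_fraction_const chart_fraction_add chart_fraction_mult chart_fraction_\<sigma>)
  then show ?case using pCons by (simp add: chart_fraction_add chart_fraction_mult chart_fraction_\<tau>)
qed

lemma ev_form:
  "\<exists>d A. multiform d A \<and> (\<forall>y\<in>U. A (coords y) = 0 \<longleftrightarrow> ev q (\<sigma> y) (\<tau> y) = 0)"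
proof -
  obtain A N where A: "multiform (\<lambda>k. N * (unit_deg None k + unit_deg (Some i) k)) A"
      "\<And>y. H (coords y) \<noteq> 0 \<Longrightarrow> ev q (\<sigma> y) (\<tau> y) = A (coords y) / H (coords y) ^ N"
    using chart_fraction_ev[of q] unfolding chart_fraction_def by blast
  have "A (coords y) = 0 \<longleftrightarrow> ev q (\<sigma> y) (\<tau> y) = 0" if "y \<in> U" for y
    using A(2)[OF U_D(5)[OF that]] U_D(5)[OF that] by simp
  then show ?thesis using A(1) by blast
qed

lemma regular_ev_U: "x \<in> U \<Longrightarrow> regular_at X x (\<lambda>y. ev q (\<sigma> y) (\<tau> y))"
proof (rule regular_ev)
  assume x: "x \<in> U"
  show "regular_at X x \<sigma>"
    unfolding \<sigma>_def by (rule regular_ratio[OF multiform_dot multiform_dot]) (rule U_D(2)[OF x])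
  have "regular_at X x (\<lambda>y. (- 1 * dot u1 (coords y (Some i))) / dot u2 (coords y (Some i)))"
    by (rule regular_ratio[OF multiform_cmult[OF multiform_dot] multiform_dot]) (rule U_D(3)[OF x])
  then show "regular_at X x \<tau>" unfolding \<tau>_def by simp
qed

section \<open>Equations of curves in a chart\<close>

definition V where "V C = (\<lambda>y. (\<sigma> y, \<tau> y)) ` (C \<inter> U)"

lemma V_ideal: "q \<in> vanishing_ideal (V C) \<longleftrightarrow> (\<forall>y\<in>C \<inter> U. ev q (\<sigma> y) (\<tau> y) = 0)"
  by (auto simp: vanishing_ideal_def V_def)

lemma vanishes_U:
  assumes "zariski_irreducible C" "C \<subseteq> X" "C \<inter> U \<noteq> {}" "multiform d F"
    "\<And>y. y \<in> C \<Longrightarrow> y \<in> U \<Longrightarrow> F (coords y) = 0"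
  shows "vanishes F C"
proof (rule irreducible_vanishes_off[OF assms(1,4) zariski_closed_G0])
  show "\<not> C \<subseteq> {y. G0 (coords y) = 0}" using assms(3) by (auto simp: U_def)
  show "F (coords y) = 0" if "y \<in> C" "y \<notin> {y. G0 (coords y) = 0}" for y
    using that assms(2) by (intro assms(5)) (auto simp: U_def)
qed

lemma vanishes_iff_pull:
  assumes "zariski_irreducible C" "C \<subseteq> X" "C \<inter> U \<noteq> {}" "multiform d F"
  shows "vanishes F C \<longleftrightarrow> pull F \<in> vanishing_ideal (V C)"
proof
  assume "vanishes F C"
  then show "pull F \<in> vanishing_ideal (V C)"
    unfolding V_ideal using form_U_0_iff[OF assms(4)] by (auto simp: vanishes_def)
next
  assume "pull F \<in> vanishing_ideal (V C)"
  then have "F (coords y) = 0" if "y \<in> C" "y \<in> U" for y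
    using form_U_0_iff[OF assms(4) that(2)] that unfolding V_ideal by blast
  then show "vanishes F C" using vanishes_U[OF assms] by blast
qed

text \<open>By \<open>ev_form\<close> a polynomial in the chart coordinates has the same zeros on
  \<open>U\<close> as some form, so the irreducibility of \<open>C\<close> passes to the
  ideal.\<close>

lemma prime_V:
  assumes C: "zariski_irreducible C" "C \<subseteq> X" "C \<inter> U \<noteq> {}"
  shows "prime_set (V C)"
  unfolding prime_set_def
proof (intro conjI allI impI)
  show "V C \<noteq> {}" using C(3) by (auto simp: V_def)
  fix a b assume ab: "a * b \<in> vanishing_ideal (V C)"
  obtain d A where A: "multiform d A" "\<And>y. y \<in> U \<Longrightarrow> A (coords y) = 0 \<longleftrightarrow> ev a (\<sigma> y) (\<tau> y) = 0"
    using ev_form[of a] by blast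
  obtain e B where B: "multiform e B" "\<And>y. y \<in> U \<Longrightarrow> B (coords y) = 0 \<longleftrightarrow> ev b (\<sigma> y) (\<tau> y) = 0"
    using ev_form[of b] by blast
  have "vanishes (\<lambda>v. A v * B v) C"
  proof (rule vanishes_U[OF C multiform_mult[OF A(1) B(1)]])
    fix y assume y: "y \<in> C" "y \<in> U"
    then have "ev a (\<sigma> y) (\<tau> y) * ev b (\<sigma> y) (\<tau> y) = 0" using ab unfolding V_ideal by auto
    then show "A (coords y) * B (coords y) = 0" using A(2)[OF y(2)] B(2)[OF y(2)] by auto
  qed
  then have "vanishes A C \<or> vanishes B C" by (rule irreducible_vanishes_mult[OF C(1) A(1) B(1)])
  then show "a \<in> vanishing_ideal (V C) \<or> b \<in> vanishing_ideal (V C)"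
    unfolding V_ideal vanishes_def using A(2) B(2) by auto
qed

lemma pull_eq_0_iff:
  assumes "multiform d F" "U \<noteq> {}"
  shows "pull F = 0 \<longleftrightarrow> vanishes F X"
proof
  assume p: "pull F = 0"
  have "X \<inter> U \<noteq> {}" using assms(2) by (auto simp: U_def)
  then show "vanishes F X"
    using vanishes_U[OF irreducible_X subset_refl _ assms(1)] form_U_0_iff[OF assms(1)] p by simp
next
  assume v: "vanishes F X"
  obtain d0 where d0: "multiform d0 G0" using multiform_G0 by blast
  obtain x where x: "x \<in> U" using assms(2) by blast
  \<comment> \<open>The vanishing of \<open>F\<close> on \<open>X\<close> is visible only where
    \<open>\<psi>\<close> lands in \<open>U\<close>. The factor \<open>pull G0\<close> takes care of
    the other parameters and is cancelled afterwards.\<close>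
  have "pull G0 * pull F = 0"
  proof (rule ev_ext)
    fix s t
    show "ev (pull G0 * pull F) s t = ev 0 s t"
    proof (cases "G0 (\<psi> s t) = 0")
      case True
      then show ?thesis by (simp add: ev_pull[OF d0])
    next
      case False
      have "F (coords (point_of (\<psi> s t))) = 0"
        using v \<psi>_point(2)[OF False] by (auto simp: vanishes_def U_def)
      then have "F (\<psi> s t) = 0" using form_point_of_0_iff[OF assms(1)] \<psi>_point(1)[OF False] by blast
      then show ?thesis by (simp add: ev_pull[OF assms(1)])
    qed
  qed
  moreover have "pull G0 \<noteq> 0" using form_U_0_iff[OF d0 x] U_D(6)[OF x] by auto
  ultimately show "pull F = 0" by simp
qed

text \<open>The image of \<open>C\<close> in the plane of parameters is not a point because
  \<open>C\<close> is infinite, and its ideal is nonzero because \<open>C\<close> is not all of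
  \<open>X\<close>; so \<open>prime_set_principal\<close> applies.\<close>

lemma curve_equation:
  assumes C: "irreducible_curve X C" "C \<inter> U \<noteq> {}"
  shows "\<exists>f. prime_elem f \<and> (\<forall>q. q \<in> vanishing_ideal (V C) \<longleftrightarrow> f dvd q)"
proof -
  note D = irreducible_curveD[OF C(1)]
  have pr: "prime_set (V C)" by (rule prime_V[OF D(4,1) C(2)])
  have ns: "V C \<noteq> {(a, b)}" for a b
  proof
    assume V: "V C = {(a, b)}"
    have "C \<subseteq> {point_of (\<psi> a b)} \<union> {y. G0 (coords y) = 0}"
    proof
      fix y assume y: "y \<in> C"
      show "y \<in> {point_of (\<psi> a b)} \<union> {y. G0 (coords y) = 0}"
      proof (cases "y \<in> U")
        case True
        then have "(\<sigma> y, \<tau> y) \<in> V C" using y by (auto simp: V_def)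
        then have "\<sigma> y = a" "\<tau> y = b" using V by auto
        then have "y = point_of (\<psi> a b)" using eq_point_of[OF U_coords[OF True]] by simp
        then show ?thesis by simp
      next
        case False
        then show ?thesis using y D(1) by (auto simp: U_def)
      qed
    qed
    then have "C \<subseteq> {point_of (\<psi> a b)} \<or> C \<subseteq> {y. G0 (coords y) = 0}"
      by (rule irreducible_UnD[OF D(4) zariski_closed_point zariski_closed_G0])
    moreover have "\<not> C \<subseteq> {y. G0 (coords y) = 0}" using C(2) by (auto simp: U_def)
    ultimately have "finite C" using finite_subset by blast
    then show False using curve_infinite[OF C(1)] by simp
  qed
  obtain z where z: "z \<in> X" "z \<notin> C" using curve_proper[OF C(1)] by blast
  obtain d F where F: "multiform d F" "F (coords z) \<noteq> 0" "vanishes F C"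
    using zariski_closed_not_mem[OF D(3) z(2)] by blast
  have "U \<noteq> {}" using C(2) by blast
  then have "pull F \<noteq> 0" using pull_eq_0_iff[OF F(1)] F(2) z(1) by (auto simp: vanishes_def)
  moreover have "pull F \<in> vanishing_ideal (V C)"
    using vanishes_iff_pull[OF D(4,1) C(2) F(1)] F(3) by simp
  ultimately obtain f where f: "f \<noteq> 0" "\<forall>q. q \<in> vanishing_ideal (V C) \<longleftrightarrow> f dvd q"
    using prime_set_principal[OF pr ns] by blast
  then have "prime_elem f" using principal_prime_elem[OF pr f(1)] by blast
  then show ?thesis using f(2) by blast
qed

text \<open>If \<open>A / B\<close> lies in the ideal of \<open>C\<close> at \<open>x\<close>, then
  \<open>A\<close> vanishes on \<open>C\<close> and its pullback is \<open>f * q\<close>; the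
  cofactor \<open>q / pull B\<close> is regular at \<open>x\<close>. Conversely a multiple of
  \<open>f\<close> vanishes on \<open>C\<close> near \<open>x\<close>.\<close>

lemma local_equation_chart:
  assumes C: "irreducible_curve X C" "x \<in> C" "x \<in> U"
    and f: "\<And>q. q \<in> vanishing_ideal (V C) \<longleftrightarrow> f dvd q"
  shows "local_equation X C x (\<lambda>y. ev f (\<sigma> y) (\<tau> y))"
  unfolding local_equation_def
proof (intro conjI equalityI subsetI)
  note D = irreducible_curveD[OF C(1)]
  have CU: "C \<inter> U \<noteq> {}" using C by blast
  have fC: "ev f (\<sigma> y) (\<tau> y) = 0" if "y \<in> C" "y \<in> U" for y
  proof -
    have "f \<in> vanishing_ideal (V C)" using f by simp
    then show ?thesis using that unfolding V_ideal by blast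
  qed
  show rf: "regular_at X x (\<lambda>y. ev f (\<sigma> y) (\<tau> y))" by (rule regular_ev_U[OF C(3)])
  {
    fix g assume g: "g \<in> curve_ideal X C x"
    then have gr: "regular_at X x g" and gn: "near C x (\<lambda>y. g y = 0)" by (simp_all add: curve_ideal_def)
    obtain d A B where AB: "multiform d A" "multiform d B" "B (coords x) \<noteq> 0"
      "\<And>y. y \<in> X \<Longrightarrow> B (coords y) \<noteq> 0 \<Longrightarrow> g y = A (coords y) / B (coords y)"
      using gr unfolding regular_at_def by blast
    have "vanishes A C" by (rule curve_ideal_numerator[OF D(4,1) C(2) gn AB(4,1,2,3)])
    then have "f dvd pull A" using vanishes_iff_pull[OF D(4,1) CU AB(1)] f by simp
    then obtain q where q: "pull A = f * q" by (rule dvdE)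
    define k where "k y = ev q (\<sigma> y) (\<tau> y) * (1 / ev (pull B) (\<sigma> y) (\<tau> y))" for y
    have "ev (pull B) (\<sigma> x) (\<tau> x) \<noteq> 0" using form_U_0_iff[OF AB(2) C(3)] AB(3) by simp
    then have "regular_at X x k" unfolding k_def using C(3)
      by (intro regular_mult regular_inverse regular_ev_U) (auto simp: U_def)
    moreover have "near X x (\<lambda>y. g y = ev f (\<sigma> y) (\<tau> y) * k y)"
      unfolding near_def
    proof (intro exI conjI ballI)
      show "zariski_closed ({y. G0 (coords y) = 0} \<union> {y. B (coords y) = 0})"
        by (intro zariski_closed_Un zariski_closed_G0 zariski_closed_form[OF AB(2)])
      show "x \<notin> {y. G0 (coords y) = 0} \<union> {y. B (coords y) = 0}" using C(3) AB(3) by (simp add: U_def)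
      fix y assume y: "y \<in> X - ({y. G0 (coords y) = 0} \<union> {y. B (coords y) = 0})"
      then have yU: "y \<in> U" by (simp add: U_def)
      have "g y = A (coords y) / B (coords y)" using AB(4) y by simp
      also have "\<dots> = ev (pull A) (\<sigma> y) (\<tau> y) / ev (pull B) (\<sigma> y) (\<tau> y)"
        by (rule ratio_U[OF AB(1,2) yU])
      finally show "g y = ev f (\<sigma> y) (\<tau> y) * k y" by (simp add: q k_def)
    qed
    ultimately show "g \<in> {g. regular_at X x g \<and>
        (\<exists>k. regular_at X x k \<and> near X x (\<lambda>y. g y = ev f (\<sigma> y) (\<tau> y) * k y))}"
      using gr by blast
  next
    fix g assume "g \<in> {g. regular_at X x g \<and>
        (\<exists>k. regular_at X x k \<and> near X x (\<lambda>y. g y = ev f (\<sigma> y) (\<tau> y) * k y))}"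
    then obtain k where g: "regular_at X x g" "near X x (\<lambda>y. g y = ev f (\<sigma> y) (\<tau> y) * k y)" by blast
    from g(2) obtain Z where Z: "zariski_closed Z" "x \<notin> Z" "\<forall>y\<in>X - Z. g y = ev f (\<sigma> y) (\<tau> y) * k y"
      unfolding near_def by (elim exE conjE)
    have "near C x (\<lambda>y. g y = 0)" unfolding near_def
    proof (intro exI conjI ballI)
      show "zariski_closed ({y. G0 (coords y) = 0} \<union> Z)"
        by (intro zariski_closed_Un zariski_closed_G0 Z(1))
      show "x \<notin> {y. G0 (coords y) = 0} \<union> Z" using C(3) Z(2) by (simp add: U_def)
      fix y assume y: "y \<in> C - ({y. G0 (coords y) = 0} \<union> Z)"
      then have "y \<in> X" "y \<in> C" "y \<in> U" "y \<notin> Z" using D(1) by (auto simp: U_def)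
      then show "g y = 0" using Z(3) fC by simp
    qed
    then show "g \<in> curve_ideal X C x" using g(1) by (simp add: curve_ideal_def)
  }
qed

text \<open>Makes the order along \<open>C\<close> the multiplicity of the prime \<open>f\<close> in
  a polynomial, so that later facts about orders become facts about prime factorisations.\<close>

lemma order_chart:
  assumes C: "irreducible_curve X C" "C \<inter> U \<noteq> {}"
    and f: "f \<noteq> 0" "\<And>q. q \<in> vanishing_ideal (V C) \<longleftrightarrow> f dvd q"
    and F: "multiform d F" "pull F = f ^ n * g" "\<not> f dvd g"
  shows "order_along X C F = n"
proof (rule curve_order_eqI[OF C(1)])
  note D = irreducible_curveD[OF C(1)]
  obtain x where x: "x \<in> C" "x \<in> U" using C(2) by blast
  have "g \<noteq> 0" using F(3) by auto
  then have "pull F \<noteq> 0" using F(2) f(1) by simp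
  then show "\<not> vanishes F X" using pull_eq_0_iff[OF F(1)] x by blast
  obtain G where G: "multiform d G" "G (coords x) \<noteq> 0"
    using multiform_nonvanishing_exists[of "coords x" d] by auto
  define k where "k y = ev g (\<sigma> y) (\<tau> y) * (1 / ev (pull G) (\<sigma> y) (\<tau> y))" for y
  have Gx: "ev (pull G) (\<sigma> x) (\<tau> x) \<noteq> 0" using form_U_0_iff[OF G(1) x(2)] G(2) by simp
  then have kr: "regular_at X x k" unfolding k_def using x(2)
    by (intro regular_mult regular_inverse regular_ev_U) (auto simp: U_def)
  have kn: "k \<notin> curve_ideal X C x"
  proof
    assume "k \<in> curve_ideal X C x"
    then obtain Z where Z: "zariski_closed Z" "x \<notin> Z" "\<forall>y\<in>C - Z. k y = 0"
      unfolding curve_ideal_def near_def by blast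
    obtain e A where A: "multiform e A" "\<And>y. y \<in> U \<Longrightarrow> A (coords y) = 0 \<longleftrightarrow> ev g (\<sigma> y) (\<tau> y) = 0"
      using ev_form[of g] by blast
    have "vanishes A C"
    proof (rule irreducible_vanishes_off[OF D(4) A(1)])
      show "zariski_closed (Z \<union> {y. G0 (coords y) = 0} \<union> {y. G (coords y) = 0})"
        by (intro zariski_closed_Un zariski_closed_G0 zariski_closed_form[OF G(1)] Z(1))
      show "\<not> C \<subseteq> Z \<union> {y. G0 (coords y) = 0} \<union> {y. G (coords y) = 0}"
        using x Z(2) G(2) by (auto simp: U_def)
      fix y assume y: "y \<in> C" "y \<notin> Z \<union> {y. G0 (coords y) = 0} \<union> {y. G (coords y) = 0}"
      then have yU: "y \<in> U" using D(1) by (auto simp: U_def)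
      have "ev (pull G) (\<sigma> y) (\<tau> y) \<noteq> 0" using form_U_0_iff[OF G(1) yU] y by simp
      moreover have "k y = 0" using Z(3) y by simp
      ultimately have "ev g (\<sigma> y) (\<tau> y) = 0" by (simp add: k_def)
      then show "A (coords y) = 0" using A(2)[OF yU] by simp
    qed
    then have "g \<in> vanishing_ideal (V C)" unfolding V_ideal using A(2) by (auto simp: vanishes_def)
    then show False using f(2) F(3) by simp
  qed
  have "near X x (\<lambda>y. F (coords y) / G (coords y) = ev f (\<sigma> y) (\<tau> y) ^ n * k y)"
    unfolding near_def
  proof (intro exI conjI ballI)
    show "zariski_closed {y. G0 (coords y) = 0}" by (rule zariski_closed_G0)
    show "x \<notin> {y. G0 (coords y) = 0}" using x by (simp add: U_def)
    fix y assume "y \<in> X - {y. G0 (coords y) = 0}"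
    then have "y \<in> U" by (simp add: U_def)
    from ratio_U[OF F(1) G(1) this]
    show "F (coords y) / G (coords y) = ev f (\<sigma> y) (\<tau> y) ^ n * k y" by (simp add: F(2) k_def)
  qed
  then show "order_witness X C F n"
    unfolding order_witness_def
    using x F(1) G kr kn local_equation_chart[OF C(1) x f(2)] by blast
qed

lemma \<sigma>_E: "y \<in> E i \<Longrightarrow> \<sigma> y = 0"
  by (simp add: \<sigma>_def mem_E coords_def dot_l w_def[symmetric])

text \<open>\<open>s\<close> is a local equation of \<open>E i\<close>.\<close>

lemma E_equation:
  assumes "E i \<inter> U \<noteq> {}"
  shows "q \<in> vanishing_ideal (V (E i)) \<longleftrightarrow> [:[:0, 1:]:] dvd q"
proof -
  obtain f where f: "prime_elem f" "\<And>q. q \<in> vanishing_ideal (V (E i)) \<longleftrightarrow> f dvd q"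
    using curve_equation[OF irreducible_curve_E assms] by blast
  have "[:[:0, 1:]:] \<in> vanishing_ideal (V (E i))" unfolding V_ideal using \<sigma>_E by simp
  then have "f dvd [:[:0, 1:]:]" using f(2) by blast
  then obtain g where g: "[:[:0, 1:]:] = f * g" by (rule dvdE)
  have pe: "prime_elem [:[:0, 1 :: complex:]:]" using prime_elem_linear[of 0] by simp
  have "[:[:0, 1:]:] dvd f * g" using g by simp
  then have "[:[:0, 1:]:] dvd f \<or> [:[:0, 1:]:] dvd g" using pe by (rule prime_elem_dvd_multD[rotated])
  moreover have "\<not> [:[:0, 1:]:] dvd g"
  proof
    assume "[:[:0, 1:]:] dvd g"
    then obtain h where "g = [:[:0, 1:]:] * h" by (rule dvdE)
    then have "[:[:0, 1:]:] * 1 = [:[:0, 1:]:] * (f * h)" using g by (simp only: mult_1_right mult.left_commute)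
    then have "f * h = 1" by (subst (asm) mult_left_cancel) auto
    then have "is_unit f" by (metis dvd_triv_left)
    then show False using f(1) by (simp add: prime_elem_def)
  qed
  ultimately have "[:[:0, 1:]:] dvd f" by blast
  then show ?thesis using f(2) \<open>f dvd _\<close> dvd_trans by blast
qed

end

section \<open>Orders of vanishing on the blow-up\<close>

lemma dot_avoid_range:
  assumes "finite A" "\<And>a. a \<in> A \<Longrightarrow> g a \<noteq> 0" "l \<noteq> 0"
  shows "\<exists>v. dot v l \<noteq> 0 \<and> (\<forall>a\<in>A. dot v (g a) \<noteq> 0)"
proof -
  have fin: "finite (insert l (g ` A))" using assms(1) by simp
  have "b \<noteq> 0" if "b \<in> insert l (g ` A)" for b
    using that assms(2,3) by (elim insertE imageE) simp_all
  then have "0 \<notin> insert l (g ` A)" by blast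
  from dot_avoid[OF fin this] obtain v where "\<forall>b\<in>insert l (g ` A). dot v b \<noteq> 0" ..
  then show ?thesis by (intro exI[of _ v]) simp
qed

context blown_up_plane
begin

text \<open>Taking \<open>u1\<close> and \<open>u2\<close> on the line \<open>l\<close> makes
  \<open>l\<close> the line at infinity of the chart. A finite set \<open>T\<close> that avoids
  \<open>l\<close> and the other exceptional curves then fits into one chart. Both the freedom in
  \<open>T\<close> and the control of the line at infinity are used later.\<close>

lemma chart_exists:
  assumes lw: "dot l (w i) \<noteq> 0" and T: "finite T" "T \<subseteq> X"
    and lT: "\<And>y. y \<in> T \<Longrightarrow> dot l (coords y None) \<noteq> 0"
    and off: "\<And>y j. y \<in> T \<Longrightarrow> j \<noteq> i \<Longrightarrow> y None \<noteq> p j"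
  shows "\<exists>u1 u2 \<kappa>. chart p i u1 u2 \<kappa> \<and> T \<subseteq> chart.U p i u1 u2 \<kappa> \<and> dot l u1 = 0 \<and> dot l u2 = 0"
proof -
  have l0: "l \<noteq> 0" using lw by auto
  then obtain e where e: "cross l e \<noteq> 0" using cross_nonzero_exists by blast
  have Lnz: "cross (coords y (Some i)) l \<noteq> 0" if y: "y \<in> T" for y
  proof
    assume "cross (coords y (Some i)) l = 0"
    from cross_eq_0_imp_scale[OF this coords_nonzero] obtain c where c: "l = c *s coords y (Some i)" ..
    have "y \<in> X" using y T(2) by blast
    then have "dot (coords y (Some i)) (w i) = 0" by (simp add: mem_blowup)
    then have "dot l (w i) = 0" unfolding c by (simp add: dot_algebra)
    then show False using lw by simp
  qed
  \<comment> \<open>Since \<open>dot (cross l b) L = dot b (cross L l)\<close>, a \<open>b\<close>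
    outside these planes gives a \<open>u2 = cross l b\<close> that is nonzero on the lines
    \<open>Some i\<close> of the points of \<open>T\<close>. The vector \<open>cross l e\<close>
    keeps \<open>b\<close> from being a multiple of \<open>l\<close>.\<close>
  define A where "A = insert (cross l e) ((\<lambda>y. cross (coords y (Some i)) l) ` T)"
  have finA: "finite A" using T(1) by (simp add: A_def)
  have "a \<noteq> 0" if "a \<in> A" for a
    using that unfolding A_def
  proof (elim insertE imageE)
    show "a \<noteq> 0" if "a = cross l e" using e that by simp
    show "a \<noteq> 0" if "a = cross (coords y (Some i)) l" "y \<in> T" for y
      unfolding that(1) by (rule Lnz[OF that(2)])
  qed
  then have "0 \<notin> A" by blast
  from dot_avoid[OF finA this] obtain b where "\<forall>a\<in>A. dot b a \<noteq> 0" ..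
  then have b: "dot b a \<noteq> 0" if "a \<in> A" for a using that by (rule bspec)
  have bl: "cross b l \<noteq> 0"
  proof
    assume "cross b l = 0"
    moreover have be: "dot b (cross l e) \<noteq> 0" by (rule b) (simp add: A_def)
    then have "b \<noteq> 0" by auto
    ultimately have "\<exists>c. l = c *s b" by (rule cross_eq_0_imp_scale)
    then obtain c where c: "l = c *s b" ..
    have "dot (c *s b) (cross l e) = 0" unfolding c[symmetric] by simp
    then have "c = 0" using be by (simp add: dot_algebra)
    then have "l = 0" unfolding c by simp
    then show False using l0 by simp
  qed
  then obtain b' where b': "dot b' (cross b l) \<noteq> 0" using dot_nonzero_exists by blast
  define u1 u2 where "u1 = cross l b'" and "u2 = cross l b"
  have u12: "cross u1 u2 = dot b' (cross b l) *s l"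
  proof -
    have "dot l (cross b' b) = dot b' (cross b l)" by (simp add: dot_def algebra_simps)
    then show ?thesis unfolding u1_def u2_def cross_cross_left by simp
  qed
  have "\<exists>k. dot k (w j) = 0 \<and> (\<forall>y\<in>T. dot k (coords y None) \<noteq> 0)" if j: "j \<noteq> i" for j
  proof -
    \<comment> \<open>The required line through \<open>p j\<close> is \<open>cross (w j) c\<close>.
      It misses the points of \<open>T\<close> when \<open>c\<close> is outside these
      planes.\<close>
    define B where "B = (\<lambda>y. cross (coords y None) (w j)) ` T"
    have finB: "finite B" using T(1) by (simp add: B_def)
    have "a \<noteq> 0" if "a \<in> B" for a
      using that unfolding B_def
    proof (elim imageE)
      show "a \<noteq> 0" if "a = cross (coords y None) (w j)" "y \<in> T" for y
        unfolding that(1) coords_def w_def by (rule cross_rep_nonzero) (rule off[OF that(2) j])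
    qed
    then have "0 \<notin> B" by blast
    from dot_avoid[OF finB this] obtain c where c: "\<forall>a\<in>B. dot c a \<noteq> 0" ..
    have dc: "dot (cross (w j) c) v = dot c (cross v (w j))" for v by (simp add: dot_def algebra_simps)
    show ?thesis
    proof (intro exI conjI ballI)
      show "dot (cross (w j) c) (w j) = 0" by simp
      show "dot (cross (w j) c) (coords y None) \<noteq> 0" if "y \<in> T" for y
        unfolding dc using c that by (simp add: B_def)
    qed
  qed
  then have "\<forall>j. \<exists>k. j \<noteq> i \<longrightarrow> dot k (w j) = 0 \<and> (\<forall>y\<in>T. dot k (coords y None) \<noteq> 0)" by blast
  from choice[OF this] obtain \<kappa> where
    "\<forall>j. j \<noteq> i \<longrightarrow> dot (\<kappa> j) (w j) = 0 \<and> (\<forall>y\<in>T. dot (\<kappa> j) (coords y None) \<noteq> 0)" ..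
  then have \<kappa>: "\<And>j. j \<noteq> i \<Longrightarrow> dot (\<kappa> j) (w j) = 0"
      "\<And>j y. j \<noteq> i \<Longrightarrow> y \<in> T \<Longrightarrow> dot (\<kappa> j) (coords y None) \<noteq> 0" by blast+
  have "dot (w i) (cross u1 u2) \<noteq> 0" unfolding u12 using b' lw by (simp add: dot_algebra dot_commute[of "w i"])
  then interpret c: chart p i u1 u2 \<kappa> by unfold_locales (assumption, rule \<kappa>(1))
  have "T \<subseteq> c.U"
  proof
    fix y assume y: "y \<in> T"
    have "dot (cross u1 u2) (coords y None) \<noteq> 0" unfolding u12 using b' lT[OF y] by (simp add: dot_algebra)
    moreover have "dot b (cross (coords y (Some i)) l) \<noteq> 0" using y by (intro b) (simp add: A_def)
    then have "dot u2 (coords y (Some i)) \<noteq> 0" unfolding u2_def by (simp add: dot_def algebra_simps)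
    moreover have "(\<Prod>j\<in>UNIV - {i}. dot (\<kappa> j) (coords y None)) \<noteq> 0" using \<kappa>(2)[OF _ y] by simp
    ultimately have "c.G0 (coords y) \<noteq> 0" by (simp add: c.G0_def c.H_def)
    then show "y \<in> c.U" using T(2) y unfolding c.U_def by blast
  qed
  moreover have "dot l u1 = 0" "dot l u2 = 0" by (simp_all add: u1_def u2_def)
  ultimately show ?thesis using c.chart_axioms by blast
qed

lemma chart_at:
  assumes x: "x \<in> X" and i: "x None = p i \<or> x None \<notin> range p"
  shows "\<exists>u1 u2 \<kappa>. chart p i u1 u2 \<kappa> \<and> x \<in> chart.U p i u1 u2 \<kappa>"
proof -
  have "finite {w i, coords x None}" "0 \<notin> {w i, coords x None}" using w_nonzero[of i] coords_nonzero[of x None] by auto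
  then obtain l where l: "\<forall>a\<in>{w i, coords x None}. dot l a \<noteq> 0" using dot_avoid by blast
  have "\<exists>u1 u2 \<kappa>. chart p i u1 u2 \<kappa> \<and> {x} \<subseteq> chart.U p i u1 u2 \<kappa> \<and> dot l u1 = 0 \<and> dot l u2 = 0"
  proof (rule chart_exists)
    show "y None \<noteq> p j" if "y \<in> {x}" "j \<noteq> i" for y j
      using that i inj by (auto dest: injD)
  qed (use x l in auto)
  then show ?thesis by blast
qed

lemma curve_chart:
  assumes "irreducible_curve X C"
  shows "\<exists>i u1 u2 \<kappa>. chart p i u1 u2 \<kappa> \<and> C \<inter> chart.U p i u1 u2 \<kappa> \<noteq> {}"
proof -
  obtain x where x: "x \<in> C" using curve_infinite[OF assms] by fastforce
  then have xX: "x \<in> X" using irreducible_curveD(1)[OF assms] by blast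
  obtain i where "x None = p i \<or> x None \<notin> range p" by blast
  then show ?thesis using chart_at[OF xX] x by blast
qed

lemma chart_at_E: "\<exists>u1 u2 \<kappa>. chart p i u1 u2 \<kappa> \<and> E i \<inter> chart.U p i u1 u2 \<kappa> \<noteq> {}"
proof -
  obtain x where x: "x \<in> E i" using E_nonempty by blast
  then have "x \<in> X" "x None = p i" by (auto simp: mem_E)
  then show ?thesis using chart_at[of x i] x by blast
qed

lemma order_factorisation:
  fixes f F :: "complex poly poly"
  assumes "prime_elem f" "F \<noteq> 0"
  shows "\<exists>n g. F = f ^ n * g \<and> \<not> f dvd g"
proof -
  have "\<not> is_unit f" using assms(1) by (simp add: prime_elem_def)
  then show ?thesis using multiplicity_decompose'[OF assms(2)] by metis
qed

lemma order_along_mult: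
  assumes C: "irreducible_curve X C"
    and F: "multiform d F" "\<not> vanishes F X" and G: "multiform e G" "\<not> vanishes G X"
  shows "order_along X C (\<lambda>v. F v * G v) = order_along X C F + order_along X C G"
proof -
  obtain i u1 u2 \<kappa> where ch: "chart p i u1 u2 \<kappa>" and CU: "C \<inter> chart.U p i u1 u2 \<kappa> \<noteq> {}"
    using curve_chart[OF C] by blast
  interpret c: chart p i u1 u2 \<kappa> by (rule ch)
  obtain f where f: "prime_elem f" "\<And>q. q \<in> vanishing_ideal (c.V C) \<longleftrightarrow> f dvd q"
    using c.curve_equation[OF C CU] by blast
  have f0: "f \<noteq> 0" using f(1) by auto
  have U: "c.U \<noteq> {}" using CU by blast
  obtain m g where g: "c.pull F = f ^ m * g" "\<not> f dvd g"
    using order_factorisation[OF f(1)] c.pull_eq_0_iff[OF F(1) U] F(2) by blast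
  obtain n h where h: "c.pull G = f ^ n * h" "\<not> f dvd h"
    using order_factorisation[OF f(1)] c.pull_eq_0_iff[OF G(1) U] G(2) by blast
  have "c.pull (\<lambda>v. F v * G v) = f ^ (m + n) * (g * h)"
    unfolding c.pull_mult[OF F(1) G(1)] g h by (simp add: power_add mult_ac)
  moreover have "\<not> f dvd g * h" using f(1) g(2) h(2) by (simp add: prime_elem_dvd_mult_iff)
  ultimately have "order_along X C (\<lambda>v. F v * G v) = m + n"
    using c.order_chart[OF C CU f0 f(2) multiform_mult[OF F(1) G(1)]] by blast
  then show ?thesis
    using c.order_chart[OF C CU f0 f(2) F(1) g] c.order_chart[OF C CU f0 f(2) G(1) h] by simp
qed

lemma vanishes_X_mult:
  assumes "multiform d F" "multiform e G" "\<not> vanishes F X" "\<not> vanishes G X"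
  shows "\<not> vanishes (\<lambda>v. F v * G v) X"
  using irreducible_vanishes_mult[OF irreducible_X assms(1,2)] assms(3,4) by blast

lemma order_along_eq_0_iff:
  assumes C: "irreducible_curve X C" and F: "multiform d F" "\<not> vanishes F X"
  shows "order_along X C F = 0 \<longleftrightarrow> \<not> vanishes F C"
proof -
  obtain i u1 u2 \<kappa> where ch: "chart p i u1 u2 \<kappa>" and CU: "C \<inter> chart.U p i u1 u2 \<kappa> \<noteq> {}"
    using curve_chart[OF C] by blast
  interpret c: chart p i u1 u2 \<kappa> by (rule ch)
  obtain f where f: "prime_elem f" "\<And>q. q \<in> vanishing_ideal (c.V C) \<longleftrightarrow> f dvd q"
    using c.curve_equation[OF C CU] by blast
  have f0: "f \<noteq> 0" using f(1) by auto
  have U: "c.U \<noteq> {}" using CU by blast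
  obtain m g where g: "c.pull F = f ^ m * g" "\<not> f dvd g"
    using order_factorisation[OF f(1)] c.pull_eq_0_iff[OF F(1) U] F(2) by blast
  have "order_along X C F = m" by (rule c.order_chart[OF C CU f0 f(2) F(1) g])
  moreover have "vanishes F C \<longleftrightarrow> f dvd f ^ m * g"
    using c.vanishes_iff_pull[OF irreducible_curveD(4,1)[OF C] CU F(1)] f(2) g(1) by simp
  moreover have "f dvd f ^ m * g \<longleftrightarrow> m \<noteq> 0" using g(2) by (cases m) auto
  ultimately show ?thesis by simp
qed

lemma order_along_1: "irreducible_curve X C \<Longrightarrow> order_along X C (\<lambda>v. 1) = 0"
proof -
  assume C: "irreducible_curve X C"
  have "X \<noteq> {}" "C \<noteq> {}" using irreducible_X curve_infinite[OF C] by (auto simp: zariski_irreducible_def)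
  then show ?thesis using order_along_eq_0_iff[OF C multiform_const[of 1]] by (simp add: vanishes_def)
qed

lemma order_along_power:
  assumes C: "irreducible_curve X C" and F: "multiform d F" "\<not> vanishes F X"
  shows "order_along X C (\<lambda>v. F v ^ n) = n * order_along X C F \<and> \<not> vanishes (\<lambda>v. F v ^ n) X"
proof (induction n)
  case 0
  have "X \<noteq> {}" using irreducible_X by (auto simp: zariski_irreducible_def)
  then show ?case using order_along_1[OF C] by (simp add: vanishes_def)
next
  case (Suc n)
  have "order_along X C (\<lambda>v. F v * F v ^ n) = order_along X C F + order_along X C (\<lambda>v. F v ^ n)"
    using Suc by (intro order_along_mult[OF C F multiform_power[OF F(1)]]) simp
  moreover have "\<not> vanishes (\<lambda>v. F v * F v ^ n) X"
    using Suc by (intro vanishes_X_mult[OF F(1) multiform_power[OF F(1)] F(2)]) simp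
  ultimately show ?case using Suc by simp
qed

text \<open>The order along \<open>E i\<close> is the multiplicity at \<open>p i\<close>, read off on lines through \<open>p i\<close>.\<close>

lemma s_dvd_iff: "[:[:0, 1:]:] dvd q \<longleftrightarrow> (\<forall>t. ev q 0 t = 0)"
proof
  assume "[:[:0, 1:]:] dvd q"
  then obtain r where "q = [:[:0, 1:]:] * r" by (rule dvdE)
  then show "\<forall>t. ev q 0 t = 0" by simp
next
  assume q: "\<forall>t. ev q 0 t = 0"
  define g where "g = map_poly (\<lambda>c. poly c 0) q"
  have "poly g t = ev q 0 t" for t
    unfolding g_def by (induction q) (auto simp: map_poly_pCons)
  then have "g = 0" using q poly_all_0_iff_0 by metis
  then have "poly (coeff q n) 0 = 0" for n by (metis coeff_0 coeff_map_poly g_def poly_0)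
  then have "[:- 0, 1:] dvd coeff q n" for n by (simp only: poly_eq_0_iff_dvd)
  then show "[:[:0, 1:]:] dvd q" by (simp add: const_poly_dvd_iff)
qed

lemma order_along_E_ge:
  assumes F: "multiform d F" "\<not> vanishes F X"
    and m: "\<And>u. \<exists>r. \<forall>s. F (gpar (w i + s *s u)) = s ^ m * poly r s"
    and dep: "\<And>v v'. v None = v' None \<Longrightarrow> F v = F v'"
  shows "m \<le> order_along X (E i) F"
proof -
  obtain u1 u2 \<kappa> where ch: "chart p i u1 u2 \<kappa>" and CU: "E i \<inter> chart.U p i u1 u2 \<kappa> \<noteq> {}"
    using chart_at_E by blast
  interpret c: chart p i u1 u2 \<kappa> by (rule ch)
  let ?s = "[:[:0, 1 :: complex:]:]"
  have pe: "prime_elem ?s" using prime_elem_linear[of 0] by simp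
  have U: "c.U \<noteq> {}" using CU by blast
  obtain n g where g: "c.pull F = ?s ^ n * g" "\<not> ?s dvd g"
    using order_factorisation[OF pe] c.pull_eq_0_iff[OF F(1) U] F(2) by blast
  have ord: "order_along X (E i) F = n"
    using c.order_chart[OF irreducible_curve_E CU _ c.E_equation[OF CU] F(1) g] by simp
  show ?thesis
  proof (rule ccontr)
    assume "\<not> ?thesis"
    then have nm: "n < m" using ord by simp
    have "ev g 0 t = 0" for t
    proof -
      obtain r where r: "\<And>s. F (gpar (w i + s *s (u1 + t *s u2))) = s ^ m * poly r s" using m by blast
      have e: "s ^ n * ev g s t = s ^ m * poly r s" for s
      proof -
        have "ev (c.pull F) s t = F (c.\<psi> s t)" by (rule c.ev_pull[OF F(1)])
        \<comment> \<open>\<open>\<psi>\<close> and \<open>gpar\<close> differ in the coordinate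
          \<open>Some i\<close> by the factor \<open>s\<close>; by \<open>dep\<close> only the image
          point matters.\<close>
        also have "\<dots> = F (gpar (w i + s *s (u1 + t *s u2)))" by (rule dep) (simp add: c.\<psi>_simps)
        finally show ?thesis unfolding g(1) r by simp
      qed
      have "ev g s t = s ^ (m - n) * poly r s" if "s \<noteq> 0" for s
      proof -
        have "s ^ m = s ^ n * s ^ (m - n)" using nm by (simp add: power_add[symmetric])
        then show ?thesis using e[of s] that by simp
      qed
      \<comment> \<open>The identity holds for all nonzero \<open>s\<close>, hence between
        polynomials, hence also at \<open>s = 0\<close>, where the right-hand side vanishes because
        \<open>n < m\<close>.\<close>
      then have "poly (poly g [:t:] - monom 1 (m - n) * r) s = 0" if "s \<noteq> 0" for s
        using that by (simp add: ev_def poly_monom)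
      then have "- {0} \<subseteq> {s. poly (poly g [:t:] - monom 1 (m - n) * r) s = 0}" by auto
      moreover have "infinite (- {0 :: complex})" using infinite_UNIV_char_0 by (simp add: Compl_eq_Diff_UNIV)
      ultimately have "poly g [:t:] - monom 1 (m - n) * r = 0"
        using poly_roots_finite finite_subset by blast
      then have "poly (poly g [:t:]) 0 = poly (monom 1 (m - n) * r) 0" by simp
      then show ?thesis using nm by (simp add: ev_def poly_monom)
    qed
    then have "?s dvd g" unfolding s_dvd_iff by blast
    then show False using g(2) by simp
  qed
qed

lemma line_nonvanishing: "l \<noteq> 0 \<Longrightarrow> \<not> vanishes (\<lambda>v. dot l (v None)) X"
proof -
  assume l: "l \<noteq> 0"
  obtain b where b: "\<And>i. cross (w i) (b i) \<noteq> 0"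
    using cross_nonzero_exists[OF w_nonzero] by metis
  have "\<exists>v. dot v l \<noteq> 0 \<and> (\<forall>i\<in>UNIV. dot v (cross (w i) (b i)) \<noteq> 0)"
    using b l by (intro dot_avoid_range) simp_all
  then obtain v where v': "dot v l \<noteq> 0" "\<And>i. dot v (cross (w i) (b i)) \<noteq> 0" by auto
  have "cross (w i) v \<noteq> 0" for i
  proof
    assume "cross (w i) v = 0"
    then obtain c where "v = c *s w i" using cross_eq_0_imp_scale[OF _ w_nonzero] by blast
    then have "dot v (cross (w i) (b i)) = 0" by (simp add: dot_algebra)
    then show False using v'(2) by simp
  qed
  note v = v'(1)[unfolded dot_commute[of v]] this
  have "dot l (coords (point_of (gpar v)) None) \<noteq> 0"
    using form_point_of_0_iff[where u = "gpar v", OF multiform_dot[of None l] point_of_gpar(3)[OF v(2)]] v(1) by simp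
  then show ?thesis using point_of_gpar(1)[OF v(2)] by (auto simp: vanishes_def)
qed

text \<open>In the chart a line through \<open>p i\<close> becomes \<open>s\<close> times
  \<open>dot l u1 + t * dot l u2\<close>. The second factor is not divisible by \<open>s\<close>,
  since \<open>l\<close> would otherwise be perpendicular to a whole basis.\<close>

lemma order_line_E:
  assumes l: "l \<noteq> 0" "dot l (w i) = 0"
  shows "order_along X (E i) (\<lambda>v. dot l (v None)) = 1"
proof -
  obtain u1 u2 \<kappa> where ch: "chart p i u1 u2 \<kappa>" and CU: "E i \<inter> chart.U p i u1 u2 \<kappa> \<noteq> {}"
    using chart_at_E by blast
  interpret c: chart p i u1 u2 \<kappa> by (rule ch)
  let ?s = "[:[:0, 1 :: complex:]:]"
  define g where "g = [:[:dot l u1:], [:dot l u2:]:]"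
  have "c.pull (\<lambda>v. dot l (v None)) = ?s ^ 1 * g"
    by (rule ev_ext)
       (simp add: c.ev_pull[OF multiform_dot] c.\<psi>_simps dot_algebra l(2) g_def algebra_simps)
  moreover have "\<not> ?s dvd g"
  proof
    assume "?s dvd g"
    then have e: "ev g 0 t = 0" for t unfolding s_dvd_iff by blast
    have "dot l u1 = 0" using e[of 0] by (simp add: g_def)
    moreover from this have "dot l u2 = 0" using e[of 1] by (simp add: g_def)
    moreover have "dot (w i) (cross u1 u2) *s l
        = dot l (w i) *s cross u1 u2 + dot l u1 *s cross u2 (w i) + dot l u2 *s cross (w i) u1"
      by (rule cramer3_dual)
    ultimately have "dot (w i) (cross u1 u2) *s l = 0" using l(2) by simp
    then show False using l(1) c.det by (simp add: vec3_eq_iff)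
  qed
  ultimately show ?thesis
    using c.order_chart[OF irreducible_curve_E CU _ c.E_equation[OF CU] multiform_dot] by simp
qed

end

section \<open>Finiteness of divisors of forms\<close>

lemma zariski_closed_subsetI:
  assumes "zariski_closed Z" "\<And>d A. multiform d A \<Longrightarrow> vanishes A Z \<Longrightarrow> vanishes A C"
  shows "C \<subseteq> Z"
proof
  fix x assume x: "x \<in> C"
  show "x \<in> Z"
  proof (rule ccontr)
    assume "x \<notin> Z"
    then obtain d F where F: "multiform d F" "F (coords x) \<noteq> 0" "vanishes F Z"
      using zariski_closed_not_mem[OF assms(1)] by blast
    have "vanishes F C" by (rule assms(2)[OF F(1,3)])
    then show False using F(2) x by (simp add: vanishes_def)
  qed
qed

context chart
begin

lemma curve_vanishes_iff:
  assumes "irreducible_curve X C" "C \<inter> U \<noteq> {}" "multiform d F"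
  shows "vanishes F C \<longleftrightarrow> pull F \<in> vanishing_ideal (V C)"
  by (rule vanishes_iff_pull[OF irreducible_curveD(4,1)[OF assms(1)] assms(2,3)])

text \<open>The curves in question correspond injectively to prime factors of \<open>pull F\<close>:
  the equation of a curve decides which forms vanish on it, and these determine the closed
  set.\<close>

lemma finite_curves_U:
  assumes F: "multiform d F" "\<not> vanishes F X"
  shows "finite {C. irreducible_curve X C \<and> vanishes F C \<and> C \<inter> U \<noteq> {}}" (is "finite ?S")
proof (cases "U = {}")
  case True
  then show ?thesis by simp
next
  case False
  have "\<forall>C\<in>?S. \<exists>f. prime_elem f \<and> (\<forall>q. q \<in> vanishing_ideal (V C) \<longleftrightarrow> f dvd q)"
    using curve_equation by simp
  from bchoice[OF this] obtain f where f: "\<forall>C\<in>?S. prime_elem (f C) \<and> (\<forall>q. q \<in> vanishing_ideal (V C) \<longleftrightarrow> f C dvd q)" ..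
  have p0: "pull F \<noteq> 0" using pull_eq_0_iff[OF F(1) False] F(2) by simp
  have "normalize (f C) \<in> prime_factors (pull F)" if C: "C \<in> ?S" for C
  proof -
    have "pull F \<in> vanishing_ideal (V C)"
      using curve_vanishes_iff[OF _ _ F(1), of C] C by simp
    then have "f C dvd pull F" using f C by blast
    moreover have "prime (normalize (f C))" using f C by (simp add: prime_def)
    ultimately show ?thesis using p0 by (simp add: in_prime_factors_iff)
  qed
  moreover have "inj_on (\<lambda>C. normalize (f C)) ?S"
  proof (rule inj_onI)
    have sub: "C \<subseteq> C'" if C: "C \<in> ?S" "C' \<in> ?S" and n: "normalize (f C) = normalize (f C')" for C C'
    proof (rule zariski_closed_subsetI)
      show "zariski_closed C'" using C(2) irreducible_curveD(3)[of X C'] by simp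
      fix d A assume A: "multiform d A" "vanishes A C'"
      have "f C' dvd pull A"
        using curve_vanishes_iff[OF _ _ A(1), of C'] C(2) A(2) f by simp
      moreover have "f C dvd f C'" using n by (rule associatedD1)
      ultimately have "f C dvd pull A" by (rule dvd_trans[rotated])
      then show "vanishes A C"
        using curve_vanishes_iff[OF _ _ A(1), of C] C(1) f by simp
    qed
    fix C C' assume "C \<in> ?S" "C' \<in> ?S" "normalize (f C) = normalize (f C')"
    then show "C = C'" using sub[of C C'] sub[of C' C] by simp
  qed
  ultimately have "inj_on (\<lambda>C. normalize (f C)) ?S" "(\<lambda>C. normalize (f C)) ` ?S \<subseteq> prime_factors (pull F)"
    by auto
  then show ?thesis by (rule inj_on_finite) simp
qed

text \<open>The lines of the plane that are missing from the chart.\<close>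

definition lines :: "(complex^3) set" where
  "lines = insert l0 (insert l1 (\<kappa> ` (UNIV - {i})))"

lemma finite_lines: "finite lines"
  by (simp add: lines_def)

lemma lines_off:
  assumes y: "y \<in> U" "y None \<notin> range p" and m: "m \<in> lines"
  shows "dot m (coords y None) \<noteq> 0"
proof -
  consider "m = l0" | "m = l1" | j where "j \<noteq> i" "m = \<kappa> j" using m unfolding lines_def by blast
  then show ?thesis
  proof cases
    case 2
    obtain c where c: "coords y (Some i) = c *s cross (w i) (coords y None)"
      using line_through[OF U_D(1)[OF y(1)]] y(2) by blast
    have "dot u2 (coords y (Some i)) \<noteq> 0" by (rule U_D(3)[OF y(1)])
    then have "dot u2 (cross (w i) (coords y None)) \<noteq> 0" unfolding c by (simp add: dot_algebra)
    then show ?thesis unfolding 2 by (simp add: dot_def algebra_simps)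
  qed (use U_D[OF y(1)] in auto)
qed

text \<open>By irreducibility such a curve lies in the zero set of one factor of \<open>G0\<close>.
  For the factor in the coordinate \<open>Some i\<close>, off the exceptional curves that coordinate
  joins \<open>p i\<close> to the image point, so the condition says that the image point lies on
  \<open>l1\<close>.\<close>

lemma curve_off_U:
  assumes C: "irreducible_curve X C" "C \<inter> U = {}"
  shows "\<exists>m\<in>lines. \<forall>y\<in>C. y None \<notin> range p \<longrightarrow> dot m (coords y None) = 0"
proof -
  note D = irreducible_curveD[OF C(1)]
  let ?A = "{y. dot l0 (coords y None) = 0}" and ?B = "{y. dot u2 (coords y (Some i)) = 0}"
    and ?K = "\<lambda>j. {y. dot (\<kappa> j) (coords y None) = 0}"
  have sub: "C \<subseteq> (?A \<union> ?B) \<union> (\<Union>j\<in>UNIV - {i}. ?K j)"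
  proof
    fix y assume "y \<in> C"
    then have "G0 (coords y) = 0" using C(2) D(1) by (auto simp: U_def)
    then show "y \<in> (?A \<union> ?B) \<union> (\<Union>j\<in>UNIV - {i}. ?K j)" by (auto simp: G0_def H_def)
  qed
  have AB: "zariski_closed (?A \<union> ?B)" by (intro zariski_closed_Un zariski_closed_dot)
  have K: "zariski_closed (\<Union>j\<in>UNIV - {i}. ?K j)"
    by (rule zariski_closed_UN) (auto intro: zariski_closed_dot)
  have "C \<subseteq> ?A \<union> ?B \<or> C \<subseteq> (\<Union>j\<in>UNIV - {i}. ?K j)"
    by (rule irreducible_UnD[OF D(4) AB K sub])
  then consider "C \<subseteq> ?A" | "C \<subseteq> ?B" | j where "j \<noteq> i" "C \<subseteq> ?K j"
  proof
    assume "C \<subseteq> ?A \<union> ?B"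
    then have "C \<subseteq> ?A \<or> C \<subseteq> ?B" by (rule irreducible_UnD[OF D(4) zariski_closed_dot zariski_closed_dot])
    then show ?thesis using \<open>C \<subseteq> ?A \<Longrightarrow> thesis\<close> \<open>C \<subseteq> ?B \<Longrightarrow> thesis\<close> by argo
  next
    assume "C \<subseteq> (\<Union>j\<in>UNIV - {i}. ?K j)"
    then have "\<exists>j\<in>UNIV - {i}. C \<subseteq> ?K j"
      by (intro irreducible_subset_UN[OF D(4)]) (auto intro: zariski_closed_dot)
    then obtain j where "j \<noteq> i" "C \<subseteq> ?K j" by auto
    then show ?thesis by (rule that(3))
  qed
  then show ?thesis
  proof cases
    case 1
    then show ?thesis by (intro bexI[of _ l0]) (auto simp: lines_def)
  next
    case 2
    have "dot l1 (coords y None) = 0" if y: "y \<in> C" "y None \<notin> range p" for y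
    proof -
      have "y \<in> X" using y D(1) by blast
      then obtain c where c: "coords y (Some i) = c *s cross (w i) (coords y None)"
        using line_through y(2) by blast
      then have "c \<noteq> 0" using coords_nonzero[of y "Some i"] by auto
      moreover have "dot u2 (coords y (Some i)) = 0" using 2 y by blast
      ultimately have "dot u2 (cross (w i) (coords y None)) = 0" unfolding c by (simp add: dot_algebra)
      then show ?thesis by (simp add: dot_def algebra_simps)
    qed
    then show ?thesis by (intro bexI[of _ l1]) (auto simp: lines_def)
  next
    case 3
    then show ?thesis by (intro bexI[of _ "\<kappa> j"]) (auto simp: lines_def)
  qed
qed

end

context blown_up_plane
begin

text \<open>The intersection of \<open>m\<close> with a second line \<open>b\<close> that passes
  through none of the \<open>p i\<close>.\<close>

lemma point_on_line:
  assumes "m \<noteq> 0"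
  shows "\<exists>y\<in>X. y None \<notin> range p \<and> dot m (coords y None) = 0"
proof -
  obtain e where e: "cross m e \<noteq> 0" using cross_nonzero_exists[OF assms] by blast
  have "\<exists>b. dot b (cross m e) \<noteq> 0 \<and> (\<forall>i\<in>UNIV. dot b (w i) \<noteq> 0)"
    using e by (intro dot_avoid_range) simp_all
  then obtain b where b: "dot b (cross m e) \<noteq> 0" "\<And>i. dot b (w i) \<noteq> 0" by auto
  define v where "v = cross m b"
  have v0: "v \<noteq> 0"
  proof
    assume "v = 0"
    then have "\<exists>c. b = c *s m" unfolding v_def by (rule cross_eq_0_imp_scale[OF _ assms])
    then obtain c where "b = c *s m" ..
    then have "dot b (cross m e) = 0" by (simp add: dot_algebra)
    then show False using b by simp
  qed
  have cv: "cross (w i) v \<noteq> 0" for i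
  proof
    assume "cross (w i) v = 0"
    then have "\<exists>c. v = c *s w i" by (rule cross_eq_0_imp_scale) simp
    then obtain c where c: "v = c *s w i" ..
    have "dot b v = 0" by (simp add: v_def)
    then have "c * dot b (w i) = 0" unfolding c by (simp add: dot_algebra)
    then have "c = 0" using b by simp
    then show False using c v0 by simp
  qed
  have "dot m v = 0" by (simp add: v_def)
  then have "dot m (coords (point_of (gpar v)) None) = 0"
    using form_point_of_0_iff[where u = "gpar v", OF multiform_dot[of None m] point_of_gpar(3)[OF cv]] by simp
  then show ?thesis using point_of_gpar(1,2)[OF cv] by blast
qed

text \<open>Two charts suffice. The second is chosen to contain a point of every line missing from
  the first, so a missing line of one is never a missing line of the other. A curve outside both
  charts maps, off the exceptional curves, to the intersection point of two distinct lines, and is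
  therefore exceptional.\<close>

lemma finite_curves_vanishing:
  assumes F: "multiform d F" "\<not> vanishes F X"
  shows "finite {C. irreducible_curve X C \<and> vanishes F C}"
proof -
  fix i :: 'i
  obtain x where x: "x \<in> X" "x None \<notin> range p" using generic_point_X[of "{}"] by blast
  obtain u1 u2 \<kappa> where ch: "chart p i u1 u2 \<kappa>" and xU: "x \<in> chart.U p i u1 u2 \<kappa>"
    using chart_at[OF x(1)] x(2) by blast
  interpret c: chart p i u1 u2 \<kappa> by (rule ch)
  have "\<forall>m\<in>c.lines. \<exists>y. y \<in> X \<and> y None \<notin> range p \<and> dot m (coords y None) = 0"
  proof
    fix m assume "m \<in> c.lines"
    then have "dot m (coords x None) \<noteq> 0" by (rule c.lines_off[OF xU x(2)])
    then have "m \<noteq> 0" by auto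
    from point_on_line[OF this] show "\<exists>y. y \<in> X \<and> y None \<notin> range p \<and> dot m (coords y None) = 0" by blast
  qed
  from bchoice[OF this] obtain y where
    y: "\<forall>m\<in>c.lines. y m \<in> X \<and> y m None \<notin> range p \<and> dot m (coords (y m) None) = 0" ..
  define T where "T = y ` c.lines"
  have T: "finite T" "T \<subseteq> X" "\<And>z. z \<in> T \<Longrightarrow> z None \<notin> range p"
    using y c.finite_lines by (auto simp: T_def)
  have "\<exists>l. dot l (w i) \<noteq> 0 \<and> (\<forall>z\<in>T. dot l (coords z None) \<noteq> 0)"
    using T(1) by (intro dot_avoid_range) simp_all
  then obtain l where l: "dot l (w i) \<noteq> 0" "\<And>z. z \<in> T \<Longrightarrow> dot l (coords z None) \<noteq> 0" by auto
  have "\<exists>u1 u2 \<kappa>. chart p i u1 u2 \<kappa> \<and> T \<subseteq> chart.U p i u1 u2 \<kappa> \<and> dot l u1 = 0 \<and> dot l u2 = 0"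
  proof (rule chart_exists[OF l(1) T(1,2) l(2)])
    show "z None \<noteq> p j" if "z \<in> T" for z j using T(3)[OF that] by (metis rangeI)
  qed
  then obtain v1 v2 \<mu> where ch': "chart p i v1 v2 \<mu>" and TU: "T \<subseteq> chart.U p i v1 v2 \<mu>" by blast
  interpret c': chart p i v1 v2 \<mu> by (rule ch')
  have "C \<in> range E \<or> C \<inter> c.U \<noteq> {} \<or> C \<inter> c'.U \<noteq> {}" if C: "irreducible_curve X C" for C
  proof (rule ccontr)
    assume n: "\<not> ?thesis"
    note D = irreducible_curveD[OF C]
    obtain m where m: "m \<in> c.lines" "\<And>z. z \<in> C \<Longrightarrow> z None \<notin> range p \<Longrightarrow> dot m (coords z None) = 0"
      using c.curve_off_U[OF C] n by blast
    obtain m' where m': "m' \<in> c'.lines" "\<And>z. z \<in> C \<Longrightarrow> z None \<notin> range p \<Longrightarrow> dot m' (coords z None) = 0"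
      using c'.curve_off_U[OF C] n by blast
    have ym: "y m \<in> T" using m(1) by (simp add: T_def)
    have d': "dot m' (coords (y m) None) \<noteq> 0"
      by (rule c'.lines_off[OF subsetD[OF TU ym] T(3)[OF ym] m'(1)])
    have d: "dot m (coords (y m) None) = 0" using y m(1) by blast
    have m0: "m \<noteq> 0" using c.lines_off[OF xU x(2) m(1)] by auto
    have mm: "cross m m' \<noteq> 0"
    proof
      assume "cross m m' = 0"
      then have "\<exists>c. m' = c *s m" by (rule cross_eq_0_imp_scale[OF _ m0])
      then obtain c where "m' = c *s m" ..
      then have "dot m' (coords (y m) None) = c * dot m (coords (y m) None)" by (simp only: dot_algebra)
      then show False using d d' by simp
    qed
    have "C \<subseteq> {point_of (gpar (cross m m'))} \<union> (\<Union>j\<in>UNIV. E j)"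
    proof
      fix z assume z: "z \<in> C"
      show "z \<in> {point_of (gpar (cross m m'))} \<union> (\<Union>j\<in>UNIV. E j)"
      proof (cases "z None \<in> range p")
        case True
        then show ?thesis using z D(1) by (auto simp: mem_E)
      next
        case False
        have "dot (coords z None) m = 0" "dot (coords z None) m' = 0"
          using m(2)[OF z False] m'(2)[OF z False] by (simp_all add: dot_commute)
        then have "\<exists>c. coords z None = c *s cross m m'" using mm by (rule perp_scale)
        then obtain c where c: "coords z None = c *s cross m m'" ..
        have "\<exists>c. coords z k = c *s gpar (cross m m') k" for k
        proof -
          obtain b where "coords z k = b *s gpar (coords z None) k" using coords_gpar[of z] z False D(1) by blast
          moreover have "gpar (coords z None) k = c *s gpar (cross m m') k"
            unfolding c by (cases k) (simp_all add: cross_linear)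
          ultimately have "coords z k = (b * c) *s gpar (cross m m') k" by (simp add: vector_smult_assoc)
          then show ?thesis by (rule exI)
        qed
        then have "z = point_of (gpar (cross m m'))" by (rule eq_point_of)
        then show ?thesis by simp
      qed
    qed
    moreover have "zariski_closed (\<Union>j\<in>UNIV. E j)" by (rule zariski_closed_UN) (simp_all add: zariski_closed_E)
    ultimately have "C \<subseteq> {point_of (gpar (cross m m'))} \<or> C \<subseteq> (\<Union>j\<in>UNIV. E j)"
      using irreducible_UnD[OF D(4) zariski_closed_point] by simp
    then show False
    proof
      assume "C \<subseteq> {point_of (gpar (cross m m'))}"
      then have "finite C" by (rule finite_subset) simp
      then show False using curve_infinite[OF C] by simp
    next
      assume "C \<subseteq> (\<Union>j\<in>UNIV. E j)"
      then have "\<exists>j\<in>UNIV. C \<subseteq> E j"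
        by (intro irreducible_subset_UN[OF D(4)]) (simp_all add: zariski_closed_E)
      then obtain j where "C \<subseteq> E j" by blast
      then have "C = E j" by (rule curve_subset_E[OF C])
      then show False using n by blast
    qed
  qed
  then have "{C. irreducible_curve X C \<and> vanishes F C} \<subseteq> range E
      \<union> {C. irreducible_curve X C \<and> vanishes F C \<and> C \<inter> c.U \<noteq> {}}
      \<union> {C. irreducible_curve X C \<and> vanishes F C \<and> C \<inter> c'.U \<noteq> {}}" by blast
  moreover have "finite (range E \<union> {C. irreducible_curve X C \<and> vanishes F C \<and> C \<inter> c.U \<noteq> {}}
      \<union> {C. irreducible_curve X C \<and> vanishes F C \<and> C \<inter> c'.U \<noteq> {}})"
    using c.finite_curves_U[OF F] c'.finite_curves_U[OF F] by simp
  ultimately show ?thesis by (rule finite_subset)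
qed

section \<open>Effective representatives\<close>

lemma form_divisor_support:
  assumes F: "multiform d F" "\<not> vanishes F X"
  shows "finite {C. form_divisor X F C \<noteq> 0}"
proof (rule finite_subset[OF _ finite_curves_vanishing[OF F]])
  show "{C. form_divisor X F C \<noteq> 0} \<subseteq> {C. irreducible_curve X C \<and> vanishes F C}"
    using order_along_eq_0_iff[OF _ F] by (auto simp: form_divisor_def split: if_splits)
qed

lemma form_divisor_nonneg: "form_divisor X F C \<ge> 0"
  by (simp add: form_divisor_def)

lemma form_divisor_not_curve: "\<not> irreducible_curve X C \<Longrightarrow> form_divisor X F C = 0"
  by (simp add: form_divisor_def)

lemma linearly_equivalent_step:
  assumes "linearly_equivalent X D D'" "principal_divisor X P"
  shows "linearly_equivalent X D (\<lambda>C. D' C + a * P C)"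
proof -
  obtain n :: nat and b Q where Q: "\<forall>k<n. principal_divisor X (Q k)" "D' = (\<lambda>C. D C + (\<Sum>k<n. b k * Q k C))"
    using assms(1) unfolding linearly_equivalent_def by (elim exE conjE) blast
  have "(\<Sum>k<Suc n. (if k = n then a else b k) * (if k = n then P else Q k) C)
      = (\<Sum>k<n. b k * Q k C) + a * P C" for C
    by simp
  then have "(\<lambda>C. D' C + a * P C)
      = (\<lambda>C. D C + (\<Sum>k<Suc n. (if k = n then a else b k) * (if k = n then P else Q k) C))"
    unfolding Q(2) by (intro ext) (simp only: add.assoc)
  moreover have "\<forall>k<Suc n. principal_divisor X (if k = n then P else Q k)"
    using Q(1) assms(2) by (auto simp: less_Suc_eq)
  ultimately show ?thesis
    unfolding linearly_equivalent_def
    by (intro exI[of _ "Suc n"] exI[of _ "\<lambda>k. if k = n then a else b k"] exI[of _ "\<lambda>k. if k = n then P else Q k"]) simp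
qed

lemma linearly_equivalent_refl: "linearly_equivalent X D D"
  unfolding linearly_equivalent_def by (intro exI[of _ 0]) simp

lemma linearly_equivalent_sum:
  assumes "finite S" "\<And>s. s \<in> S \<Longrightarrow> principal_divisor X (P s)"
  shows "linearly_equivalent X D (\<lambda>C. D C + (\<Sum>s\<in>S. a * P s C))"
  using assms
proof (induction S)
  case empty
  then show ?case by (simp add: linearly_equivalent_refl)
next
  case (insert s S)
  then have "linearly_equivalent X D (\<lambda>C. D C + (\<Sum>s\<in>S. a * P s C) + a * P s C)"
    by (intro linearly_equivalent_step) auto
  moreover have "(\<lambda>C. D C + (\<Sum>s\<in>insert s S. a * P s C)) = (\<lambda>C. D C + (\<Sum>s\<in>S. a * P s C) + a * P s C)"
    using insert.hyps by (intro ext) simp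
  ultimately show ?case by simp
qed

lemma principalI:
  assumes "multiform d F" "multiform d G" "\<not> vanishes F X" "\<not> vanishes G X"
  shows "principal_divisor X (\<lambda>C. form_divisor X F C - form_divisor X G C)"
  unfolding principal_divisor_def using assms by (auto simp: vanishes_def)

definition exceptional_sum :: "('i option \<Rightarrow> cp2) set \<Rightarrow> real" where
  "exceptional_sum C = (\<Sum>i\<in>UNIV. prime_divisor (E i) C)"

lemma E_inj: "E i = E j \<Longrightarrow> i = j"
proof -
  assume e: "E i = E j"
  obtain x where "x \<in> E i" using E_nonempty by blast
  then have "x \<in> E i" "x \<in> E j" using e by auto
  then have "p i = p j" by (simp add: mem_E)
  then show ?thesis by (rule injD[OF inj])
qed

lemma exceptional_sum_E: "exceptional_sum (E j) = 1"
proof -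
  have "exceptional_sum (E j) = (\<Sum>i\<in>UNIV. if i = j then 1 else 0)"
    unfolding exceptional_sum_def prime_divisor_def by (rule sum.cong) (auto dest: E_inj)
  then show ?thesis by simp
qed

lemma exceptional_sum_0: "C \<notin> range E \<Longrightarrow> exceptional_sum C = 0"
  unfolding exceptional_sum_def prime_divisor_def by (rule sum.neutral) auto

lemma divisorI:
  assumes "finite S" "{C. D C \<noteq> 0} \<subseteq> S" "\<And>C. \<not> irreducible_curve X C \<Longrightarrow> D C = 0"
  shows "divisor X D"
  unfolding divisor_def using assms finite_subset by blast

lemma exceptional_sum_not_curve: "\<not> irreducible_curve X C \<Longrightarrow> exceptional_sum C = 0"
  using irreducible_curve_E by (intro exceptional_sum_0) auto

text \<open>The inequality is the integral form of the condition that the average order along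
  \<open>E j\<close> over \<open>S\<close>, divided by \<open>n\<close>, is at least 4/13.\<close>

lemma nef_criterion:
  fixes B :: "'b \<Rightarrow> ('i option \<Rightarrow> complex^3) \<Rightarrow> complex"
  assumes n: "n > 0" and l: "l \<noteq> 0"
    and B: "\<And>s. s \<in> I \<Longrightarrow> multiform (\<lambda>k. n * unit_deg None k) (B s)"
    and crit: "\<And>C. irreducible_curve X C \<Longrightarrow> C \<notin> range E \<Longrightarrow> \<exists>S. S \<subseteq> I \<and> finite S \<and> S \<noteq> {} \<and>
      (\<forall>s\<in>S. \<not> vanishes (B s) C) \<and>
      (\<forall>j. 4 * n * card S \<le> 13 * (\<Sum>s\<in>S. order_along X (E j) (B s)))"
  shows "nef X (\<lambda>C. form_divisor X (\<lambda>v. dot l (v None)) C - 4 / 13 * exceptional_sum C)" (is "nef X ?D")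
  unfolding nef_def
proof (intro conjI allI impI)
  let ?L = "\<lambda>v :: 'i option \<Rightarrow> complex^3. dot l (v None)"
  have L: "multiform (unit_deg None) ?L" "\<not> vanishes ?L X" using multiform_dot line_nonvanishing[OF l] by auto
  show "divisor X ?D"
  proof (rule divisorI)
    show "finite ({C. form_divisor X ?L C \<noteq> 0} \<union> range E)" using form_divisor_support[OF L] by simp
    show "{C. ?D C \<noteq> 0} \<subseteq> {C. form_divisor X ?L C \<noteq> 0} \<union> range E" using exceptional_sum_0 by auto
    show "?D C = 0" if "\<not> irreducible_curve X C" for C
      using form_divisor_not_curve[OF that] exceptional_sum_not_curve[OF that] by simp
  qed
  fix C assume C: "irreducible_curve X C"
  show "\<exists>r. has_intersection_number X ?D C r \<and> r \<ge> 0"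
  proof (cases "C \<in> range E")
    case False
    obtain S where S: "S \<subseteq> I" "finite S" "S \<noteq> {}" "\<And>s. s \<in> S \<Longrightarrow> \<not> vanishes (B s) C"
        "\<And>j. 4 * n * card S \<le> 13 * (\<Sum>s\<in>S. order_along X (E j) (B s))"
      using crit[OF C False] by blast
    define N where "N = card S"
    have N: "N > 0" using S(2,3) by (simp add: N_def card_gt_0_iff)
    have Bs: "multiform (\<lambda>k. n * unit_deg None k) (B s)" "\<not> vanishes (B s) X" if "s \<in> S" for s
      using B S(1) S(4)[OF that] that irreducible_curveD(1)[OF C] by (auto simp: vanishes_def subset_iff)
    \<comment> \<open>Each \<open>B s\<close> is equivalent to \<open>n\<close> lines, so with this
      weight the \<open>N\<close> members of \<open>S\<close> together replace exactly one
      line.\<close>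
    define a where "a = 1 / (real n * real N)"
    define D' where "D' C' = (\<Sum>s\<in>S. a * form_divisor X (B s) C') - 4 / 13 * exceptional_sum C'" for C'
    have fdL: "form_divisor X (\<lambda>v. ?L v ^ n) C' = real n * form_divisor X ?L C'" for C'
      using order_along_power[OF _ L, of C' n] by (simp add: form_divisor_def)
    have Ln: "\<not> vanishes (\<lambda>v. ?L v ^ n) X" using order_along_power[OF C L] by blast
    have "linearly_equivalent X ?D (\<lambda>C'. ?D C' +
        (\<Sum>s\<in>S. a * (form_divisor X (B s) C' - form_divisor X (\<lambda>v. ?L v ^ n) C')))"
      using Bs Ln by (intro linearly_equivalent_sum S(2) principalI[OF _ multiform_power[OF L(1)]]) auto
    moreover have "?D C' + (\<Sum>s\<in>S. a * (form_divisor X (B s) C' - form_divisor X (\<lambda>v. ?L v ^ n) C')) = D' C'" for C'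
    proof -
      have "(\<Sum>s\<in>S. a * (form_divisor X (B s) C' - form_divisor X (\<lambda>v. ?L v ^ n) C'))
          = (\<Sum>s\<in>S. a * form_divisor X (B s) C') - real N * (a * (real n * form_divisor X ?L C'))"
        unfolding fdL by (simp add: right_diff_distrib sum_subtractf N_def)
      also have "real N * (a * (real n * form_divisor X ?L C')) = form_divisor X ?L C'"
        using n N by (simp add: a_def)
      finally show ?thesis by (simp add: D'_def)
    qed
    ultimately have le: "linearly_equivalent X ?D D'" by (simp only:)
    have pos: "D' C' \<ge> 0" for C'
    proof (cases "C' \<in> range E")
      case True
      then obtain j where j: "C' = E j" by blast
      have "real (4 * n * N) \<le> real (13 * (\<Sum>s\<in>S. order_along X (E j) (B s)))"
        using S(5)[of j] unfolding N_def by (rule of_nat_mono)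
      then have "4 / 13 \<le> a * (\<Sum>s\<in>S. real (order_along X (E j) (B s)))"
        using n N by (simp add: a_def field_simps)
      then show ?thesis
        unfolding D'_def j exceptional_sum_E by (simp add: form_divisor_def irreducible_curve_E sum_distrib_left)
    next
      case False
      then show ?thesis
        unfolding D'_def by (simp add: exceptional_sum_0 sum_nonneg form_divisor_nonneg a_def)
    qed
    have "divisor X D'"
    proof (rule divisorI)
      show "finite ((\<Union>s\<in>S. {C. form_divisor X (B s) C \<noteq> 0}) \<union> range E)"
        using S(2) form_divisor_support[OF Bs] by simp
      show "{C. D' C \<noteq> 0} \<subseteq> (\<Union>s\<in>S. {C. form_divisor X (B s) C \<noteq> 0}) \<union> range E"
      proof
        fix C' assume c: "C' \<in> {C. D' C \<noteq> 0}"
        show "C' \<in> (\<Union>s\<in>S. {C. form_divisor X (B s) C \<noteq> 0}) \<union> range E"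
        proof (rule ccontr)
          assume "C' \<notin> (\<Union>s\<in>S. {C. form_divisor X (B s) C \<noteq> 0}) \<union> range E"
          then have "D' C' = 0" by (simp add: D'_def exceptional_sum_0)
          then show False using c by simp
        qed
      qed
      show "D' C' = 0" if "\<not> irreducible_curve X C'" for C'
        using that by (simp add: D'_def form_divisor_not_curve exceptional_sum_not_curve)
    qed
    moreover have "D' C = 0"
    proof -
      have "form_divisor X (B s) C = 0" if "s \<in> S" for s
        using order_along_eq_0_iff[OF C Bs[OF that]] S(4)[OF that] by (simp add: form_divisor_def)
      then show ?thesis using exceptional_sum_0[OF False] by (simp add: D'_def)
    qed
    ultimately have "has_intersection_number X ?D C (\<Sum>C' | D' C' \<noteq> 0. D' C' * real (curve_intersection X C' C))"
      unfolding has_intersection_number_def using le by blast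
    moreover have "(\<Sum>C' | D' C' \<noteq> 0. D' C' * real (curve_intersection X C' C)) \<ge> 0"
      by (intro sum_nonneg mult_nonneg_nonneg pos) simp
    ultimately show ?thesis by blast
  next
    case True
    then obtain i where i: "C = E i" by blast
    have "\<exists>k. dot k l \<noteq> 0 \<and> (\<forall>j\<in>UNIV. dot k (w j) \<noteq> 0)"
      using l by (intro dot_avoid_range) simp_all
    then obtain k where k: "dot k l \<noteq> 0" "\<And>j. dot k (w j) \<noteq> 0" by auto
    then have k0: "k \<noteq> 0" by auto
    obtain b where b: "cross (w i) b \<noteq> 0" using cross_nonzero_exists[OF w_nonzero] by blast
    define m where "m = cross (w i) b"
    have m: "m \<noteq> 0" "dot m (w i) = 0" using b by (auto simp: m_def)
    let ?K = "\<lambda>v :: 'i option \<Rightarrow> complex^3. dot k (v None)" and ?M = "\<lambda>v :: 'i option \<Rightarrow> complex^3. dot m (v None)"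
    have K: "multiform (unit_deg None) ?K" "\<not> vanishes ?K X" using multiform_dot line_nonvanishing[OF k0] by auto
    have M: "multiform (unit_deg None) ?M" "\<not> vanishes ?M X" using multiform_dot line_nonvanishing[OF m(1)] by auto
    \<comment> \<open>One line is split as 9/13 + 4/13: the line \<open>?K\<close> misses
      \<open>p i\<close>, and \<open>?M\<close> passes through \<open>p i\<close> with order one
      along \<open>E i\<close>, so the coefficient of \<open>E i\<close> cancels.\<close>
    define D' where "D' C' = 9 / 13 * form_divisor X ?K C' + 4 / 13 * form_divisor X ?M C' - 4 / 13 * exceptional_sum C'" for C'
    have "linearly_equivalent X ?D (\<lambda>C'. (?D C' + 1 * (form_divisor X ?K C' - form_divisor X ?L C'))
        + 4 / 13 * (form_divisor X ?M C' - form_divisor X ?K C'))"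
      by (intro linearly_equivalent_step linearly_equivalent_refl principalI[OF K(1) L(1) K(2) L(2)]
          principalI[OF M(1) K(1) M(2) K(2)])
    moreover have "(?D C' + 1 * (form_divisor X ?K C' - form_divisor X ?L C'))
        + 4 / 13 * (form_divisor X ?M C' - form_divisor X ?K C') = D' C'" for C'
      by (simp add: D'_def algebra_simps)
    ultimately have le: "linearly_equivalent X ?D D'" by (simp only:)
    have "\<not> vanishes ?K (E i)"
    proof
      assume v: "vanishes ?K (E i)"
      obtain x where x: "x \<in> E i" using E_nonempty by blast
      then have "coords x None = w i" by (simp add: mem_E coords_def w_def)
      then show False using v x k(2)[of i] by (auto simp: vanishes_def)
    qed
    then have "form_divisor X ?K (E i) = 0"
      using order_along_eq_0_iff[OF irreducible_curve_E K] by (simp add: form_divisor_def)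
    moreover have "form_divisor X ?M (E i) = 1"
      using order_line_E[OF m] irreducible_curve_E by (simp add: form_divisor_def)
    ultimately have Di: "D' (E i) = 0" by (simp add: D'_def exceptional_sum_E)
    have "divisor X D'"
    proof (rule divisorI)
      show "finite ({C. form_divisor X ?K C \<noteq> 0} \<union> {C. form_divisor X ?M C \<noteq> 0} \<union> range E)"
        using form_divisor_support[OF K] form_divisor_support[OF M] by simp
      show "{C. D' C \<noteq> 0} \<subseteq> {C. form_divisor X ?K C \<noteq> 0} \<union> {C. form_divisor X ?M C \<noteq> 0} \<union> range E"
        using exceptional_sum_0 by (auto simp: D'_def)
      show "D' C' = 0" if "\<not> irreducible_curve X C'" for C'
        using that by (simp add: D'_def form_divisor_not_curve exceptional_sum_not_curve)
    qed
    then have "has_intersection_number X ?D C (\<Sum>C' | D' C' \<noteq> 0. D' C' * real (curve_intersection X C' C))"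
      unfolding has_intersection_number_def using le Di i by blast
    moreover have "D' C' * real (curve_intersection X C' C) \<ge> 0" for C'
    proof (cases "C' \<in> range E")
      case True
      then obtain j where j: "C' = E j" by blast
      show ?thesis
      proof (cases "j = i")
        case True
        then show ?thesis using Di j by simp
      next
        case False
        then have "C' \<inter> C = {}" using inj unfolding i j by (auto simp: mem_E dest: injD)
        then show ?thesis by (simp add: curve_intersection_def)
      qed
    next
      case False
      then show ?thesis by (simp add: D'_def exceptional_sum_0 form_divisor_nonneg)
    qed
    then have "(\<Sum>C' | D' C' \<noteq> 0. D' C' * real (curve_intersection X C' C)) \<ge> 0"
      by (intro sum_nonneg)
    ultimately show ?thesis by blast
  qed
qed

end

section \<open>Curves meet the line at infinity\<close>

lemma norm_dot_le: "\<exists>K\<ge>0. \<forall>v. norm (dot a v) \<le> K * norm v"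
proof (intro exI conjI allI)
  let ?K = "norm (a$1) + norm (a$2) + norm (a$3)"
  show "0 \<le> ?K" by simp
  fix v
  have "norm (dot a v) \<le> norm (a$1 * v$1) + norm (a$2 * v$2) + norm (a$3 * v$3)"
    unfolding dot_def by (intro norm_triangle_le add_mono order_refl norm_triangle_ineq)
  also have "\<dots> \<le> norm (a$1) * norm v + norm (a$2) * norm v + norm (a$3) * norm v"
    unfolding norm_mult by (intro add_mono mult_left_mono Finite_Cartesian_Product.norm_nth_le) simp_all
  finally show "norm (dot a v) \<le> ?K * norm v" by (simp add: distrib_right)
qed

lemma scaleR_smult: "r *\<^sub>R (v :: complex^3) = of_real r *s v"
  by (simp add: vec3_eq_iff, simp add: scaleR_conv_of_real)

text \<open>If \<open>f\<close> involves only \<open>s\<close>, fix \<open>s = a\<close> and let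
  \<open>t\<close> grow. Otherwise \<open>f\<close> keeps its positive degree in \<open>t\<close>
  for all but finitely many \<open>s\<close>, so it has a zero over some large integer. The zero
  with \<open>a \<noteq> 0\<close> excludes powers of \<open>s\<close>, on whose zeros both
  \<open>s\<close> and \<open>s * t\<close> are 0.\<close>

lemma bivariate_zeros_unbounded:
  assumes f: "f \<noteq> 0" and ab: "ev f a b = 0" "a \<noteq> 0"
  shows "\<exists>s t. ev f s t = 0 \<and> (R < norm s \<or> R < norm (s * t))"
proof (cases "degree f = 0")
  case True
  then obtain c where c: "f = [:c:]" by (metis degree_eq_zeroE)
  define t where "t = complex_of_real ((\<bar>R\<bar> + 1) / norm a)"
  have "norm t = (\<bar>R\<bar> + 1) / norm a" unfolding t_def norm_of_real by simp
  then have "norm (a * t) = \<bar>R\<bar> + 1" using ab(2) by (simp add: norm_mult)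
  then have "R < norm (a * t)" by simp
  moreover have "ev f a t = 0" using ab(1) c by simp
  ultimately show ?thesis by blast
next
  case False
  define c where "c = lead_coeff f"
  have c: "c \<noteq> 0" using f by (simp add: c_def)
  have "infinite (range (of_nat :: nat \<Rightarrow> complex))" by (simp add: finite_image_iff inj_on_def)
  moreover have "finite {z. poly c z = 0}" using c by (rule poly_roots_finite)
  moreover have "finite ((of_nat :: nat \<Rightarrow> complex) ` {n. real n \<le> R})"
    by (rule finite_imageI, rule finite_subset[of _ "{..nat \<lceil>R\<rceil>}"]) (auto, linarith)
  ultimately have "infinite (range (of_nat :: nat \<Rightarrow> complex) - ({z. poly c z = 0} \<union> of_nat ` {n. real n \<le> R}))"
    by (simp add: Diff_infinite_finite)
  then have "range (of_nat :: nat \<Rightarrow> complex) - ({z. poly c z = 0} \<union> of_nat ` {n. real n \<le> R}) \<noteq> {}"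
    by (metis finite.emptyI)
  then obtain n where n: "poly c (of_nat n) \<noteq> 0" "\<not> real n \<le> R" by auto
  define g where "g = map_poly (\<lambda>c. poly c (of_nat n)) f"
  have g: "poly g t = ev f (of_nat n) t" for t
    unfolding g_def by (induction f) (auto simp: map_poly_pCons)
  have "coeff g (degree f) \<noteq> 0" using n(1) by (simp add: g_def c_def coeff_map_poly)
  then have "degree g \<noteq> 0" using False le_degree by fastforce
  then have "\<not> constant (poly g)" by (simp add: constant_degree)
  then obtain t where "poly g t = 0" using fundamental_theorem_of_algebra by blast
  then show ?thesis using n(2) by (intro exI[of _ "of_nat n"] exI[of _ t]) (auto simp: g[symmetric])
qed

context chart
begin

text \<open>\<open>s\<close> and \<open>s * t\<close> are the affine coordinates of the image point
  along \<open>u1\<close> and \<open>u2\<close>, and linear forms bound them by a multiple of its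
  norm.\<close>

lemma \<psi>_unbounded:
  assumes f: "f \<noteq> 0" and ab: "ev f a b = 0" "a \<noteq> 0"
  shows "\<exists>s t. ev f s t = 0 \<and> R < norm (\<psi> s t None)"
proof -
  define D where "D = dot (w i) (cross u1 u2)"
  have D: "norm D > 0" using det by (simp add: D_def)
  obtain K1 where K1: "\<And>v. norm (dot l1 v) \<le> K1 * norm v" "K1 \<ge> 0" using norm_dot_le by blast
  obtain K2 where K2: "\<And>v. norm (dot l2 v) \<le> K2 * norm v" "K2 \<ge> 0" using norm_dot_le by blast
  define K where "K = K1 + K2 + 1"
  have K: "K > 0" using K1(2) K2(2) by (simp add: K_def)
  obtain s t where st: "ev f s t = 0" "K * \<bar>R\<bar> / norm D < norm s \<or> K * \<bar>R\<bar> / norm D < norm (s * t)"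
    using bivariate_zeros_unbounded[OF f ab] by blast
  have e1: "dot l1 (\<psi> s t None) = s * D" unfolding \<psi>_simps dot_algebra dot_l D_def by simp
  have e2: "dot l2 (\<psi> s t None) = s * t * D"
    unfolding \<psi>_simps D_def by (simp add: dot_def algebra_simps)
  have "K1 * norm (\<psi> s t None) \<le> K * norm (\<psi> s t None)" "K2 * norm (\<psi> s t None) \<le> K * norm (\<psi> s t None)"
    using K1(2) K2(2) by (intro mult_right_mono; simp add: K_def)+
  then have "norm s * norm D \<le> K * norm (\<psi> s t None)" "norm (s * t) * norm D \<le> K * norm (\<psi> s t None)"
    using K1(1)[of "\<psi> s t None"] K2(1)[of "\<psi> s t None"] unfolding e1 e2 norm_mult by linarith+
  moreover have "K * \<bar>R\<bar> < norm s * norm D \<or> K * \<bar>R\<bar> < norm (s * t) * norm D"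
    using st(2) D by (simp add: divide_less_eq)
  ultimately have "K * \<bar>R\<bar> < K * norm (\<psi> s t None)" by linarith
  then have "R < norm (\<psi> s t None)" using K by simp
  then show ?thesis using st(1) by blast
qed

end

context blown_up_plane
begin

lemma form_scale_None:
  assumes "multiform (\<lambda>k. n * unit_deg None k) (\<lambda>v :: 'i option \<Rightarrow> complex^3. g (v None))"
  shows "g (c *s v) = c ^ n * g v"
proof -
  have "(\<Prod>k\<in>(UNIV :: 'i option set). c ^ (n * unit_deg None k)) = (\<Prod>k\<in>(UNIV :: 'i option set). if k = None then c ^ n else 1)"
    by (rule prod.cong) (auto simp: unit_deg_def)
  also have "\<dots> = c ^ n" by simp
  finally show ?thesis using multiform_scale[OF assms, of "\<lambda>_. c" "\<lambda>_. v"] by simp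
qed

text \<open>
  A common component of two plane curves without common points on a line would be an affine
  plane curve, hence unbounded, and have a point at infinity.
\<close>

lemma no_common_component:
  assumes C: "irreducible_curve X C" "C \<notin> range E" and l: "\<And>i. dot l (w i) \<noteq> 0"
    and F: "multiform (\<lambda>k. n * unit_deg None k) (\<lambda>v :: 'i option \<Rightarrow> complex^3. g (v None))"
    and G: "multiform (\<lambda>k. n * unit_deg None k) (\<lambda>v :: 'i option \<Rightarrow> complex^3. h (v None))"
    and van: "vanishes (\<lambda>v. g (v None)) C" "vanishes (\<lambda>v. h (v None)) C"
  shows "\<exists>v. v \<noteq> 0 \<and> dot l v = 0 \<and> g v = 0 \<and> h v = 0"
proof (cases "\<exists>x\<in>C. dot l (coords x None) = 0")
  case True
  then obtain x where "x \<in> C" "dot l (coords x None) = 0" by blast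
  then show ?thesis using van by (intro exI[of _ "coords x None"]) (simp add: vanishes_def)
next
  case False
  fix i :: 'i
  note D = irreducible_curveD[OF C(1)]
  have "\<exists>x\<in>C. x None \<notin> range p"
  proof (rule ccontr)
    assume "\<not> ?thesis"
    then have "C \<subseteq> (\<Union>j\<in>UNIV. E j)" using D(1) by (fastforce simp: mem_E)
    then have "\<exists>j\<in>UNIV. C \<subseteq> E j"
      by (intro irreducible_subset_UN[OF D(4)]) (simp_all add: zariski_closed_E)
    then obtain j where "C \<subseteq> E j" by blast
    then have "C = E j" by (rule curve_subset_E[OF C(1)])
    then show False using C(2) by blast
  qed
  then obtain x where x: "x \<in> C" "x None \<notin> range p" by blast
  have "\<exists>u1 u2 \<kappa>. chart p i u1 u2 \<kappa> \<and> {x} \<subseteq> chart.U p i u1 u2 \<kappa> \<and> dot l u1 = 0 \<and> dot l u2 = 0"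
  proof (rule chart_exists[OF l])
    show "y None \<noteq> p j" if "y \<in> {x}" for y j using that x(2) by (metis rangeI singletonD)
  qed (use x(1) False D(1) in auto)
  then obtain u1 u2 \<kappa> where ch: "chart p i u1 u2 \<kappa>" "x \<in> chart.U p i u1 u2 \<kappa>" "dot l u1 = 0" "dot l u2 = 0"
    by blast
  interpret c: chart p i u1 u2 \<kappa> by (rule ch(1))
  have CU: "C \<inter> c.U \<noteq> {}" using x(1) ch(2) by blast
  obtain f where f: "prime_elem f" "\<And>q. q \<in> vanishing_ideal (c.V C) \<longleftrightarrow> f dvd q"
    using c.curve_equation[OF C(1) CU] by blast
  have f0: "f \<noteq> 0" using f(1) by auto
  have "f \<in> vanishing_ideal (c.V C)" using f(2) by simp
  then have fx: "ev f (c.\<sigma> x) (c.\<tau> x) = 0" unfolding c.V_ideal using x(1) ch(2) by blast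
  \<comment> \<open>Here \<open>C \<notin> range E\<close> enters: the equation \<open>s = 0\<close>
    of \<open>E i\<close>, which is contracted to a point, would give no unbounded zeros.\<close>
  have sx: "c.\<sigma> x \<noteq> 0"
  proof
    assume s: "c.\<sigma> x = 0"
    obtain a where "coords x None = a *s c.\<psi> (c.\<sigma> x) (c.\<tau> x) None" using c.U_coords[OF ch(2)] by blast
    then have "coords x None = a *s w i" using s by (simp add: c.\<psi>_simps)
    then have "x None = p i" unfolding coords_def w_def by (rule cp2_eqI)
    then show False using x(2) by blast
  qed
  have zero: "g (c.\<psi> s t None) = 0 \<and> h (c.\<psi> s t None) = 0" if "ev f s t = 0" for s t
  proof -
    have "f dvd c.pull (\<lambda>v. g (v None))" "f dvd c.pull (\<lambda>v. h (v None))"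
      using c.curve_vanishes_iff[OF C(1) CU F] c.curve_vanishes_iff[OF C(1) CU G] van f(2) by simp_all
    then have "ev (c.pull (\<lambda>v. g (v None))) s t = 0" "ev (c.pull (\<lambda>v. h (v None))) s t = 0"
      using that by (auto elim!: dvdE)
    then show ?thesis by (simp add: c.ev_pull[OF F] c.ev_pull[OF G])
  qed
  have "\<forall>k :: nat. \<exists>v. g v = 0 \<and> h v = 0 \<and> dot l v = dot l (w i) \<and> real (Suc k) < norm v"
  proof
    fix k :: nat
    obtain s t where st: "ev f s t = 0" "real (Suc k) < norm (c.\<psi> s t None)"
      using c.\<psi>_unbounded[OF f0 fx sx] by blast
    moreover have "dot l (c.\<psi> s t None) = dot l (w i)" by (simp add: c.\<psi>_simps dot_algebra ch(3,4))
    ultimately show "\<exists>v. g v = 0 \<and> h v = 0 \<and> dot l v = dot l (w i) \<and> real (Suc k) < norm v" using zero by blast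
  qed
  from choice[OF this] obtain v where
    v: "\<forall>k :: nat. g (v k) = 0 \<and> h (v k) = 0 \<and> dot l (v k) = dot l (w i) \<and> real (Suc k) < norm (v k)" ..
  \<comment> \<open>Scaling to the unit sphere preserves the zeros of the two forms. As
    \<open>dot l\<close> is constant along the unbounded sequence, it tends to 0 after scaling, so a
    limit point lies on the line \<open>l\<close>.\<close>
  define z where "z k = (1 / norm (v k)) *\<^sub>R v k" for k
  have vn: "norm (v k) > 0" for k using v by (metis le_less_trans of_nat_0_le_iff)
  have zn: "norm (z k) = 1" for k using vn[of k] by (simp add: z_def)
  have zs: "z k = of_real (1 / norm (v k)) *s v k" for k unfolding z_def by (rule scaleR_smult)
  have zg: "g (z k) = 0" "h (z k) = 0" for k
    unfolding zs form_scale_None[OF F] form_scale_None[OF G] using v by simp_all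
  have zl: "dot l (z k) = of_real (1 / norm (v k)) * dot l (w i)" for k
    unfolding zs dot_algebra using v by simp
  have "seq_compact (sphere (0 :: complex^3) 1)" using compact_sphere compact_eq_seq_compact_metric by blast
  moreover have "\<forall>k. z k \<in> sphere 0 1" using zn by simp
  ultimately obtain y r where y: "y \<in> sphere 0 1" "strict_mono (r :: nat \<Rightarrow> nat)" "(z \<circ> r) \<longlonglongrightarrow> y"
    using seq_compactE by blast
  have lim: "(\<lambda>k. (\<lambda>_ :: 'i option. (z \<circ> r) k) j) \<longlonglongrightarrow> (\<lambda>_ :: 'i option. y) j" for j :: "'i option" using y(3) by (simp add: o_def)
  have "g y = 0"
    using polyfun_tendsto[OF multiform_polyfun[OF F] lim] zg LIMSEQ_unique[OF _ tendsto_const] by fastforce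
  moreover have "h y = 0"
    using polyfun_tendsto[OF multiform_polyfun[OF G] lim] zg LIMSEQ_unique[OF _ tendsto_const] by fastforce
  moreover have "dot l y = 0"
  proof -
    have "(\<lambda>k. dot l ((z \<circ> r) k)) \<longlonglongrightarrow> dot l y"
      using polyfun_tendsto[OF polyfun_dot[of l None] lim] by simp
    moreover have "(\<lambda>k. dot l ((z \<circ> r) k)) \<longlonglongrightarrow> 0"
    proof (rule tendsto_norm_zero_cancel, rule Lim_null_comparison)
      show "(\<lambda>k. norm (dot l (w i)) * (1 / real (Suc k))) \<longlonglongrightarrow> 0"
        using tendsto_mult_right_zero[OF LIMSEQ_inverse_real_of_nat] by (simp add: inverse_eq_divide)
      show "\<forall>\<^sub>F k in sequentially. norm (norm (dot l ((z \<circ> r) k))) \<le> norm (dot l (w i)) * (1 / real (Suc k))"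
      proof (rule eventuallyI)
        fix k
        have "k \<le> r k" using y(2) by (rule seq_suble)
        moreover have "real (Suc (r k)) < norm (v (r k))" using v by blast
        ultimately have "real (Suc k) \<le> norm (v (r k))" by simp
        then have le: "1 / norm (v (r k)) \<le> 1 / real (Suc k)" by (intro divide_left_mono) (use vn in simp_all)
        have "norm (dot l (z (r k))) = norm (dot l (w i)) * (1 / norm (v (r k)))"
          unfolding zl by (simp add: norm_mult norm_divide)
        also have "\<dots> \<le> norm (dot l (w i)) * (1 / real (Suc k))"
          by (rule mult_left_mono[OF le]) simp
        finally show "norm (norm (dot l ((z \<circ> r) k))) \<le> norm (dot l (w i)) * (1 / real (Suc k))" by simp
      qed
    qed
    ultimately show ?thesis by (rule LIMSEQ_unique)
  qed
  moreover have "y \<noteq> 0" using y(1) by auto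
  ultimately show ?thesis by blast
qed

end

section \<open>Hasse derivatives of ternary forms\<close>

text \<open>The partial derivative of order \<open>b\<close> of the monomial with exponent
  \<open>a\<close>, divided by the factorials. It has integer coefficients, so it makes sense modulo
  11. Where an entry of \<open>b\<close> exceeds that of \<open>a\<close>, the binomial coefficient
  is zero and the truncated subtraction is harmless.\<close>

fun hasse :: "nat \<times> nat \<times> nat \<Rightarrow> nat \<times> nat \<times> nat \<Rightarrow> 'a \<times> 'a \<times> 'a \<Rightarrow> 'a::comm_ring_1" where
  "hasse (b1, b2, b3) (a1, a2, a3) (x, y, z) =
     of_nat (a1 choose b1) * x ^ (a1 - b1) * (of_nat (a2 choose b2) * y ^ (a2 - b2))
       * (of_nat (a3 choose b3) * z ^ (a3 - b3))"

lemma taylor_power: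
  fixes x y s :: "'a::comm_ring_1"
  assumes "a \<le> N"
  shows "(x + s * y) ^ a = (\<Sum>b\<le>N. of_nat (a choose b) * x ^ (a - b) * (y ^ b * s ^ b))"
proof -
  have "(x + s * y) ^ a = (s * y + x) ^ a" by (simp add: add.commute)
  also have "\<dots> = (\<Sum>b\<le>a. of_nat (a choose b) * (s * y) ^ b * x ^ (a - b))" by (rule binomial_ring)
  also have "\<dots> = (\<Sum>b\<le>a. of_nat (a choose b) * x ^ (a - b) * (y ^ b * s ^ b))"
    by (intro sum.cong refl) (simp add: power_mult_distrib mult_ac)
  also have "\<dots> = (\<Sum>b\<le>N. of_nat (a choose b) * x ^ (a - b) * (y ^ b * s ^ b))"
    using assms by (intro sum.mono_neutral_left) (auto simp: binomial_eq_0 not_le)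
  finally show ?thesis .
qed

lemma taylor_hasse:
  fixes s :: "'a::comm_ring_1"
  assumes "a1 \<le> N" "a2 \<le> N" "a3 \<le> N"
  shows "hasse (0, 0, 0) (a1, a2, a3) (x1 + s * y1, x2 + s * y2, x3 + s * y3) =
    (\<Sum>b1\<le>N. \<Sum>b2\<le>N. \<Sum>b3\<le>N. hasse (b1, b2, b3) (a1, a2, a3) (x1, x2, x3)
       * (y1 ^ b1 * y2 ^ b2 * y3 ^ b3 * s ^ (b1 + b2 + b3)))"
proof -
  have "hasse (0, 0, 0) (a1, a2, a3) (x1 + s * y1, x2 + s * y2, x3 + s * y3)
      = (x1 + s * y1) ^ a1 * ((x2 + s * y2) ^ a2 * (x3 + s * y3) ^ a3)" by (simp add: mult.assoc)
  also have "\<dots> = (\<Sum>b1\<le>N. of_nat (a1 choose b1) * x1 ^ (a1 - b1) * (y1 ^ b1 * s ^ b1)) *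
    ((\<Sum>b2\<le>N. of_nat (a2 choose b2) * x2 ^ (a2 - b2) * (y2 ^ b2 * s ^ b2)) *
     (\<Sum>b3\<le>N. of_nat (a3 choose b3) * x3 ^ (a3 - b3) * (y3 ^ b3 * s ^ b3)))"
    unfolding taylor_power[OF assms(1)] taylor_power[OF assms(2)] taylor_power[OF assms(3)] ..
  also have "\<dots> = (\<Sum>b1\<le>N. \<Sum>b2\<le>N. \<Sum>b3\<le>N. hasse (b1, b2, b3) (a1, a2, a3) (x1, x2, x3)
       * (y1 ^ b1 * y2 ^ b2 * y3 ^ b3 * s ^ (b1 + b2 + b3)))"
    unfolding sum_distrib_right unfolding sum_distrib_left
    by (intro sum.cong refl) (simp add: power_add mult_ac)
  finally show ?thesis .
qed

lemma euler_power:
  fixes x :: "'a::comm_ring_1"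
  shows "of_nat (Suc b) * (of_nat (a choose Suc b) * x ^ (a - Suc b)) * x = of_nat (a - b) * (of_nat (a choose b) * x ^ (a - b))"
proof (cases "b < a")
  case True
  have "Suc b * (a choose Suc b) = (a - b) * (a choose b)"
    by (metis binomial_absorb_comp binomial_absorption)
  then have "(of_nat (Suc b) * of_nat (a choose Suc b) :: 'a) = of_nat (a - b) * of_nat (a choose b)"
    unfolding of_nat_mult[symmetric] by simp
  moreover have "x ^ (a - b) = x ^ (a - Suc b) * x"
    using True by (metis Suc_diff_Suc power_Suc2)
  ultimately show ?thesis by (metis mult.assoc)
qed (simp add: binomial_eq_0)

text \<open>Euler's relation for the form obtained by deriving to order \<open>b\<close>. The
  factors \<open>Suc b\<close> convert the next Hasse derivatives into its ordinary partial
  derivatives.\<close>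

lemma euler_hasse:
  fixes x1 x2 x3 :: "'a::comm_ring_1"
  shows "of_nat (Suc b1) * hasse (Suc b1, b2, b3) (a1, a2, a3) (x1, x2, x3) * x1
    + of_nat (Suc b2) * hasse (b1, Suc b2, b3) (a1, a2, a3) (x1, x2, x3) * x2
    + of_nat (Suc b3) * hasse (b1, b2, Suc b3) (a1, a2, a3) (x1, x2, x3) * x3
    = of_nat (a1 + a2 + a3 - (b1 + b2 + b3)) * hasse (b1, b2, b3) (a1, a2, a3) (x1, x2, x3)"
proof -
  define h where "h a b x = (of_nat (a choose b) * x ^ (a - b) :: 'a)" for a b x
  have e: "of_nat (Suc b) * h a (Suc b) x * x = of_nat (a - b) * h a b x" for a b x
    unfolding h_def by (rule euler_power)
  have "of_nat (Suc b1) * (h a1 (Suc b1) x1 * h a2 b2 x2 * h a3 b3 x3) * x1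
    + of_nat (Suc b2) * (h a1 b1 x1 * h a2 (Suc b2) x2 * h a3 b3 x3) * x2
    + of_nat (Suc b3) * (h a1 b1 x1 * h a2 b2 x2 * h a3 (Suc b3) x3) * x3
    = (of_nat (Suc b1) * h a1 (Suc b1) x1 * x1) * h a2 b2 x2 * h a3 b3 x3
    + (of_nat (Suc b2) * h a2 (Suc b2) x2 * x2) * h a1 b1 x1 * h a3 b3 x3
    + (of_nat (Suc b3) * h a3 (Suc b3) x3 * x3) * h a1 b1 x1 * h a2 b2 x2"
    by (simp only: mult_ac)
  also have "\<dots> = (of_nat (a1 - b1) + of_nat (a2 - b2) + of_nat (a3 - b3)) * (h a1 b1 x1 * h a2 b2 x2 * h a3 b3 x3)"
    unfolding e by (simp add: algebra_simps)
  also have "\<dots> = of_nat (a1 + a2 + a3 - (b1 + b2 + b3)) * (h a1 b1 x1 * h a2 b2 x2 * h a3 b3 x3)"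
  \<comment> \<open>The three truncated differences add up only when none is truncated; otherwise
    the product contains a zero binomial coefficient.\<close>
  proof (cases "b1 \<le> a1 \<and> b2 \<le> a2 \<and> b3 \<le> a3")
    case True
    then have "a1 + a2 + a3 - (b1 + b2 + b3) = (a1 - b1) + (a2 - b2) + (a3 - b3)" by simp
    then show ?thesis by (simp only: of_nat_add)
  next
    case False
    then have "h a1 b1 x1 * h a2 b2 x2 * h a3 b3 x3 = 0" by (auto simp: h_def not_le binomial_eq_0)
    then show ?thesis by simp
  qed
  finally show ?thesis unfolding h_def hasse.simps .
qed

text \<open>Each block of constant first exponent begins with third exponent 0, which puts the
  monomials without third variable at the triangular positions.\<close>

definition exps :: "(nat \<times> nat \<times> nat) list" where
  "exps = concat (map (\<lambda>i. map (\<lambda>j. (9 - i, i - j, j)) [0..<Suc i]) [0..<10])"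

lemma exps_list: "exps = [(9,0,0), (8,1,0), (8,0,1), (7,2,0), (7,1,1), (7,0,2), (6,3,0), (6,2,1), (6,1,2), (6,0,3),
  (5,4,0), (5,3,1), (5,2,2), (5,1,3), (5,0,4), (4,5,0), (4,4,1), (4,3,2), (4,2,3), (4,1,4), (4,0,5),
  (3,6,0), (3,5,1), (3,4,2), (3,3,3), (3,2,4), (3,1,5), (3,0,6), (2,7,0), (2,6,1), (2,5,2), (2,4,3), (2,3,4), (2,2,5), (2,1,6), (2,0,7),
  (1,8,0), (1,7,1), (1,6,2), (1,5,3), (1,4,4), (1,3,5), (1,2,6), (1,1,7), (1,0,8),
  (0,9,0), (0,8,1), (0,7,2), (0,6,3), (0,5,4), (0,4,5), (0,3,6), (0,2,7), (0,1,8), (0,0,9)]"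
  by (simp add: exps_def upt_rec)

lemma length_exps: "length exps = 55"
  by (simp add: exps_list)

lemma exps_degree: "(a1, a2, a3) \<in> set exps \<Longrightarrow> a1 + a2 + a3 = 9"
  by (auto simp: exps_list)

definition trip :: "complex^3 \<Rightarrow> complex \<times> complex \<times> complex" where
  "trip v = (v$1, v$2, v$3)"

definition nonic :: "(nat \<Rightarrow> complex) \<Rightarrow> complex^3 \<Rightarrow> complex" where
  "nonic c v = (\<Sum>j<55. c j * hasse (0, 0, 0) (exps ! j) (trip v))"

definition dnonic :: "(nat \<Rightarrow> complex) \<Rightarrow> nat \<times> nat \<times> nat \<Rightarrow> complex^3 \<Rightarrow> complex" where
  "dnonic c b v = (\<Sum>j<55. c j * hasse b (exps ! j) (trip v))"

lemma exps_nth: "j < 55 \<Longrightarrow> \<exists>a1 a2 a3. exps ! j = (a1, a2, a3) \<and> a1 + a2 + a3 = 9"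
proof -
  assume "j < 55"
  then have "exps ! j \<in> set exps" by (simp add: length_exps)
  moreover obtain a1 a2 a3 where "exps ! j = (a1, a2, a3)" by (metis prod_cases3)
  ultimately show ?thesis using exps_degree by metis
qed

lemma nonic_taylor:
  "nonic c (u + s *s y) = (\<Sum>b1\<le>9. \<Sum>b2\<le>9. \<Sum>b3\<le>9. dnonic c (b1, b2, b3) u
       * (y$1 ^ b1 * y$2 ^ b2 * y$3 ^ b3 * s ^ (b1 + b2 + b3)))"
proof -
  have "c j * hasse (0, 0, 0) (exps ! j) (trip (u + s *s y)) =
     (\<Sum>b1\<le>9. \<Sum>b2\<le>9. \<Sum>b3\<le>9. c j * hasse (b1, b2, b3) (exps ! j) (trip u)
       * (y$1 ^ b1 * y$2 ^ b2 * y$3 ^ b3 * s ^ (b1 + b2 + b3)))" if j: "j < 55" for j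
  proof -
    obtain a1 a2 a3 where a: "exps ! j = (a1, a2, a3)" "a1 + a2 + a3 = 9" using exps_nth[OF j] by blast
    have t: "trip (u + s *s y) = (u$1 + s * y$1, u$2 + s * y$2, u$3 + s * y$3)" by (simp add: trip_def)
    have "a1 \<le> 9" "a2 \<le> 9" "a3 \<le> 9" using a(2) by auto
    from taylor_hasse[OF this, of "u$1" s "y$1" "u$2" "y$2" "u$3" "y$3"]
    show ?thesis unfolding a(1) t unfolding trip_def by (simp only: sum_distrib_left mult.assoc)
  qed
  then have "nonic c (u + s *s y) = (\<Sum>j<55. \<Sum>b1\<le>9. \<Sum>b2\<le>9. \<Sum>b3\<le>9. c j * hasse (b1, b2, b3) (exps ! j) (trip u)
       * (y$1 ^ b1 * y$2 ^ b2 * y$3 ^ b3 * s ^ (b1 + b2 + b3)))"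
    unfolding nonic_def by (intro sum.cong) auto
  also have "\<dots> = (\<Sum>b1\<le>9. \<Sum>b2\<le>9. \<Sum>b3\<le>9. \<Sum>j<55. c j * hasse (b1, b2, b3) (exps ! j) (trip u)
       * (y$1 ^ b1 * y$2 ^ b2 * y$3 ^ b3 * s ^ (b1 + b2 + b3)))"
  proof -
    have sw: "(\<Sum>j<55. \<Sum>b\<le>9. G j b) = (\<Sum>b\<le>9. \<Sum>j<55. G j b)" for G :: "nat \<Rightarrow> nat \<Rightarrow> complex"
      by (rule sum.swap)
    show ?thesis unfolding sw ..
  qed
  finally show ?thesis unfolding dnonic_def sum_distrib_right .
qed

text \<open>By Euler's relation the derivatives of lower order vanish as well.\<close>

lemma dnonic_lower:
  assumes k: "k < 9" and z: "\<And>b1 b2 b3. b1 + b2 + b3 = Suc k \<Longrightarrow> dnonic c (b1, b2, b3) u = 0"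
    and b: "b1 + b2 + b3 = k"
  shows "dnonic c (b1, b2, b3) u = 0"
proof -
  have "of_nat (Suc b1) * dnonic c (Suc b1, b2, b3) u * u$1 + of_nat (Suc b2) * dnonic c (b1, Suc b2, b3) u * u$2
    + of_nat (Suc b3) * dnonic c (b1, b2, Suc b3) u * u$3 = of_nat (9 - k) * dnonic c (b1, b2, b3) u"
    unfolding dnonic_def sum_distrib_left sum_distrib_right sum.distrib[symmetric]
  proof (rule sum.cong[OF refl])
    fix j :: nat assume "j \<in> {..<55}"
    then obtain a1 a2 a3 where a: "exps ! j = (a1, a2, a3)" "a1 + a2 + a3 = 9" using exps_nth by blast
    have e: "of_nat (9 - k) * hasse (b1, b2, b3) (a1, a2, a3) (u$1, u$2, u$3) =
      of_nat (Suc b1) * hasse (Suc b1, b2, b3) (a1, a2, a3) (u$1, u$2, u$3) * u$1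
    + of_nat (Suc b2) * hasse (b1, Suc b2, b3) (a1, a2, a3) (u$1, u$2, u$3) * u$2
    + of_nat (Suc b3) * hasse (b1, b2, Suc b3) (a1, a2, a3) (u$1, u$2, u$3) * u$3"
      using euler_hasse[of b1 b2 b3 a1 a2 a3 "u$1" "u$2" "u$3"] unfolding a(2) b by simp
    have "of_nat (9 - k) * (c j * hasse (b1, b2, b3) (a1, a2, a3) (u$1, u$2, u$3))
      = c j * (of_nat (9 - k) * hasse (b1, b2, b3) (a1, a2, a3) (u$1, u$2, u$3))" by (rule mult.left_commute)
    then show "of_nat (Suc b1) * (c j * hasse (Suc b1, b2, b3) (exps ! j) (trip u)) * u$1
      + of_nat (Suc b2) * (c j * hasse (b1, Suc b2, b3) (exps ! j) (trip u)) * u$2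
      + of_nat (Suc b3) * (c j * hasse (b1, b2, Suc b3) (exps ! j) (trip u)) * u$3
      = of_nat (9 - k) * (c j * hasse (b1, b2, b3) (exps ! j) (trip u))"
      unfolding a(1) trip_def e distrib_left by (simp only: mult_ac)
  qed
  moreover have "dnonic c (Suc b1, b2, b3) u = 0" "dnonic c (b1, Suc b2, b3) u = 0" "dnonic c (b1, b2, Suc b3) u = 0"
    using b by (auto intro!: z)
  ultimately have "of_nat (9 - k) * dnonic c (b1, b2, b3) u = 0" by simp
  moreover have "of_nat (9 - k) \<noteq> (0 :: complex)" using k by (simp only: of_nat_eq_0_iff)
  ultimately show ?thesis by (simp only: mult_eq_0_iff simp_thms)
qed

lemma dnonic_vanish_below:
  assumes "m < 9" "\<And>b1 b2 b3. b1 + b2 + b3 = m \<Longrightarrow> dnonic c (b1, b2, b3) u = 0" "b1 + b2 + b3 \<le> m"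
  shows "dnonic c (b1, b2, b3) u = 0"
  using assms
proof (induction m arbitrary: b1 b2 b3)
  case 0
  then show ?case by simp
next
  case (Suc m)
  show ?case
  proof (cases "b1 + b2 + b3 = Suc m")
    case False
    show ?thesis
    proof (rule Suc.IH)
      show "dnonic c (a1, a2, a3) u = 0" if "a1 + a2 + a3 = m" for a1 a2 a3
        using dnonic_lower[OF _ Suc.prems(2) that] Suc.prems(1) by simp
    qed (use Suc.prems False in auto)
  qed (rule Suc.prems(2))
qed

text \<open>In the Taylor expansion at \<open>u\<close> only terms of order above \<open>m\<close>
  survive.\<close>

lemma nonic_order:
  assumes "m < 9" "\<And>b1 b2 b3. b1 + b2 + b3 = m \<Longrightarrow> dnonic c (b1, b2, b3) u = 0"
  shows "\<exists>r. \<forall>s. nonic c (u + s *s y) = s ^ Suc m * poly r s"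
proof -
  define k where "k b1 b2 b3 = dnonic c (b1, b2, b3) u * (y$1 ^ b1 * y$2 ^ b2 * y$3 ^ b3)" for b1 b2 b3
  let ?r = "\<Sum>b1\<le>9. \<Sum>b2\<le>9. \<Sum>b3\<le>9. monom (k b1 b2 b3) (b1 + b2 + b3 - Suc m)"
  have "dnonic c (b1, b2, b3) u * (y$1 ^ b1 * y$2 ^ b2 * y$3 ^ b3 * s ^ (b1 + b2 + b3))
      = s ^ Suc m * poly (monom (k b1 b2 b3) (b1 + b2 + b3 - Suc m)) s" for b1 b2 b3 s
  proof (cases "b1 + b2 + b3 \<le> m")
    case True
    then have "dnonic c (b1, b2, b3) u = 0" using dnonic_vanish_below[OF assms] by blast
    then show ?thesis by (simp add: k_def)
  next
    case False
    then have "b1 + b2 + b3 = Suc m + (b1 + b2 + b3 - Suc m)" by simp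
    then have "s ^ (b1 + b2 + b3) = s ^ Suc m * s ^ (b1 + b2 + b3 - Suc m)"
      by (metis power_add)
    then show ?thesis by (simp add: k_def poly_monom mult_ac del: power_Suc)
  qed
  then have "nonic c (u + s *s y) = s ^ Suc m * poly ?r s" for s
    unfolding nonic_taylor by (simp add: poly_sum sum_distrib_left del: power_Suc)
  then show ?thesis by blast
qed

lemma multiform_component: "multiform (unit_deg i) (\<lambda>v. v i $ k)"
proof -
  have "v $ k = dot (axis k 1) v" for v
    unfolding dot_sum by (simp add: axis_def if_distrib[where f="\<lambda>x. x * _"] sum.delta cong: if_cong)
  then show ?thesis using multiform_dot[of i "axis k 1"] by simp
qed

lemma multiform_hasse:
  "multiform (\<lambda>k. (a1 + a2 + a3 - (b1 + b2 + b3)) * unit_deg i k) (\<lambda>v. hasse (b1, b2, b3) (a1, a2, a3) (trip (v i)))"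
proof (cases "b1 \<le> a1 \<and> b2 \<le> a2 \<and> b3 \<le> a3")
  case True
  then have e: "(a1 + a2 + a3 - (b1 + b2 + b3)) * unit_deg i k
      = (a1 - b1) * unit_deg i k + (a2 - b2) * unit_deg i k + (a3 - b3) * unit_deg i k" for k
    by (simp add: distrib_right[symmetric])
  show ?thesis unfolding trip_def hasse.simps e
    by (intro multiform_mult multiform_cmult multiform_power multiform_component)
next
  case False
  then have "hasse (b1, b2, b3) (a1, a2, a3) (trip u) = 0" for u by (auto simp: trip_def not_le binomial_eq_0)
  then show ?thesis by (simp add: multiform_zero)
qed

lemma multiform_nonic: "multiform (\<lambda>k. 9 * unit_deg i k) (\<lambda>v. nonic c (v i))"
  unfolding nonic_def
proof (intro multiform_sum multiform_cmult)
  fix j :: nat assume "j \<in> {..<55}"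
  then obtain a1 a2 a3 where a: "exps ! j = (a1, a2, a3)" "a1 + a2 + a3 = 9" using exps_nth by blast
  show "multiform (\<lambda>k. 9 * unit_deg i k) (\<lambda>v. hasse (0, 0, 0) (exps ! j) (trip (v i)))"
    using multiform_hasse[of a1 a2 a3 0 0 0 i] unfolding a by simp
qed

section \<open>Determinants\<close>

text \<open>Each term of the Leibniz expansion takes one entry from every row, so it has the sum of
  the row multidegrees.\<close>

lemma multiform_det:
  assumes "\<And>a b. a < n \<Longrightarrow> b < n \<Longrightarrow> multiform (D a) (\<lambda>v. f v a b)"
  shows "multiform (\<lambda>k. \<Sum>a\<in>{0..<n}. D a k) (\<lambda>v. Determinant.det (mat n n (\<lambda>(a, b). f v a b)))"
proof -
  have "Determinant.det (mat n n (\<lambda>(a, b). f v a b))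
      = (\<Sum>p\<in>{p. p permutes {0..<n}}. signof p * (\<Prod>a\<in>{0..<n}. f v a (p a)))" for v
  proof -
    have "(\<Prod>a\<in>{0..<n}. mat n n (\<lambda>(a, b). f v a b) $$ (a, p a)) = (\<Prod>a\<in>{0..<n}. f v a (p a))"
      if "p permutes {0..<n}" for p
      using permutes_in_image[OF that] by (intro prod.cong) auto
    then show ?thesis unfolding Determinant.det_def by (auto intro!: sum.cong)
  qed
  moreover have "multiform (\<lambda>k. \<Sum>a\<in>{0..<n}. D a k) (\<lambda>v. \<Sum>p\<in>{p. p permutes {0..<n}}. signof p * (\<Prod>a\<in>{0..<n}. f v a (p a)))"
  proof (intro multiform_sum multiform_cmult multiform_prod assms)
    show "p a < n" if "p \<in> {p. p permutes {0..<n}}" "a \<in> {0..<n}" for p a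
      using that permutes_in_image by fastforce
  qed auto
  ultimately show ?thesis by simp
qed

text \<open>The coordinates of Cramer's solution of \<open>n\<close> linear equations in \<open>n + 1\<close> unknowns.\<close>

definition bordered :: "nat \<Rightarrow> (nat \<Rightarrow> nat \<Rightarrow> 'a) \<Rightarrow> (nat \<Rightarrow> 'a) \<Rightarrow> 'a mat" where
  "bordered n f r = mat (Suc n) (Suc n) (\<lambda>(a, b). if a < n then f a b else r b)"

definition cramer :: "nat \<Rightarrow> (nat \<Rightarrow> nat \<Rightarrow> 'a::comm_ring_1) \<Rightarrow> nat \<Rightarrow> 'a" where
  "cramer n f j = Determinant.det (bordered n f (\<lambda>b. if b = j then 1 else 0))"

lemma det_bordered:
  "Determinant.det (bordered n f r) = (\<Sum>p\<in>{p. p permutes {0..<Suc n}}. signof p * ((\<Prod>a\<in>{0..<n}. f a (p a)) * r (p n)))"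
proof -
  have "(\<Prod>a\<in>{0..<Suc n}. bordered n f r $$ (a, p a)) = (\<Prod>a\<in>{0..<n}. f a (p a)) * r (p n)"
    if "p permutes {0..<Suc n}" for p
  proof -
    have pa: "p a < Suc n" if "a < Suc n" for a
      using permutes_in_image[OF \<open>p permutes {0..<Suc n}\<close>, of a] that by simp
    have "(\<Prod>a\<in>{0..<n}. bordered n f r $$ (a, p a)) = (\<Prod>a\<in>{0..<n}. f a (p a))"
      using pa by (intro prod.cong) (auto simp: bordered_def)
    then show ?thesis using pa[of n] by (simp add: prod.atLeast0_lessThan_Suc bordered_def)
  qed
  then show ?thesis unfolding Determinant.det_def by (auto simp: bordered_def intro!: sum.cong)
qed

lemma sum_cramer: "(\<Sum>j<Suc n. r j * cramer n f j) = Determinant.det (bordered n f r)"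
proof -
  have "(\<Sum>j<Suc n. r j * cramer n f j) = (\<Sum>j<Suc n. \<Sum>p\<in>{p. p permutes {0..<Suc n}}.
      r j * (signof p * ((\<Prod>a\<in>{0..<n}. f a (p a)) * (if p n = j then 1 else 0))))"
    unfolding cramer_def det_bordered sum_distrib_left ..
  also have "\<dots> = (\<Sum>p\<in>{p. p permutes {0..<Suc n}}. \<Sum>j<Suc n.
      r j * (signof p * ((\<Prod>a\<in>{0..<n}. f a (p a)) * (if p n = j then 1 else 0))))"
    by (rule sum.swap)
  also have "\<dots> = (\<Sum>p\<in>{p. p permutes {0..<Suc n}}. signof p * ((\<Prod>a\<in>{0..<n}. f a (p a)) * r (p n)))"
  proof (intro sum.cong refl)
    fix p assume "p \<in> {p. p permutes {0..<Suc n}}"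
    then have "p permutes {0..<Suc n}" by simp
    from permutes_in_image[OF this, of n] have pn: "p n < Suc n" by simp
    have "(\<Sum>j<Suc n. r j * (signof p * ((\<Prod>a\<in>{0..<n}. f a (p a)) * (if p n = j then 1 else 0))))
        = (\<Sum>j<Suc n. if p n = j then r j * (signof p * (\<Prod>a\<in>{0..<n}. f a (p a))) else 0)"
      by (intro sum.cong) auto
    also have "\<dots> = r (p n) * (signof p * (\<Prod>a\<in>{0..<n}. f a (p a)))"
      using pn by (simp add: sum.delta)
    finally show "(\<Sum>j<Suc n. r j * (signof p * ((\<Prod>a\<in>{0..<n}. f a (p a)) * (if p n = j then 1 else 0))))
        = signof p * ((\<Prod>a\<in>{0..<n}. f a (p a)) * r (p n))" by (simp add: mult_ac)
  qed
  finally show ?thesis unfolding det_bordered .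
qed

text \<open>Pairing the solution with row \<open>a\<close> amounts to bordering by this row a second
  time, and a determinant with two equal rows is zero.\<close>

lemma cramer_kernel:
  assumes a: "a < n"
  shows "(\<Sum>j<Suc n. f a j * cramer n f j) = 0"
  unfolding sum_cramer
proof (rule det_identical_rows[of _ "Suc n" a n])
  show "row (bordered n f (f a)) a = row (bordered n f (f a)) n"
    using a by (intro eq_vecI) (auto simp: bordered_def)
qed (use a in \<open>auto simp: bordered_def\<close>)

definition sylvester :: "(nat \<Rightarrow> 'a) \<Rightarrow> (nat \<Rightarrow> 'a) \<Rightarrow> 'a::comm_ring_1 mat" where
  "sylvester b b' = mat 18 18 (\<lambda>(i, j). if i < 9 then (if i \<le> j \<and> j \<le> i + 9 then b (j - i) else 0)
     else (if i - 9 \<le> j \<and> j \<le> i then b' (j - (i - 9)) else 0))"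

lemma sylvester_row:
  fixes x y :: complex
  assumes i: "i < 9" and z: "(\<Sum>k\<le>9. b k * (x ^ (9 - k) * y ^ k)) = 0"
  shows "(\<Sum>j<18. (if i \<le> j \<and> j \<le> i + 9 then b (j - i) else 0) * (x ^ (17 - j) * y ^ j)) = 0"
proof -
  have "(\<Sum>j<18. (if i \<le> j \<and> j \<le> i + 9 then b (j - i) else 0) * (x ^ (17 - j) * y ^ j))
      = (\<Sum>j\<in>{i..i + 9}. b (j - i) * (x ^ (17 - j) * y ^ j))"
    using i by (intro sum.mono_neutral_cong_right) auto
  also have "\<dots> = (\<Sum>k\<le>9. b k * (x ^ (17 - (k + i)) * y ^ (k + i)))"
    by (rule sum.reindex_bij_witness[of _ "\<lambda>k. k + i" "\<lambda>j. j - i"]) auto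
  also have "\<dots> = (\<Sum>k\<le>9. x ^ (8 - i) * y ^ i * (b k * (x ^ (9 - k) * y ^ k)))"
  proof (intro sum.cong refl)
    fix k :: nat assume "k \<in> {..9}"
    then have "17 - (k + i) = (8 - i) + (9 - k)" using i by auto
    then show "b k * (x ^ (17 - (k + i)) * y ^ (k + i)) = x ^ (8 - i) * y ^ i * (b k * (x ^ (9 - k) * y ^ k))"
      by (simp add: power_add mult_ac)
  qed
  also have "\<dots> = x ^ (8 - i) * y ^ i * (\<Sum>k\<le>9. b k * (x ^ (9 - k) * y ^ k))" by (rule sum_distrib_left[symmetric])
  finally show ?thesis using z by simp
qed

text \<open>The monomials of degree 17 at the common zero form a kernel vector: each row expresses
  one of the two forms times a monomial of degree 8. The vector is nonzero because it contains
  \<open>x ^ 17\<close> and \<open>y ^ 17\<close>.\<close>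

lemma sylvester_common_zero:
  fixes x y :: complex
  assumes z: "(\<Sum>k\<le>9. b k * (x ^ (9 - k) * y ^ k)) = 0" "(\<Sum>k\<le>9. b' k * (x ^ (9 - k) * y ^ k)) = 0"
    and xy: "x \<noteq> 0 \<or> y \<noteq> 0"
  shows "Determinant.det (sylvester b b') = 0"
proof -
  define m where "m = Matrix.vec 18 (\<lambda>j. x ^ (17 - j) * y ^ j)"
  have "m \<noteq> 0\<^sub>v 18"
  proof
    assume m0: "m = 0\<^sub>v 18"
    have "vec_index m 0 = x ^ 17" "vec_index m 17 = y ^ 17" by (simp_all add: m_def)
    then show False using m0 xy by auto
  qed
  moreover have "sylvester b b' *\<^sub>v m = 0\<^sub>v 18"
  proof (rule eq_vecI)
    fix i assume "i < dim_vec (0\<^sub>v 18 :: complex Matrix.vec)"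
    then have i: "i < 18" by simp
    have "vec_index (sylvester b b' *\<^sub>v m) i = (\<Sum>j<18. (if i < 9 then (if i \<le> j \<and> j \<le> i + 9 then b (j - i) else 0)
     else (if i - 9 \<le> j \<and> j \<le> i then b' (j - (i - 9)) else 0)) * (x ^ (17 - j) * y ^ j))"
      using i by (simp add: sylvester_def m_def scalar_prod_def atLeast0LessThan)
    also have "\<dots> = 0"
    proof (cases "i < 9")
      case True
      then show ?thesis using sylvester_row[OF True z(1)] by simp
    next
      case False
      then have "i - 9 < 9" "i - 9 + 9 = i" using i by auto
      then show ?thesis using sylvester_row[OF _ z(2), of "i - 9"] False by simp
    qed
    finally show "vec_index (sylvester b b' *\<^sub>v m) i = vec_index (0\<^sub>v 18) i" using i by simp
  qed (simp add: sylvester_def)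
  moreover have "sylvester b b' \<in> carrier_mat 18 18" "m \<in> carrier_vec 18"
    by (simp_all add: sylvester_def m_def)
  ultimately show ?thesis using det_0_iff_vec_prod_zero_field by blast
qed

section \<open>Nonics with eight triple and two double points\<close>

text \<open>
  Double points at \<open>0\<close> and \<open>1\<close>, triple points at \<open>2, \<dots>, 9\<close>. By \<open>dnonic_lower\<close> it suffices to annihilate
  the derivatives of the highest relevant order: 54 conditions on 55 coefficients.
\<close>

definition derivs :: "nat \<Rightarrow> (nat \<times> nat \<times> nat) list" where
  "derivs k = (if k < 2 then [(1,0,0), (0,1,0), (0,0,1)]
     else [(2,0,0), (1,1,0), (1,0,1), (0,2,0), (0,1,1), (0,0,2)])"

definition conds :: "(nat \<times> nat \<times> nat \<times> nat) list" where
  "conds = concat (map (\<lambda>k. map (Pair k) (derivs k)) [0..<10])"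

lemma length_conds: "length conds = 54"
  by code_simp

lemma conds_mem:
  assumes k: "k < 10" and b: "b1 + b2 + b3 = (if k < 2 then 1 else 2)"
  shows "(k, b1, b2, b3) \<in> set conds"
proof -
  have "\<forall>k\<in>set [0..<10]. \<forall>b\<in>set (derivs k). (k, b) \<in> set conds" by code_simp
  moreover have "(b1, b2, b3) \<in> set (derivs k)"
  proof (cases "k < 2")
    case True
    then have "b1 + b2 + b3 = 1" using b by simp
    then have "(b1 = 1 \<and> b2 = 0 \<and> b3 = 0) \<or> (b1 = 0 \<and> b2 = 1 \<and> b3 = 0) \<or> (b1 = 0 \<and> b2 = 0 \<and> b3 = 1)"
      by presburger
    then show ?thesis using True by (elim disjE) (simp_all add: derivs_def)
  next
    case False
    then have "b1 + b2 + b3 = 2" using b by simp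
    then have "(b1 = 2 \<and> b2 = 0 \<and> b3 = 0) \<or> (b1 = 1 \<and> b2 = 1 \<and> b3 = 0) \<or> (b1 = 1 \<and> b2 = 0 \<and> b3 = 1)
      \<or> (b1 = 0 \<and> b2 = 2 \<and> b3 = 0) \<or> (b1 = 0 \<and> b2 = 1 \<and> b3 = 1) \<or> (b1 = 0 \<and> b2 = 0 \<and> b3 = 2)"
      by presburger
    then show ?thesis using False by (elim disjE) (simp_all add: derivs_def)
  qed
  ultimately show ?thesis using k by simp
qed

definition condrow :: "(nat \<Rightarrow> 'a \<times> 'a \<times> 'a::comm_ring_1) \<Rightarrow> nat \<Rightarrow> nat \<Rightarrow> 'a" where
  "condrow w a j = hasse (snd (conds ! a)) (exps ! j) (w (fst (conds ! a)))"

definition coef :: "(nat \<Rightarrow> 'a \<times> 'a \<times> 'a::comm_ring_1) \<Rightarrow> nat \<Rightarrow> 'a" where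
  "coef w j = cramer 54 (condrow w) j"

lemma dnonic_coef:
  assumes "k < 10" "b1 + b2 + b3 = (if k < 2 then 1 else 2)"
  shows "dnonic (coef (\<lambda>k. trip (v k))) (b1, b2, b3) (v k) = 0"
proof -
  obtain a where a: "a < 54" "conds ! a = (k, b1, b2, b3)"
    using conds_mem[OF assms] length_conds by (metis in_set_conv_nth)
  have "(\<Sum>j<Suc 54. condrow (\<lambda>k. trip (v k)) a j * coef (\<lambda>k. trip (v k)) j) = 0"
    unfolding coef_def by (rule cramer_kernel[OF a(1)])
  then show ?thesis by (simp add: dnonic_def condrow_def a(2) mult.commute)
qed

text \<open>A condition of order \<open>m\<close> at a point has degree \<open>9 - m\<close> in this
  point for every column, and the border is constant. Hence the multidegree is the same for all
  \<open>j\<close>, as needed for the rows of the Sylvester matrix.\<close>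

lemma multiform_coef:
  fixes e :: "nat \<Rightarrow> 'k::finite"
  shows "\<exists>d. \<forall>j<55. multiform d (\<lambda>v. coef (\<lambda>k. trip (v (e k))) j)"
proof (intro exI allI impI)
  fix j :: nat assume j: "j < 55"
  define D where "D a k = (if a < 54 then (case conds ! a of (i, b1, b2, b3) \<Rightarrow> (9 - (b1 + b2 + b3)) * unit_deg (e i) k) else 0)"
    for a k
  have "multiform (D a) (\<lambda>v. if a < 54 then condrow (\<lambda>k. trip (v (e k))) a b else if b = j then 1 else 0)"
    if ab: "a < Suc 54" "b < Suc 54" for a b
  proof (cases "a < 54")
    case True
    obtain i b1 b2 b3 where c: "conds ! a = (i, b1, b2, b3)" by (metis prod_cases4)
    obtain a1 a2 a3 where x: "exps ! b = (a1, a2, a3)" "a1 + a2 + a3 = 9" using exps_nth[of b] ab(2) by auto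
    have "D a = (\<lambda>k. (a1 + a2 + a3 - (b1 + b2 + b3)) * unit_deg (e i) k)"
      unfolding x(2) by (rule ext) (simp add: D_def True c)
    then show ?thesis using multiform_hasse[of a1 a2 a3 b1 b2 b3 "e i"] True c x(1) by (simp add: condrow_def)
  next
    case False
    then have "D a = (\<lambda>_. 0)" by (auto simp: D_def)
    then show ?thesis using False by (simp add: multiform_const)
  qed
  from multiform_det[of "Suc 54", OF this]
  show "multiform (\<lambda>k. \<Sum>a\<in>{0..<Suc 54}. D a k) (\<lambda>v. coef (\<lambda>k. trip (v (e k))) j)"
    unfolding coef_def cramer_def bordered_def by simp
qed

text \<open>The position in \<open>exps\<close> of the \<open>k\<close>-th monomial without third variable.\<close>

definition line_idx :: "nat \<Rightarrow> nat" where
  "line_idx k = k * Suc k div 2"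

lemma nonic_at_infinity:
  assumes "v$3 = 0"
  shows "nonic c v = (\<Sum>k\<le>9. c (line_idx k) * (v$1 ^ (9 - k) * v$2 ^ k))"
proof -
  have l: "(\<Sum>j<n. g j) = (\<Sum>j\<leftarrow>[0..<n]. g j)" for g :: "nat \<Rightarrow> complex" and n
    by (simp add: interv_sum_list_conv_sum_set_nat atLeast0LessThan)
  have ten: "{..9 :: nat} = {..<10}" by auto
  have u: "[0..<10] = [0,1,2,3,4,5,6,7,8,9]" "[0..<55] = [0,1,2,3,4,5,6,7,8,9,10,11,12,13,14,15,16,17,18,19,20,21,22,23,24,25,26,27,28,29,30,31,32,33,34,35,36,37,38,39,40,41,42,43,44,45,46,47,48,49,50,51,52,53,54]"
    by (simp_all add: upt_rec)
  show ?thesis unfolding nonic_def ten l u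
    by (simp add: exps_list trip_def line_idx_def assms add.assoc)
qed

text \<open>The involution exchanges the roles of the pairs \<open>{0, 1}\<close> and \<open>{2, 3}\<close>.\<close>

definition swap4 :: "nat \<Rightarrow> nat" where
  "swap4 k = (if k = 0 then 2 else if k = 1 then 3 else if k = 2 then 0 else if k = 3 then 1 else k)"

definition resultant9 :: "(nat \<Rightarrow> 'a \<times> 'a \<times> 'a::comm_ring_1) \<Rightarrow> 'a" where
  "resultant9 w = Determinant.det (sylvester (\<lambda>k. coef w (line_idx k)) (\<lambda>k. coef (\<lambda>i. w (swap4 i)) (line_idx k)))"

lemma line_idx_less: "k \<le> 9 \<Longrightarrow> line_idx k < 55"
proof -
  assume "k \<le> 9"
  then have "k * Suc k \<le> 9 * Suc 9" by (intro mult_le_mono) auto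
  then show ?thesis by (simp add: line_idx_def)
qed

lemma multiform_if:
  "(P \<Longrightarrow> multiform d F) \<Longrightarrow> (\<not> P \<Longrightarrow> multiform d G) \<Longrightarrow> multiform d (\<lambda>v. if P then F v else G v)"
  by (cases P) simp_all

lemma multiform_resultant9:
  fixes e :: "nat \<Rightarrow> 'k::finite"
  shows "\<exists>d. multiform d (\<lambda>v. resultant9 (\<lambda>k. trip (v (e k))))"
proof -
  obtain d where d: "\<And>j. j < 55 \<Longrightarrow> multiform d (\<lambda>v. coef (\<lambda>k. trip (v (e k))) j)"
    using multiform_coef[of e] by blast
  obtain d' where d': "\<And>j. j < 55 \<Longrightarrow> multiform d' (\<lambda>v. coef (\<lambda>k. trip (v (e (swap4 k)))) j)"
    using multiform_coef[of "\<lambda>k. e (swap4 k)"] by blast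
  have entry: "multiform (if i < 9 then d else d') (\<lambda>v.
      if i < 9 then (if i \<le> j \<and> j \<le> i + 9 then coef (\<lambda>k. trip (v (e k))) (line_idx (j - i)) else 0)
     else (if i - 9 \<le> j \<and> j \<le> i then coef (\<lambda>k. trip (v (e (swap4 k)))) (line_idx (j - (i - 9))) else 0))"
    if "i < 18" "j < 18" for i j
  proof (cases "i < 9")
    case True
    have "multiform d (\<lambda>v. if i \<le> j \<and> j \<le> i + 9 then coef (\<lambda>k. trip (v (e k))) (line_idx (j - i)) else 0)"
      by (intro multiform_if multiform_zero d line_idx_less) linarith
    then show ?thesis using True by (simp only: if_True)
  next
    case False
    have "multiform d' (\<lambda>v. if i - 9 \<le> j \<and> j \<le> i
        then coef (\<lambda>k. trip (v (e (swap4 k)))) (line_idx (j - (i - 9))) else 0)"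
      by (intro multiform_if multiform_zero d' line_idx_less) linarith
    then show ?thesis using False by (simp only: if_False)
  qed
  show ?thesis unfolding resultant9_def sylvester_def
    by (rule exI, rule multiform_det[where D = "\<lambda>i. if i < 9 then d else d'"]) (rule entry)
qed

lemma resultant9_no_common_zero:
  assumes R: "resultant9 (\<lambda>k. trip (u k)) \<noteq> 0" and v: "v \<noteq> 0" "v$3 = 0"
  shows "nonic (coef (\<lambda>k. trip (u k))) v \<noteq> 0 \<or> nonic (coef (\<lambda>k. trip (u (swap4 k)))) v \<noteq> 0"
proof (rule ccontr)
  assume "\<not> ?thesis"
  moreover have "v$1 \<noteq> 0 \<or> v$2 \<noteq> 0" using v by (auto simp: vec3_eq_iff)
  ultimately have "resultant9 (\<lambda>k. trip (u k)) = 0"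
    unfolding resultant9_def nonic_at_infinity[OF v(2)]
    by (intro sylvester_common_zero[of _ "v$1" "v$2"]) auto
  then show False using R by simp
qed

section \<open>Ten special points\<close>

text \<open>
  The resultant is nonzero modulo 11 at the following ten points. The certificates \<open>inverse1\<close> and
  \<open>inverse2\<close> are the inverses modulo 11 of the matrices of the two linear systems, bordered by the
  second unit vector; the last column of such an inverse is a kernel vector of the system, and
  \<open>inverse3\<close> is the inverse of the Sylvester matrix of the two kernel vectors.
\<close>

definition points :: "(int \<times> int \<times> int) list" where
  "points = [(2, -2, 1), (-2, -1, 1), (2, -1, 1), (3, -1, 1), (0, -2, 1), (3, 0, 1), (-2, 0, 1), (0, 0, 1), (2, 3, 1), (0, 1, 1)]"

definition points' :: "(int \<times> int \<times> int) list" where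
  "points' = map (\<lambda>k. points ! swap4 k) [0..<10]"

definition inverse1 :: "int list list" where
  "inverse1 = [[-1,-2,-2,4,1,2,2,-2,1,-5,-3,-4,3,-2,5,2,3,0,-4,-3,-2,-5,5,-1,-3,-2,2,-4,5,1,-1,2,-3,-1,5,0,-2,4,4,3,2,4,0,-4,4,-5,-3,-2,-2,5,2,0,-5,2,4],
  [0,0,0,0,0,0,0,0,0,0,0,0,0,0,0,0,0,0,0,0,0,0,0,0,0,0,0,0,0,0,0,0,0,0,0,0,0,0,0,0,0,0,0,0,0,0,0,0,0,0,0,0,0,0,1],
  [3,-5,-5,-1,-3,5,5,-5,-3,4,-2,1,2,-5,-4,5,2,0,1,-2,-5,4,-4,3,2,-5,2,1,-4,0,-3,5,2,3,-4,0,-2,-1,5,2,5,-4,0,1,-1,4,-2,-5,-5,-4,5,0,4,5,-1],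
  [5,1,-2,3,-5,3,-3,-4,5,-3,0,-5,1,1,2,-2,-5,1,0,-3,1,1,4,1,-5,-5,0,-1,2,4,5,3,-4,-4,-2,-2,-4,4,0,-5,3,2,-5,-3,-1,1,4,4,-3,-1,-4,-1,0,3,4],
  [2,-5,3,-1,3,4,-3,1,-3,5,1,-5,-3,3,-2,-4,1,4,-1,-1,-5,-3,-3,-2,-4,0,0,-2,-5,-3,0,-2,1,4,2,5,3,5,4,4,-2,-5,-5,-4,0,-3,-5,-2,2,3,2,-1,-4,-2,5],
  [4,-3,-3,-5,-4,3,3,-3,-4,-2,1,5,-1,-3,2,3,-1,0,5,1,-3,-2,2,4,0,-3,-3,5,2,-3,2,3,4,4,2,-4,-1,-5,-2,-1,3,-2,0,5,-5,-2,1,-3,-3,2,3,0,-2,3,-5],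
  [1,1,-3,-4,4,5,-5,-4,5,4,-4,-3,5,0,0,3,-3,-4,-3,2,-4,2,3,2,4,-4,1,3,-4,-1,3,-2,-1,5,-3,-3,-4,0,4,-2,4,3,5,4,5,-2,-1,1,-1,-3,1,-4,4,-1,2],
  [4,-2,2,-4,-4,-5,0,4,-5,-2,1,-4,-1,-2,-3,2,1,4,-5,-4,2,3,0,5,1,3,3,5,0,3,-1,-5,5,4,2,-1,-3,-5,-4,-1,-5,-2,-1,2,-2,4,3,5,-1,-2,-4,4,3,-1,3],
  [-4,5,2,1,-2,5,3,4,-2,-4,2,-3,5,-4,-2,-5,-1,1,3,-5,3,-1,-1,-4,0,4,5,-4,-5,-1,-2,0,5,3,-4,4,-4,1,-3,0,5,0,5,3,-1,4,5,1,-3,3,-2,-3,-3,3,0],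
  [-2,-4,-4,-3,2,4,4,-4,2,1,5,3,-5,-4,-1,4,-5,0,3,5,-4,1,-1,-2,1,-4,3,3,-1,2,5,4,-3,-2,-1,2,-5,-3,-2,-5,4,-5,0,3,-3,1,5,-4,-4,-1,4,0,1,4,-3],
  [0,0,-3,-3,2,2,-4,1,4,-2,2,-4,0,-1,5,-3,3,1,-3,2,-3,-1,-1,2,-4,3,-3,0,-4,-2,-2,0,1,-1,-2,-1,1,-4,-4,1,-2,1,0,-5,-4,4,5,0,-2,-1,-5,1,2,-5,4],
  [-3,1,1,4,-1,2,0,2,4,4,-3,4,-1,-5,-3,5,1,2,-4,-3,1,3,5,4,2,4,-3,1,-1,-2,-4,-1,-5,3,5,0,-1,5,-2,0,2,-5,-5,5,-2,-3,3,-4,2,3,5,-4,1,3,-1],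
  [2,-1,-2,2,2,1,-3,-2,1,0,-1,2,4,-1,4,-2,-4,1,-5,2,-5,-1,-5,1,-2,4,-5,4,-2,1,5,-4,5,-2,5,-5,-3,4,-2,1,1,2,5,-4,-5,0,1,1,1,5,-4,5,2,0,-4],
  [0,-1,-5,2,3,-4,-5,-1,5,-1,3,4,2,-4,1,4,-2,4,-2,3,3,3,3,5,5,4,1,5,-2,3,4,-4,-3,0,1,5,-4,4,1,-5,-4,-2,-1,-1,2,4,-1,-5,-2,4,-4,-1,0,2,-5],
  [-2,-4,-4,-3,2,4,4,-4,2,1,5,3,-5,-4,-1,4,-5,0,3,5,-4,1,-1,-2,-5,-4,1,3,-1,-2,2,4,1,-2,-1,0,2,-3,2,-5,4,1,0,3,-3,1,5,-4,-4,-1,4,0,1,4,-3],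
  [-5,1,-5,-5,3,-3,-5,2,4,4,3,-3,1,-2,-1,5,3,-5,-4,-3,3,-5,-4,-4,5,-5,-2,-5,-2,2,-2,3,1,1,2,0,-5,5,-5,3,1,4,5,0,-5,-2,5,0,-2,-5,5,-4,-1,-3,-2],
  [4,-4,4,1,4,-5,-2,-1,2,-1,-3,-5,-3,-5,3,0,4,-1,3,2,0,4,-3,1,-2,-5,5,4,-3,4,5,-4,-2,4,1,-3,2,-3,-3,-3,-5,5,-4,3,4,-5,-5,3,3,4,4,-3,-3,-1,-3],
  [-1,-1,1,1,-2,3,-1,-2,-3,5,-4,-4,0,-5,0,4,1,0,-4,1,5,-5,0,-3,1,-3,5,-3,2,-4,1,2,0,-5,5,3,-2,4,-2,4,0,-4,-4,0,-4,-1,-3,0,5,3,-5,-2,1,0,3],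
  [5,3,-1,5,-2,5,-2,3,-3,-4,5,5,0,-5,5,-3,-1,-4,-4,1,-4,4,-3,3,-3,4,2,5,-3,3,-4,4,4,-2,1,-4,2,1,2,-3,-1,5,0,1,1,-2,-3,-1,-5,-2,5,-4,-2,3,-1],
  [2,-5,3,-1,3,4,-3,1,-3,5,1,-5,-3,3,-2,-4,1,4,-1,-1,-5,-3,-3,-2,-4,3,0,-2,4,-3,0,-1,1,4,5,5,3,-3,4,4,-3,-5,-5,-4,0,-3,-5,-2,2,3,2,-1,-4,-2,-1],
  [-2,-4,-4,-3,2,4,4,-4,2,1,5,3,-5,-4,-1,4,-5,0,3,5,-4,1,-1,-2,2,-4,-3,3,-1,-2,0,4,-5,-2,-1,4,2,-3,-4,-5,4,-3,0,3,-3,1,5,-4,-4,-1,4,0,1,4,-3],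
  [-1,-3,1,2,0,-4,-4,-2,4,-5,1,5,2,3,-3,-2,4,1,-4,3,-5,-1,3,-3,-1,-4,-3,5,0,2,-3,1,-3,-3,1,-3,-3,-1,0,-2,-5,-4,0,5,5,3,5,-2,-3,1,-3,-3,2,2,5],
  [5,5,4,4,5,-1,-3,5,-2,-3,1,-2,-3,5,4,-3,5,-5,1,-2,3,-3,0,4,3,-5,-4,-5,5,-1,-2,4,1,1,-5,1,-5,5,-2,1,1,0,2,3,1,1,1,-5,-4,-1,1,3,5,-1,4],
  [5,-2,-4,4,2,1,-1,5,-1,5,4,3,2,3,0,5,2,1,-1,1,-4,5,-1,-3,-2,4,0,3,2,-2,5,3,-5,2,-2,4,-5,4,-3,1,0,2,-4,3,4,1,3,-3,1,-5,0,4,-4,-4,-5],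
  [3,-5,-4,5,3,-4,4,1,-4,3,2,4,1,3,3,-3,-2,3,-1,2,0,3,-1,-2,2,4,1,-5,1,1,0,-2,1,-3,-4,2,3,3,1,-5,-2,-2,-4,-5,-3,4,2,-1,-2,-3,-5,-1,-1,-3,2],
  [-2,5,-4,-3,0,1,0,2,5,0,-4,1,0,1,2,1,4,-5,-1,5,-1,-3,-3,4,0,1,-2,-3,3,4,-4,0,0,-1,2,4,-5,2,-4,-2,0,-2,4,2,3,-4,5,-1,1,1,-2,4,0,4,2],
  [-5,2,-5,-4,2,3,-1,-2,5,-1,-4,5,1,0,-1,-3,4,-1,-2,1,0,-5,-5,-3,2,4,5,-3,5,-5,-2,0,-1,1,5,-4,0,4,-5,-2,5,-3,2,5,-1,0,2,2,-4,-4,-3,3,-1,4,2],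
  [-4,3,3,5,4,-3,-3,3,4,2,-1,-5,1,3,-2,-3,1,0,-5,-1,3,2,-2,-4,2,3,-2,-5,-2,4,-1,-3,1,-4,-2,5,-2,5,4,1,-3,0,0,-5,5,2,-1,3,3,-2,-3,0,2,-3,5],
  [-5,-4,2,-1,-1,0,3,1,3,5,4,5,0,3,4,-1,1,2,2,-1,-1,-5,5,-5,-4,5,-2,0,2,3,3,-4,4,0,0,-4,-2,1,1,0,4,1,5,-2,4,2,-5,4,4,1,-3,1,1,-1,0],
  [2,-5,2,4,-5,-4,3,1,-3,2,-5,5,1,1,-5,-1,3,4,-4,2,-5,-2,1,5,5,3,2,5,1,5,5,-5,3,-4,4,-4,0,5,1,0,3,-1,-4,-1,5,4,0,5,-2,0,3,0,-4,-2,4],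
  [-3,-2,1,3,3,1,-5,4,3,3,-4,1,1,-5,3,3,5,0,1,-3,5,2,-1,1,-3,3,-2,-3,-4,-2,3,-5,-1,5,2,-1,5,3,-1,-1,-5,5,-2,3,0,-2,3,-1,1,-2,-4,3,3,2,5],
  [-2,1,-4,-2,-3,-1,0,-2,1,2,4,-3,-5,-1,0,-5,-5,1,-5,-5,4,3,3,3,-3,0,4,-5,2,5,-4,2,-3,-5,3,1,5,-3,3,3,2,-4,2,-4,-3,0,-4,-3,-1,-3,3,-4,4,4,0],
  [-5,-5,2,5,1,-5,-4,4,0,5,-4,0,4,5,-3,-5,-1,2,-3,-3,2,3,5,4,-1,2,-4,-3,4,-3,4,4,-1,4,4,-4,-5,0,-2,5,4,2,1,-5,-4,-4,0,2,5,-5,5,0,-3,-5,-5],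
  [2,-3,-5,5,4,3,1,-4,-2,-2,4,-2,2,2,-3,4,5,-3,-5,-2,5,-2,-3,5,-3,1,-2,-3,-2,2,-5,-1,-1,0,5,3,1,1,5,2,2,5,2,2,1,-5,-1,2,2,4,1,4,-1,5,-2],
  [0,-4,2,-3,1,-5,2,-4,-2,-4,1,5,-3,-5,4,5,3,5,3,1,1,1,1,-2,-2,-3,4,-2,-3,1,5,-2,-1,0,4,-2,-5,4,4,2,1,3,-4,-4,-3,5,-4,2,3,5,-5,-4,0,-3,-2],
  [0,0,0,0,0,0,0,0,0,0,0,0,0,0,0,0,0,0,0,0,0,0,0,0,0,0,0,0,0,0,0,0,0,0,0,0,1,0,0,0,0,0,0,0,0,0,0,0,0,0,0,0,0,0,0],
  [5,-3,-3,1,1,-1,2,3,2,-5,5,3,4,2,-2,4,-4,4,0,0,0,-5,3,5,-5,0,-3,0,0,4,-1,0,0,0,0,-4,-1,0,-3,-1,-1,-2,0,-2,0,1,-1,0,0,0,0,1,-3,2,-5],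
  [5,1,-3,5,1,5,1,-1,-3,-4,0,1,2,5,-4,-1,4,5,-2,-2,3,-4,-1,1,0,2,3,2,-1,-3,1,-4,-4,-5,3,5,2,-4,3,3,3,-2,5,-2,3,0,2,5,4,1,5,-1,-3,4,-5],
  [-2,0,-1,2,0,-4,-5,-5,-2,-5,4,-4,3,2,1,-1,-1,-5,5,0,4,5,0,-3,-3,-5,-1,-5,-3,2,-1,-1,1,-4,-2,0,1,2,-2,-3,-3,-4,4,3,-2,1,5,4,1,-5,-1,-2,-1,3,-4],
  [-3,0,4,-4,-2,-4,4,1,5,4,0,0,1,1,-2,3,5,-3,2,-2,-3,2,0,1,2,-2,-5,-2,1,1,-3,4,-3,5,-3,0,5,2,3,1,1,-4,-5,-1,-3,-4,2,-5,-4,1,-2,-3,4,-1,2],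
  [4,-4,2,-5,4,-2,-1,-3,4,-3,-2,-2,3,-3,-4,-2,3,0,3,-5,0,0,4,-1,-1,-3,3,-3,-4,-4,3,-5,0,2,1,2,-1,3,3,2,2,4,-2,5,1,-1,-2,-2,5,-4,-1,-5,2,3,3],
  [-2,-1,-1,5,-2,2,4,-1,-1,-2,2,-3,0,2,-2,2,-2,2,0,4,0,2,1,-2,5,0,5,0,0,-1,-3,0,3,0,0,-5,1,1,-1,-4,-4,-2,0,3,0,4,-4,0,0,-4,-5,4,-1,-3,4],
  [4,-4,2,-4,-2,4,-5,-5,-5,4,2,5,-2,2,2,-5,-5,-3,3,5,-4,0,4,-1,2,-3,-2,-3,-4,1,4,-5,3,2,1,2,4,-5,1,2,2,-1,-2,5,1,-1,-2,-2,5,-4,0,-5,2,3,5],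
  [0,0,0,0,0,0,0,0,0,0,0,0,0,0,0,0,0,0,0,0,0,0,0,0,0,0,0,0,0,0,0,0,0,0,0,0,0,1,0,0,0,0,0,0,0,0,0,0,0,0,0,0,0,0,0],
  [0,0,0,0,0,0,0,0,0,0,0,0,0,0,0,0,0,0,0,0,0,0,0,0,0,0,0,0,0,0,0,0,0,0,0,0,0,0,-4,0,0,0,0,0,0,0,0,0,0,0,0,0,0,0,0],
  [5,-1,-1,-5,-1,-3,2,0,5,5,2,0,1,-4,0,-5,2,5,-2,4,-1,1,3,3,-4,-1,-4,-2,-3,0,-5,1,-4,5,-3,0,4,2,1,0,4,4,0,-2,2,3,4,-1,-1,-3,1,-4,-4,1,4],
  [4,-3,-3,-4,-3,2,-5,0,4,4,-5,0,3,-1,0,-4,-5,4,5,1,-3,1,-5,-2,-1,-3,-1,5,2,0,-4,3,-1,4,2,0,1,-5,3,4,-1,5,0,5,-5,-2,1,-3,-3,2,3,-5,-4,-1,1],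
  [-4,3,3,4,3,-2,5,0,-4,-4,5,0,-3,1,0,4,5,-4,-5,-1,3,3,5,5,1,3,1,-5,-2,0,4,-3,1,-4,-2,0,-1,5,-3,1,-1,2,0,-5,5,2,-1,3,3,-2,-3,0,-4,2,-1],
  [0,0,0,0,0,0,0,0,0,0,0,0,0,0,0,0,0,0,0,0,0,-2,0,-4,0,0,0,0,0,0,0,0,0,0,0,0,0,0,0,-1,2,-1,0,0,0,0,0,0,0,0,0,-3,2,5,0],
  [-3,5,5,3,5,4,1,0,-3,-3,1,0,-5,-2,0,3,1,-3,-1,2,5,-4,-3,1,-2,5,-2,-1,4,0,3,-5,-2,-3,4,0,2,1,-5,0,-5,0,0,-1,1,-4,2,5,5,4,-5,3,0,3,2],
  [5,-1,-1,-5,-1,-3,2,0,5,5,2,0,1,-4,0,-5,2,5,-2,4,-1,2,4,4,-4,-1,-4,-2,-3,0,-5,1,-4,5,-3,0,4,2,1,2,3,2,0,-2,2,3,4,-1,-1,-3,1,-1,5,2,4],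
  [4,-3,-3,-4,-3,2,-5,0,4,4,-5,0,3,-1,0,-4,-5,4,5,1,-3,-1,-4,4,-1,-3,-1,5,2,0,-4,3,-1,4,2,0,1,-5,3,4,2,-5,0,5,-5,-2,1,-3,-3,2,3,3,-2,3,1],
  [0,0,0,0,0,0,0,0,0,0,0,0,0,0,0,0,0,0,0,0,0,0,0,0,0,0,0,0,0,0,0,0,0,0,0,0,0,0,0,1,0,0,0,0,0,0,0,0,0,0,0,0,0,0,0],
  [0,0,0,0,0,0,0,0,0,0,0,0,0,0,0,0,0,0,0,0,0,0,0,0,0,0,0,0,0,0,0,0,0,0,0,0,0,0,0,0,-4,0,0,0,0,0,0,0,0,0,0,0,0,0,0],
  [0,0,0,0,0,0,0,0,0,0,0,0,0,0,0,0,0,0,0,0,0,0,0,0,0,0,0,0,0,0,0,0,0,0,0,0,0,0,0,0,0,4,0,0,0,0,0,0,0,0,0,0,0,0,0]]"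

definition inverse2 :: "int list list" where
  "inverse2 = [[-2,5,0,1,4,-5,0,-3,1,5,5,-4,-3,5,-2,5,2,5,-1,0,-2,2,5,1,0,2,-4,-3,1,3,-4,-5,5,-2,-1,3,2,-5,2,2,-4,1,5,0,1,-5,1,-5,-2,3,4,-5,5,0,0],
  [0,0,0,0,0,0,0,0,0,0,0,0,0,0,0,0,0,0,0,0,0,0,0,0,0,0,0,0,0,0,0,0,0,0,0,0,0,0,0,0,0,0,0,0,0,0,0,0,0,0,0,0,0,0,1],
  [-5,-4,0,-3,-1,4,0,-2,-3,-4,-4,1,-2,-4,-5,-4,5,-4,3,0,-5,5,-4,-3,4,5,-2,-2,-3,5,-5,4,0,-5,3,2,-3,4,0,5,1,5,-4,0,-3,4,-3,4,-5,2,-1,4,-4,0,0],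
  [-5,3,-1,-2,-1,-3,-4,-3,-3,2,4,-4,-4,-5,-5,4,-1,2,3,-5,2,-1,-4,4,2,2,-3,-2,5,-1,-2,0,-1,-2,4,5,-4,4,1,2,-5,1,3,4,-4,4,2,4,-1,4,-5,2,-1,1,4],
  [-2,-3,-2,4,5,-1,-2,3,-4,-2,-5,3,3,-1,-5,0,-2,1,-4,1,-5,2,2,2,3,1,1,-1,3,1,0,0,4,-2,-1,5,0,4,1,1,-1,-5,3,3,2,-2,0,-3,-2,-2,3,1,1,5,3],
  [-3,2,0,-4,-5,-2,0,1,-4,2,2,5,1,2,-3,2,3,2,4,0,-3,3,2,-4,-1,3,-1,1,-4,0,3,-2,5,-3,4,-5,5,-2,-5,3,5,-1,2,0,-4,-2,-4,-2,-3,-1,-5,-2,2,0,0],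
  [-2,4,-2,0,4,3,0,0,-3,5,-4,3,3,-4,-4,1,-1,4,2,-1,4,5,5,-3,5,-3,-5,-4,-1,2,0,-1,1,-1,-4,4,-2,3,0,-1,1,-5,-4,-1,-2,2,-3,-4,-4,1,5,-4,0,-4,-2],
  [2,-3,-3,-3,-3,2,-1,1,0,-5,2,5,1,-3,0,4,-4,0,-3,0,-3,-1,-2,1,4,5,-4,3,-1,5,5,-1,5,-5,-1,5,2,-1,1,0,-2,3,1,-5,0,1,3,1,4,0,-2,4,5,5,4],
  [4,-2,2,-5,2,-5,2,0,3,-3,0,1,-1,-1,0,-5,-3,-2,5,-1,-4,-4,4,-3,-4,4,5,4,4,2,4,-2,-1,4,5,-3,2,5,3,-3,-3,1,-4,0,-4,-1,-1,-2,-2,0,0,-1,-1,4,5],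
  [-4,-1,0,2,-3,1,0,5,2,-1,-1,3,5,-1,-4,-1,4,-1,-2,0,-4,4,-1,2,-4,4,2,5,2,-5,-1,1,2,-4,-2,-3,3,1,5,4,3,0,-1,0,2,1,2,1,-4,-5,-3,1,-1,0,0],
  [-4,1,2,5,1,-5,5,-4,0,5,5,4,5,-5,-5,5,3,5,-4,0,2,-2,-4,4,-5,-4,-5,2,-5,-1,1,0,4,-4,-5,-5,1,-2,-4,0,0,3,5,4,-4,2,-4,-5,1,3,-5,2,-5,4,4],
  [4,5,-2,2,-4,-3,4,-1,0,-5,0,-4,-1,3,2,2,5,0,2,2,0,3,-1,3,-1,4,2,1,0,-1,-5,-5,3,-3,-5,-4,0,5,-1,-5,-4,-3,-4,4,-1,4,2,-4,-4,-1,-1,4,5,-5,-5],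
  [0,-3,1,-4,5,4,3,2,-1,4,4,0,-1,3,5,-4,5,-5,1,0,4,5,-2,-3,1,-3,0,-5,-3,3,1,-2,2,1,-5,-2,-4,-4,2,-3,4,1,-2,-1,3,1,-3,-5,-4,4,3,0,-3,-4,0],
  [0,5,4,5,-2,3,4,-1,-1,3,-2,-3,1,-5,-2,-1,3,0,-5,-2,-5,0,-5,-2,-4,0,-3,-4,3,3,3,3,-3,0,-5,-3,-4,0,1,2,-3,-4,-4,-1,0,-1,2,5,1,-3,-1,-2,-2,5,4],
  [-4,-1,0,2,-3,1,0,5,2,-1,-1,3,5,-1,-4,-1,4,-1,-2,0,-4,4,-1,2,1,4,0,5,2,2,-4,1,-5,-4,-2,-5,-1,1,-2,4,3,-5,-1,0,2,1,2,1,-4,-5,-3,1,-1,0,0],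
  [-2,-2,-2,0,3,-2,0,-3,2,-4,2,3,5,-2,5,2,-5,4,4,5,1,-1,1,3,0,-2,-2,5,-1,-1,5,-1,3,0,-4,1,0,-5,3,3,2,5,0,3,2,2,0,-4,5,-3,2,1,-5,1,4],
  [-3,-3,-1,4,0,-3,-5,-1,2,-3,4,0,-2,-2,-2,4,4,1,1,5,5,-3,2,3,4,1,4,3,3,-4,-1,0,-4,5,5,0,3,-5,4,-5,1,-5,0,-1,-5,-3,1,0,-2,5,5,-2,-5,-5,3],
  [-5,-5,1,4,-3,0,-4,3,-2,-5,1,-3,3,0,4,2,-2,1,-1,-5,0,2,0,4,-5,3,-5,-4,1,0,-2,-4,-5,0,4,-2,-4,0,-1,-2,-5,0,3,-3,0,4,-4,5,0,4,4,2,4,3,-3],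
  [2,-3,0,-1,0,-5,-2,5,-5,2,1,3,-2,-1,0,-1,5,-3,1,4,-1,0,-5,2,-1,0,-4,-5,5,3,-1,-1,4,3,-1,5,3,-1,-4,3,1,5,3,-1,1,2,2,-1,-1,4,2,4,1,1,3],
  [-2,-3,-2,4,5,-1,-2,3,-4,-2,-5,3,3,-1,-5,0,-2,1,-4,1,-5,2,2,2,3,4,1,-1,1,1,0,1,4,-2,2,5,0,-4,1,1,-2,-5,3,3,2,-2,0,-3,-2,-2,3,1,1,5,-3],
  [-4,-1,0,2,-3,1,0,5,2,-1,-1,3,5,-1,-4,-1,4,-1,-2,0,-4,4,-1,2,-3,4,-4,5,2,2,5,1,0,-4,-2,-1,-1,1,3,4,3,2,-1,0,2,1,2,1,-4,-5,-3,1,-1,0,0],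
  [3,2,2,-2,-2,-5,4,-3,-2,4,5,3,0,5,5,0,2,-5,-5,-1,-3,5,4,5,-5,2,4,2,2,-1,-1,1,1,4,0,1,-2,4,-1,3,-5,-3,5,-5,0,-3,-3,5,-4,0,-2,2,-3,4,4],
  [-3,-2,-4,1,-5,-2,1,1,1,0,-2,-2,-2,-2,-3,4,1,-3,4,1,-2,0,4,-3,1,4,-3,3,-3,3,-5,3,2,-5,2,-4,-1,4,-4,-3,5,5,5,-3,5,3,0,-3,-4,-1,3,-2,-5,3,-5],
  [2,2,-1,0,1,2,-4,5,-5,4,-3,5,3,-3,1,2,-3,-4,2,4,-2,4,-3,-4,4,-2,0,2,4,-5,3,-2,3,-2,-5,-1,-4,1,2,3,-5,2,-4,-2,3,-4,5,0,-5,5,1,-3,2,4,-1],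
  [-5,3,0,5,-5,5,1,0,-4,4,3,-1,0,-1,-1,-3,-4,-1,4,-5,-1,3,-3,3,4,1,-5,5,-1,-2,-3,2,2,0,0,-5,-3,1,-1,5,1,2,-4,1,-5,2,-5,-4,5,5,3,1,-5,4,-1],
  [2,1,2,0,-5,3,2,4,-2,-2,2,-5,0,-2,-5,5,4,-2,-3,-1,3,-2,3,2,-5,-4,0,-5,-4,-4,4,5,-4,1,4,3,2,5,-3,2,-4,2,-2,5,-2,1,-1,0,-3,-1,4,2,1,0,-1],
  [5,5,3,4,5,1,3,4,5,-2,-3,5,3,5,-3,-5,-2,3,-4,4,4,-5,3,-4,0,-2,-1,-1,-1,-4,4,-3,-3,5,-1,0,2,3,-3,2,2,-2,0,4,-5,0,-1,5,-1,1,4,4,4,-4,-3],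
  [3,-2,0,4,5,2,0,-1,4,-2,-2,-5,-1,-2,3,-2,-3,-2,-4,0,3,-3,-2,4,3,-3,-4,-1,4,1,-2,2,0,3,-4,-5,3,2,-4,-3,-5,-1,-2,0,4,2,4,2,3,1,5,2,-2,0,0],
  [5,3,-3,1,3,1,-5,-2,2,0,1,-5,-2,3,4,1,5,4,-2,-5,2,-5,-5,3,-2,-1,-4,2,-4,1,3,-4,2,1,1,-1,2,2,1,4,4,-2,0,-3,-2,-3,2,-5,-1,2,-2,-3,-1,0,-2],
  [-2,-3,-5,1,3,-5,0,-4,-1,-5,5,-2,4,-2,-2,5,4,-4,-5,5,-1,2,2,-2,-5,-3,-3,-3,0,-1,-2,3,5,4,1,-3,-4,-3,-1,3,5,5,1,4,-3,4,1,2,5,3,5,3,1,2,5],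
  [-4,-5,3,2,-1,2,1,-1,4,1,2,-3,-1,-1,-3,1,0,-1,-2,-3,-3,-4,-4,-3,2,-3,0,-1,-2,-2,1,-4,-1,0,2,5,-5,5,-3,-3,-1,1,2,-5,-2,2,4,3,0,-4,4,2,5,-4,-3],
  [5,-3,-5,-4,-2,0,0,0,-3,2,-1,-2,-1,-1,3,0,1,-1,2,3,-4,-4,5,5,-4,-1,4,0,-3,3,1,-4,5,-1,-1,4,0,2,2,0,3,0,1,2,-5,3,-3,-1,1,3,-5,-4,5,-4,3],
  [-4,-2,-3,-4,-2,-4,0,-4,4,1,0,3,-2,2,-5,2,4,4,3,-3,-1,-4,4,-3,-5,-3,-5,-4,0,-2,4,-1,-5,-3,-3,2,0,0,4,-2,1,-3,-3,-5,-3,-3,-3,1,-5,3,-1,-2,-1,-3,-2],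
  [0,1,-3,-5,-4,5,-1,4,-2,0,1,-1,-2,-3,0,-5,-4,-2,2,0,5,4,-4,-3,-3,-3,-2,0,3,0,3,-5,-5,-1,-2,5,0,-5,4,1,5,4,4,0,4,1,2,2,-3,5,3,1,-1,0,-2],
  [0,-2,5,-2,3,1,5,-4,-4,1,3,-1,4,2,3,-4,1,0,2,3,2,0,2,3,-5,3,-1,-5,-5,1,1,4,-1,0,2,-1,-5,-1,4,-3,5,-5,-5,-4,0,-4,-3,-2,4,-1,-4,3,3,-2,1],
  [0,0,0,0,0,0,0,0,0,0,0,0,0,0,0,0,0,0,0,0,0,0,0,0,0,0,0,0,0,0,0,0,0,0,0,0,1,0,0,0,0,0,0,0,0,0,0,0,0,0,0,0,0,0,0],
  [3,-5,3,0,0,2,-5,2,4,2,-3,5,0,-5,2,-5,0,2,0,3,-2,5,-3,5,-3,-2,-2,0,1,-5,4,1,4,-4,1,-5,2,1,-4,-1,0,1,-2,-1,-1,-5,-2,0,1,3,1,5,-1,4,-4],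
  [0,-1,0,4,-4,4,4,-3,-5,-3,0,-2,-3,0,5,4,2,3,-2,-2,3,3,-4,-5,-5,0,-1,0,-1,3,3,-4,2,2,-1,1,-2,-5,4,5,5,4,-3,1,-1,3,0,0,-3,2,2,3,-5,-5,-2],
  [0,5,2,0,0,4,-2,3,5,-3,-4,4,-1,-5,-5,1,5,-3,3,-2,5,-4,-1,5,3,-2,-3,5,2,-4,3,3,-5,1,-2,-2,5,3,-4,3,-5,4,-3,1,-3,1,2,-4,1,2,1,5,5,4,-2],
  [4,3,-3,5,-5,1,-2,4,-1,3,-1,3,-3,-2,-2,4,-4,5,-2,-2,0,-4,0,4,4,-3,2,-1,5,1,5,-5,-4,1,-3,-3,1,5,-2,-1,-1,-4,5,1,-4,0,5,3,-5,1,-5,3,-4,-3,1],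
  [-5,-5,0,-3,3,0,4,0,5,-4,-5,5,-3,5,-4,-5,0,-3,-2,-4,4,-5,0,-4,-3,2,3,-4,5,-3,5,-4,5,4,-5,-2,-4,0,-2,-1,3,-2,-1,-3,5,4,1,1,4,5,0,1,-5,-3,5],
  [2,5,5,4,-4,4,5,1,-4,3,3,0,1,2,-3,4,4,-2,-3,3,2,4,-2,4,3,3,-5,2,-1,1,1,3,-1,-1,4,2,5,4,0,-4,3,-4,4,0,3,3,-2,5,1,4,3,1,0,0,-4],
  [-4,-2,4,1,-1,-4,-4,4,-4,2,-1,-4,-2,5,-4,-3,4,-2,-5,4,-1,1,-1,2,1,2,-5,-2,0,-4,1,-5,-1,-3,-5,-2,4,2,1,-1,-5,1,0,1,1,5,-4,-5,1,1,5,4,-1,3,-5],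
  [0,0,0,0,0,0,0,0,0,0,0,0,0,0,0,0,0,0,0,0,0,0,0,0,0,0,0,0,0,0,0,0,0,0,0,0,0,1,0,0,0,0,0,0,0,0,0,0,0,0,0,0,0,0,0],
  [0,0,0,0,0,0,0,0,0,0,0,0,0,0,0,0,0,0,0,0,0,0,0,0,0,0,0,0,0,0,0,0,0,0,0,0,0,0,-4,0,0,0,0,0,0,0,0,0,0,0,0,0,0,0,0],
  [-4,-2,1,1,4,5,5,4,3,1,5,1,-3,2,-3,2,2,4,-1,4,-1,0,-1,4,-2,3,0,-3,-5,0,4,0,-2,0,4,-1,-3,0,4,-4,2,-2,0,3,4,-4,-5,-1,3,-4,-2,-1,-2,-1,2],
  [-1,5,3,3,1,4,4,1,-2,3,4,3,2,-5,2,-5,-5,1,-3,1,-3,-2,5,1,5,-2,0,2,-4,0,1,0,5,0,1,-3,2,0,1,3,4,-2,0,-2,1,-1,-4,-3,-2,-1,5,4,2,4,-5],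
  [1,-5,-3,-3,-1,-4,-4,-1,2,-3,-4,-3,-2,5,-2,5,5,-1,3,-1,3,-5,-5,2,-5,2,0,-2,4,0,-1,0,-5,0,-1,3,-2,0,-1,2,5,-2,0,2,-1,1,4,3,2,1,-5,2,1,-3,5],
  [0,0,0,0,0,0,0,0,0,0,0,0,0,0,0,0,0,0,0,0,0,-2,0,-4,0,0,0,0,0,0,0,0,0,0,0,0,0,0,0,-1,2,-1,0,0,0,0,0,0,0,0,0,-3,2,5,0],
  [-2,-1,-5,-5,2,-3,-3,2,-4,-5,-3,-5,4,1,4,1,1,2,5,2,5,1,-5,-4,-1,-4,0,4,3,0,2,0,-1,0,2,5,4,0,2,-2,5,-3,0,-4,2,-2,3,5,-4,-2,-1,-1,1,2,1],
  [-4,-2,1,1,4,5,5,4,3,1,5,1,-3,2,-3,2,2,4,-1,4,-1,1,0,5,-2,3,0,-3,-5,0,4,0,-2,0,4,-1,-3,0,4,-2,1,-4,0,3,4,-4,-5,-1,3,-4,-2,2,-4,0,2],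
  [-1,5,3,3,1,4,4,1,-2,3,4,3,2,-5,2,-5,-5,1,-3,1,-3,-4,-5,-4,5,-2,0,2,-4,0,1,0,5,0,1,-3,2,0,1,3,-4,-1,0,-2,1,-1,-4,-3,-2,-1,5,1,4,-3,-5],
  [0,0,0,0,0,0,0,0,0,0,0,0,0,0,0,0,0,0,0,0,0,0,0,0,0,0,0,0,0,0,0,0,0,0,0,0,0,0,0,1,0,0,0,0,0,0,0,0,0,0,0,0,0,0,0],
  [0,0,0,0,0,0,0,0,0,0,0,0,0,0,0,0,0,0,0,0,0,0,0,0,0,0,0,0,0,0,0,0,0,0,0,0,0,0,0,0,-4,0,0,0,0,0,0,0,0,0,0,0,0,0,0],
  [0,0,0,0,0,0,0,0,0,0,0,0,0,0,0,0,0,0,0,0,0,0,0,0,0,0,0,0,0,0,0,0,0,0,0,0,0,0,0,0,0,4,0,0,0,0,0,0,0,0,0,0,0,0,0]]"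

definition inverse3 :: "int list list" where
  "inverse3 = [[3,2,-3,-2,1,3,-5,3,0,0,-2,5,3,5,3,0,5,0],
  [0,3,2,-3,-2,1,3,-5,3,0,0,-2,5,3,5,3,0,5],
  [0,4,-3,5,2,3,-5,-5,1,-5,-4,-5,1,0,0,-4,3,-2],
  [0,5,2,-2,3,0,1,-4,-3,2,1,-2,-4,3,-1,-3,-4,-5],
  [0,-4,0,-1,4,-2,-5,-2,1,5,-5,-5,-5,1,-5,-3,-3,-2],
  [0,5,5,1,-3,2,-4,-4,0,2,0,-3,-4,-3,0,3,-3,0],
  [0,0,5,5,1,-3,2,-4,-4,0,2,0,-3,-4,-3,0,3,-3],
  [0,2,-3,1,2,-2,5,-2,-1,3,-2,5,-4,0,0,-2,0,2],
  [0,-5,4,-4,3,4,0,4,-4,-2,-3,-4,4,5,1,3,-2,-3],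
  [0,2,3,0,4,0,1,-4,-4,3,-4,0,3,-4,-2,2,3,-3],
  [0,2,-1,-1,-3,1,-3,-3,-1,3,1,-1,-4,-5,0,-1,2,2],
  [0,-5,4,-2,1,-1,3,-4,-5,-2,-3,-1,-2,5,-4,3,-1,-1],
  [0,-3,5,-1,-3,0,-2,-2,-3,1,1,-2,5,-1,-1,0,3,-5],
  [0,-4,3,2,5,3,-5,-5,3,5,5,-5,-5,-1,2,-3,0,5],
  [0,4,1,-5,-4,-1,-3,-2,1,-5,1,0,-2,1,-4,4,-3,-2],
  [0,5,2,2,4,5,-3,-2,0,2,1,3,1,0,0,4,4,0],
  [0,0,5,2,2,4,5,-3,-2,0,2,1,3,1,0,0,4,4],
  [0,1,4,3,-5,-5,-3,3,4,-4,-1,-2,-1,-1,3,-5,0,-2]]"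

section \<open>Executable check of the certificates\<close>

definition bin2 :: "nat \<Rightarrow> nat \<Rightarrow> int" where
  "bin2 a b = (if b = 0 then 1 else if b = 1 then int a else int a * (int a - 1) div 2)"

fun hasse2 :: "nat \<times> nat \<times> nat \<Rightarrow> nat \<times> nat \<times> nat \<Rightarrow> int \<times> int \<times> int \<Rightarrow> int" where
  "hasse2 (b1, b2, b3) (a1, a2, a3) (x, y, z) =
     (let c = bin2 a1 b1 * bin2 a2 b2 * bin2 a3 b3
      in if c = 0 then 0 else c * x ^ (a1 - b1) * y ^ (a2 - b2) * z ^ (a3 - b3))"

text \<open>The border normalises the kernel vector to have entry 1 at position 1. Position 0 would
  not do for \<open>points'\<close>: the first row of \<open>inverse2\<close> ends in 0, so that
  entry of the kernel vector vanishes modulo 11.\<close>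

definition system_rows :: "(int \<times> int \<times> int) list \<Rightarrow> int list list" where
  "system_rows P = map (\<lambda>(k, b). map (\<lambda>a. hasse2 b a (P ! k) mod 11) exps) conds
     @ [map (\<lambda>j. if j = 1 then 1 else 0) [0..<55]]"

fun add_multiple :: "int \<Rightarrow> int list \<Rightarrow> int list \<Rightarrow> int list" where
  "add_multiple c (x # xs) (y # ys) = (if y = 0 then x else x + c * y) # add_multiple c xs ys"
| "add_multiple c xs ys = []"

fun combination :: "int list \<Rightarrow> int list list \<Rightarrow> int list \<Rightarrow> int list" where
  "combination (c # cs) (r # rs) acc = combination cs rs (if c = 0 then acc else add_multiple c acc r)"
| "combination cs rs acc = acc"

fun inverse_check :: "nat \<Rightarrow> int list list \<Rightarrow> int list list \<Rightarrow> nat \<Rightarrow> bool" where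
  "inverse_check m (b # bs) R n \<longleftrightarrow> length b = m \<and>
     map (\<lambda>x. x mod 11) (combination b R (replicate m 0)) = map (\<lambda>j. if j = n then 1 else 0) [0..<m]
     \<and> inverse_check m bs R (Suc n)"
| "inverse_check m [] R n \<longleftrightarrow> True"

text \<open>Only the entries of the kernel vector at monomials without third variable, that is, the
  restriction of the nonic to the line at infinity.\<close>

definition last_column :: "int list list \<Rightarrow> int list" where
  "last_column B = map (\<lambda>k. B ! line_idx k ! 54) [0..<10]"

definition sylvester_rows :: "int list \<Rightarrow> int list \<Rightarrow> int list list" where
  "sylvester_rows b b' = map (\<lambda>i. map (\<lambda>j. if i < 9 then (if i \<le> j \<and> j \<le> i + 9 then b ! (j - i) else 0)
     else (if i - 9 \<le> j \<and> j \<le> i then b' ! (j - (i - 9)) else 0)) [0..<18]) [0..<18]"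

lemma inverse_check1: "length inverse1 = 55 \<and> inverse_check 55 inverse1 (system_rows points) 0"
  by code_simp

lemma inverse_check2: "length inverse2 = 55 \<and> inverse_check 55 inverse2 (system_rows points') 0"
  by code_simp

lemma inverse_check3:
  "length inverse3 = 18 \<and> (\<forall>r\<in>set inverse3. length r = 18) \<and>
   inverse_check 18 (sylvester_rows (last_column inverse1) (last_column inverse2)) inverse3 0"
  by code_simp

lemma length_add_multiple: "length xs = length ys \<Longrightarrow> length (add_multiple c xs ys) = length ys"
  by (induction c xs ys rule: add_multiple.induct) auto

lemma nth_add_multiple:
  "length xs = length ys \<Longrightarrow> j < length ys \<Longrightarrow> add_multiple c xs ys ! j = xs ! j + c * ys ! j"
proof (induction c xs ys arbitrary: j rule: add_multiple.induct)
  case (1 c x xs y ys)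
  then show ?case by (cases j) auto
qed auto

lemma nth_combination:
  "length acc = m \<Longrightarrow> (\<forall>r\<in>set rs. length r = m) \<Longrightarrow> length cs = length rs \<Longrightarrow> j < m \<Longrightarrow>
    combination cs rs acc ! j = acc ! j + (\<Sum>k<length rs. cs ! k * rs ! k ! j)"
proof (induction cs rs acc rule: combination.induct)
  case (1 c cs r rs acc)
  define acc' where "acc' = (if c = 0 then acc else add_multiple c acc r)"
  have l: "length acc' = m" using 1 by (simp add: acc'_def length_add_multiple)
  have a: "acc' ! j = acc ! j + c * r ! j" using 1 by (simp add: acc'_def nth_add_multiple)
  have "combination cs rs acc' ! j = acc' ! j + (\<Sum>k<length rs. cs ! k * rs ! k ! j)"
    using 1 l unfolding acc'_def by simp
  moreover have "(\<Sum>k<length (r # rs). (c # cs) ! k * (r # rs) ! k ! j) = c * r ! j + (\<Sum>k<length rs. cs ! k * rs ! k ! j)"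
    by (simp add: sum.lessThan_Suc_shift del: sum.lessThan_Suc)
  ultimately show ?case using a unfolding combination.simps acc'_def[symmetric] by simp
qed auto

lemma length_combination:
  "length acc = m \<Longrightarrow> (\<forall>r\<in>set rs. length r = m) \<Longrightarrow> length (combination cs rs acc) = m"
  by (induction cs rs acc rule: combination.induct) (auto simp: length_add_multiple)

lemma inverse_checkD:
  assumes "inverse_check m B R n" "length R = m" "\<forall>r\<in>set R. length r = m" "a < length B" "j < m"
  shows "(\<Sum>k<m. B ! a ! k * R ! k ! j) mod 11 = (if j = n + a then 1 else 0)"
  using assms(1,4)
proof (induction B arbitrary: n a)
  case (Cons b B)
  show ?case
  proof (cases a)
    case 0
    have lb: "length b = length R" using Cons.prems(1) assms(2) by simp
    have "map (\<lambda>x. x mod 11) (combination b R (replicate m 0)) ! j = map (\<lambda>j. if j = n then 1 else 0) [0..<m] ! j"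
      using Cons.prems(1) by (simp only: inverse_check.simps)
    moreover have "length (combination b R (replicate m 0)) = m" by (rule length_combination) (use assms(3) in auto)
    ultimately have "combination b R (replicate m 0) ! j mod 11 = (if j = n then 1 else 0)"
      using assms(5) by simp
    moreover have "combination b R (replicate m 0) ! j = (\<Sum>k<m. b ! k * R ! k ! j)"
      using nth_combination[OF _ assms(3) lb assms(5), of "replicate m 0"] assms(2,5) by simp
    ultimately show ?thesis using 0 by simp
  next
    case (Suc a')
    then show ?thesis using Cons.IH[of "Suc n" a'] Cons.prems by simp
  qed
qed simp

lemma bin2_eq: "b \<le> 2 \<Longrightarrow> bin2 a b = int (a choose b)"
proof -
  assume "b \<le> 2"
  then consider "b = 0" | "b = 1" | "b = 2" by linarith
  then show ?thesis
  proof cases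
    case 3
    have "int (a * (a - 1)) = int a * (int a - 1)" by (cases a) (simp_all add: algebra_simps)
    then have "int (a * (a - 1) div 2) = int a * (int a - 1) div 2" by (simp only: zdiv_int of_nat_numeral)
    then show ?thesis unfolding 3 choose_two by (simp add: bin2_def)
  qed (simp_all add: bin2_def)
qed

lemma hasse2_eq: "b1 \<le> 2 \<Longrightarrow> b2 \<le> 2 \<Longrightarrow> b3 \<le> 2 \<Longrightarrow> hasse2 (b1, b2, b3) a t = hasse (b1, b2, b3) a t"
  by (cases a; cases t) (simp add: bin2_eq Let_def)

lemma conds_small: "\<forall>(k, b1, b2, b3)\<in>set conds. k < 10 \<and> b1 \<le> 2 \<and> b2 \<le> 2 \<and> b3 \<le> 2"
  by code_simp

lemma conds_nth:
  assumes "a < 54"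
  obtains k b1 b2 b3 where "conds ! a = (k, b1, b2, b3)" "k < 10" "b1 \<le> 2" "b2 \<le> 2" "b3 \<le> 2"
proof -
  have "conds ! a \<in> set conds" using assms length_conds by simp
  moreover obtain k b1 b2 b3 where "conds ! a = (k, b1, b2, b3)" by (metis prod_cases4)
  ultimately show ?thesis using conds_small that by fastforce
qed

lemma system_rows_length: "length (system_rows P) = 55" "\<forall>r\<in>set (system_rows P). length r = 55"
  by (auto simp: system_rows_def length_conds length_exps)

lemma system_rows_nth:
  assumes "a < 54" "j < 55"
  shows "system_rows P ! a ! j = condrow (\<lambda>k. P ! k) a j mod 11"
proof -
  obtain k b1 b2 b3 where c: "conds ! a = (k, b1, b2, b3)" "b1 \<le> 2" "b2 \<le> 2" "b3 \<le> 2"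
    using conds_nth[OF assms(1)] by metis
  then show ?thesis
    using assms by (simp add: system_rows_def nth_append length_conds length_exps condrow_def hasse2_eq)
qed

lemma system_rows_last: "j < 55 \<Longrightarrow> system_rows P ! 54 ! j = (if j = 1 then 1 else 0)"
  by (simp add: system_rows_def nth_append length_conds)

lemma det_mat_sum:
  "Determinant.det (mat n n (\<lambda>(a, b). f a b)) = (\<Sum>p\<in>{p. p permutes {0..<n}}. signof p * (\<Prod>a\<in>{0..<n}. f a (p a)))"
proof -
  have "(\<Prod>a\<in>{0..<n}. mat n n (\<lambda>(a, b). f a b) $$ (a, p a)) = (\<Prod>a\<in>{0..<n}. f a (p a))"
    if "p permutes {0..<n}" for p
    using permutes_in_image[OF that] by (intro prod.cong) auto
  then show ?thesis unfolding Determinant.det_def by (auto intro!: sum.cong)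
qed

lemma det_cong:
  fixes f g :: "nat \<Rightarrow> nat \<Rightarrow> int"
  assumes "\<And>a b. a < n \<Longrightarrow> b < n \<Longrightarrow> [f a b = g a b] (mod m)"
  shows "[Determinant.det (mat n n (\<lambda>(a, b). f a b)) = Determinant.det (mat n n (\<lambda>(a, b). g a b))] (mod m)"
  unfolding det_mat_sum
proof (intro cong_sum cong_mult cong_refl cong_prod assms)
  show "p a < n" if "p \<in> {p. p permutes {0..<n}}" "a \<in> {0..<n}" for p a
    using that permutes_in_image by fastforce
qed auto

text \<open>An explicit inverse shows by one matrix product that a determinant is a unit modulo
  \<open>m\<close>, and no large determinant is ever evaluated.\<close>

lemma det_inverse_mod:
  fixes f g :: "nat \<Rightarrow> nat \<Rightarrow> int"
  assumes "\<And>a b. a < n \<Longrightarrow> b < n \<Longrightarrow> [(\<Sum>k<n. f a k * g k b) = (if b = a then 1 else 0)] (mod m)"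
  shows "[Determinant.det (mat n n (\<lambda>(a, b). f a b)) * Determinant.det (mat n n (\<lambda>(a, b). g a b)) = 1] (mod m)"
proof -
  have "mat n n (\<lambda>(a, b). f a b) * mat n n (\<lambda>(a, b). g a b) = mat n n (\<lambda>(a, b). \<Sum>k<n. f a k * g k b)"
    by (rule eq_matI) (auto simp: scalar_prod_def atLeast0LessThan)
  then have "Determinant.det (mat n n (\<lambda>(a, b). f a b)) * Determinant.det (mat n n (\<lambda>(a, b). g a b))
      = Determinant.det (mat n n (\<lambda>(a, b). \<Sum>k<n. f a k * g k b))"
    by (subst Determinant.det_mult[symmetric, of _ n]) auto
  moreover have "[Determinant.det (mat n n (\<lambda>(a, b). \<Sum>k<n. f a k * g k b))
      = Determinant.det (mat n n (\<lambda>(a, b). if b = a then 1 else 0))] (mod m)"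
    by (rule det_cong) (rule assms)
  moreover have "mat n n (\<lambda>(a, b). if b = a then 1 else 0 :: int) = 1\<^sub>m n"
    by (rule eq_matI) auto
  ultimately show ?thesis by simp
qed

text \<open>The Cramer coordinate \<open>c 1\<close> is the determinant of the bordered matrix
  \<open>N\<close> itself, so it is a unit modulo 11. Moreover \<open>N\<close> maps
  \<open>c\<close> to \<open>c 1\<close> times the last unit vector; multiplying by the inverse
  \<open>B\<close> shows that \<open>c\<close> is \<open>c 1\<close> times the last column of
  \<open>B\<close>.\<close>

lemma coef_certificate:
  assumes B: "length B = 55" "inverse_check 55 B (system_rows P) 0"
  shows "\<not> 11 dvd coef (\<lambda>k. P ! k) 1"
    and "a < 55 \<Longrightarrow> [coef (\<lambda>k. P ! k) a = coef (\<lambda>k. P ! k) 1 * B ! a ! 54] (mod 11)"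
proof -
  define f where "f = condrow (\<lambda>k. P ! k)"
  define N where "N k j = (if k < 54 then f k j else if j = 1 then 1 else 0)" for k j
  have NR: "[N k j = system_rows P ! k ! j] (mod 11)" if "k < 55" "j < 55" for k j
  proof (cases "k < 54")
    case True
    then show ?thesis using system_rows_nth[OF True that(2)] by (simp add: N_def f_def cong_def)
  next
    case False
    then have "k = 54" using that by simp
    then show ?thesis using system_rows_last[OF that(2)] by (simp add: N_def)
  qed
  have inv: "[(\<Sum>k<55. B ! a ! k * N k j) = (if j = a then 1 else 0)] (mod 11)" if "a < 55" "j < 55" for a j
  proof -
    have "[(\<Sum>k<55. B ! a ! k * N k j) = (\<Sum>k<55. B ! a ! k * system_rows P ! k ! j)] (mod 11)"
      using NR that(2) by (intro cong_sum cong_mult cong_refl) auto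
    moreover have "(\<Sum>k<55. B ! a ! k * system_rows P ! k ! j) mod 11 = (if j = a then 1 else 0)"
      using inverse_checkD[OF B(2) system_rows_length, of a j] B(1) that by simp
    ultimately show ?thesis by (simp add: cong_def)
  qed
  define c where "c = coef (\<lambda>k. P ! k)"
  have c1: "c 1 = Determinant.det (mat 55 55 (\<lambda>(a, b). N a b))"
    unfolding c_def coef_def cramer_def bordered_def N_def f_def by simp
  have d: "[Determinant.det (mat 55 55 (\<lambda>(a, b). B ! a ! b)) * c 1 = 1] (mod 11)"
    unfolding c1 by (rule det_inverse_mod) (rule inv)
  show "\<not> 11 dvd coef (\<lambda>k. P ! k) 1"
  proof
    assume "11 dvd coef (\<lambda>k. P ! k) 1"
    then have "11 dvd Determinant.det (mat 55 55 (\<lambda>(a, b). B ! a ! b)) * c 1" by (simp add: c_def)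
    then show False using d by (simp add: cong_def dvd_eq_mod_eq_0)
  qed
  have Nc: "(\<Sum>j<55. N k j * c j) = (if k = 54 then c 1 else 0)" if "k < 55" for k
  proof (cases "k < 54")
    case True
    then show ?thesis using cramer_kernel[OF True, of f] by (simp add: N_def c_def coef_def f_def)
  next
    case False
    then have "(\<Sum>j<55. N k j * c j) = (\<Sum>j<55. if j = 1 then c j else 0)"
      by (intro sum.cong) (auto simp: N_def)
    then show ?thesis using False that by simp
  qed
  show "[coef (\<lambda>k. P ! k) a = coef (\<lambda>k. P ! k) 1 * B ! a ! 54] (mod 11)" if a: "a < 55"
  proof -
    have "(\<Sum>j<55. (\<Sum>k<55. B ! a ! k * N k j) * c j) = (\<Sum>j<55. \<Sum>k<55. B ! a ! k * (N k j * c j))"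
      by (simp only: sum_distrib_right mult.assoc)
    also have "\<dots> = (\<Sum>k<55. \<Sum>j<55. B ! a ! k * (N k j * c j))" by (rule sum.swap)
    also have "\<dots> = (\<Sum>k<55. B ! a ! k * (if k = 54 then c 1 else 0))"
      unfolding sum_distrib_left[symmetric] by (intro sum.cong refl) (simp add: Nc)
    also have "\<dots> = (\<Sum>k<55. if k = 54 then B ! a ! k * c 1 else 0)" by (intro sum.cong) auto
    also have "\<dots> = B ! a ! 54 * c 1" by simp
    finally have e: "(\<Sum>j<55. (\<Sum>k<55. B ! a ! k * N k j) * c j) = B ! a ! 54 * c 1" .
    have "[(\<Sum>j<55. (\<Sum>k<55. B ! a ! k * N k j) * c j) = (\<Sum>j<55. (if j = a then 1 else 0) * c j)] (mod 11)"
      using inv[OF a] by (intro cong_sum cong_mult cong_refl) auto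
    moreover have "(\<Sum>j<55. (if j = a then 1 else 0) * c j) = c a"
      using a by (simp add: if_distrib[where f = "\<lambda>x. x * _"] cong: if_cong)
    ultimately have "[B ! a ! 54 * c 1 = c a] (mod 11)" unfolding e by simp
    then show ?thesis unfolding c_def[symmetric] by (simp add: cong_sym mult.commute)
  qed
qed

lemma coef_local:
  assumes "\<And>k. k < 10 \<Longrightarrow> v k = v' k" "j < 55"
  shows "coef v j = coef v' j"
proof -
  have "condrow v a b = condrow v' a b" if a: "a < 54" for a b
  proof -
    obtain k b1 b2 b3 where "conds ! a = (k, b1, b2, b3)" "k < 10" using conds_nth[OF a] by metis
    then show ?thesis using assms(1) by (simp add: condrow_def)
  qed
  then have "bordered 54 (condrow v) r = bordered 54 (condrow v') r" for r
    unfolding bordered_def by (intro eq_matI) auto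
  then show ?thesis by (simp add: coef_def cramer_def)
qed

lemma resultant9_local:
  assumes "\<And>k. k < 10 \<Longrightarrow> v k = v' k"
  shows "resultant9 v = resultant9 v'"
proof -
  have 1: "coef v (line_idx k) = coef v' (line_idx k)" if "k \<le> 9" for k
    using assms line_idx_less[OF that] by (intro coef_local) auto
  have 2: "coef (\<lambda>i. v (swap4 i)) (line_idx k) = coef (\<lambda>i. v' (swap4 i)) (line_idx k)" if "k \<le> 9" for k
    using line_idx_less[OF that] by (intro coef_local assms) (auto simp: swap4_def)
  have "sylvester (\<lambda>k. coef v (line_idx k)) (\<lambda>k. coef (\<lambda>i. v (swap4 i)) (line_idx k))
      = sylvester (\<lambda>k. coef v' (line_idx k)) (\<lambda>k. coef (\<lambda>i. v' (swap4 i)) (line_idx k))"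
    unfolding sylvester_def by (intro eq_matI) (auto intro!: 1 2)
  then show ?thesis by (simp add: resultant9_def)
qed

text \<open>Each coefficient vector is known modulo 11 up to a unit. The units are common factors of
  the rows of the Sylvester matrix and come out of the determinant, leaving the matrix that
  \<open>inverse3\<close> inverts.\<close>

lemma resultant9_points: "\<not> 11 dvd resultant9 (\<lambda>k. points ! k)"
proof -
  let ?b = "\<lambda>k. coef (\<lambda>k. points ! k) (line_idx k)" and ?b' = "\<lambda>k. coef (\<lambda>k. points' ! k) (line_idx k)"
  have pp: "coef (\<lambda>i. points ! swap4 i) (line_idx k) = ?b' k" if "k \<le> 9" for k
    using line_idx_less[OF that] by (intro coef_local) (auto simp: points'_def)
  define S where "S i j = (if i < 9 then (if i \<le> j \<and> j \<le> i + 9 then ?b (j - i) else 0)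
     else (if i - 9 \<le> j \<and> j \<le> i then ?b' (j - (i - 9)) else 0))" for i j :: nat
  have R: "resultant9 (\<lambda>k. points ! k) = Determinant.det (mat 18 18 (\<lambda>(i, j). S i j))"
    unfolding resultant9_def sylvester_def S_def
    by (rule arg_cong[of _ _ Determinant.det], rule eq_matI) (auto simp: pp)
  define \<gamma> where "\<gamma> i = (if i < 9 then coef (\<lambda>k. points ! k) 1 else coef (\<lambda>k. points' ! k) 1)" for i :: nat
  define K where "K = sylvester_rows (last_column inverse1) (last_column inverse2)"
  note c1 = coef_certificate[OF conjunct1[OF inverse_check1] conjunct2[OF inverse_check1]]
  note c2 = coef_certificate[OF conjunct1[OF inverse_check2] conjunct2[OF inverse_check2]]
  have lc: "last_column B ! k = B ! line_idx k ! 54" if "k \<le> 9" for B k using that by (simp add: last_column_def)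
  have SK: "[S i j = \<gamma> i * K ! i ! j] (mod 11)" if ij: "i < 18" "j < 18" for i j
  proof -
    have k1: "[?b k = coef (\<lambda>k. points ! k) 1 * last_column inverse1 ! k] (mod 11)" if "k \<le> 9" for k
      unfolding lc[OF that] by (rule c1(2)[OF line_idx_less[OF that]])
    have k2: "[?b' k = coef (\<lambda>k. points' ! k) 1 * last_column inverse2 ! k] (mod 11)" if "k \<le> 9" for k
      unfolding lc[OF that] by (rule c2(2)[OF line_idx_less[OF that]])
    show ?thesis
    proof (cases "i < 9")
      case True
      then show ?thesis
        using ij k1[of "j - i"] by (cases "i \<le> j \<and> j \<le> i + 9") (auto simp: S_def \<gamma>_def K_def sylvester_rows_def)
    next
      case False
      then show ?thesis
        using ij k2[of "j - (i - 9)"]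
        by (cases "i - 9 \<le> j \<and> j \<le> i") (auto simp: S_def \<gamma>_def K_def sylvester_rows_def)
    qed
  qed
  have scale: "Determinant.det (mat 18 18 (\<lambda>(i, j). \<gamma> i * K ! i ! j))
      = (\<Prod>i\<in>{0..<18}. \<gamma> i) * Determinant.det (mat 18 18 (\<lambda>(i, j). K ! i ! j))"
    unfolding det_mat_sum sum_distrib_left by (intro sum.cong refl) (simp add: prod.distrib mult_ac)
  have "[resultant9 (\<lambda>k. points ! k) = Determinant.det (mat 18 18 (\<lambda>(i, j). \<gamma> i * K ! i ! j))] (mod 11)"
    unfolding R by (rule det_cong) (rule SK)
  moreover have "\<not> 11 dvd Determinant.det (mat 18 18 (\<lambda>(i, j). \<gamma> i * K ! i ! j))"
  proof
    assume "11 dvd Determinant.det (mat 18 18 (\<lambda>(i, j). \<gamma> i * K ! i ! j))"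
    moreover have p11: "prime (11 :: int)" by simp
    ultimately consider "11 dvd (\<Prod>i\<in>{0..<18}. \<gamma> i)" | "11 dvd Determinant.det (mat 18 18 (\<lambda>(i, j). K ! i ! j))"
      unfolding scale using prime_dvd_mult_iff by blast
    then show False
    proof cases
      case 1
      then obtain i where "11 dvd \<gamma> i" using prime_dvd_prod_iff[OF _ p11, of "{0..<18}" \<gamma>] by auto
      then show False using c1(1) c2(1) by (auto simp: \<gamma>_def split: if_splits)
    next
      case 2
      have "[(\<Sum>k<18. K ! a ! k * inverse3 ! k ! j) = (if j = a then 1 else 0)] (mod 11)" if "a < 18" "j < 18" for a j
      proof -
        have "length K = 18" by (simp add: K_def sylvester_rows_def)
        then show ?thesis
          using inverse_checkD[of 18 K inverse3 0 a j] inverse_check3 that by (simp add: K_def cong_def)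
      qed
      then have "[Determinant.det (mat 18 18 (\<lambda>(i, j). K ! i ! j)) * Determinant.det (mat 18 18 (\<lambda>(i, j). inverse3 ! i ! j)) = 1] (mod 11)"
        by (rule det_inverse_mod)
      moreover have "11 dvd Determinant.det (mat 18 18 (\<lambda>(i, j). K ! i ! j)) * Determinant.det (mat 18 18 (\<lambda>(i, j). inverse3 ! i ! j))"
        using 2 by simp
      ultimately show False by (simp add: cong_def dvd_eq_mod_eq_0)
    qed
  qed
  ultimately show ?thesis by (simp add: cong_dvd_iff)
qed

section \<open>Transfer from the integers to the complex numbers\<close>

fun embed :: "int \<times> int \<times> int \<Rightarrow> complex \<times> complex \<times> complex" where
  "embed (x, y, z) = (of_int x, of_int y, of_int z)"

lemma hasse_embed: "hasse b a (embed t) = of_int (hasse b a t)"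
  by (cases b; cases a; cases t) simp

lemma coef_embed: "coef (\<lambda>k. embed (v k)) j = of_int (coef v j)"
proof -
  have "condrow (\<lambda>k. embed (v k)) a b = of_int (condrow v a b)" for a b
    by (simp add: condrow_def hasse_embed)
  then have "bordered 54 (condrow (\<lambda>k. embed (v k))) (\<lambda>b. if b = j then 1 else 0)
      = map_mat of_int (bordered 54 (condrow v) (\<lambda>b. if b = j then 1 else 0))"
    unfolding bordered_def by (intro eq_matI) auto
  then show ?thesis unfolding coef_def cramer_def by (simp add: of_int_hom.hom_det)
qed

lemma resultant9_embed: "resultant9 (\<lambda>k. embed (v k)) = of_int (resultant9 v)"
proof -
  have "sylvester (\<lambda>k. complex_of_int (b k)) (\<lambda>k. complex_of_int (b' k))
      = map_mat complex_of_int (sylvester b b')" for b b' :: "nat \<Rightarrow> int"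
    unfolding sylvester_def by (intro eq_matI) auto
  then show ?thesis unfolding resultant9_def coef_embed by (simp add: of_int_hom.hom_det)
qed

lemma resultant9_points_nonzero: "resultant9 (\<lambda>k. embed (points ! k)) \<noteq> 0"
  unfolding resultant9_embed using resultant9_points by auto

section \<open>Very general points\<close>

lemma very_general_forms:
  fixes P :: "('i::finite \<Rightarrow> cp2) \<Rightarrow> bool"
  assumes "finite \<F>" "\<And>F. F \<in> \<F> \<Longrightarrow> \<exists>d. multiform d F" "\<And>F. F \<in> \<F> \<Longrightarrow> \<exists>x. F (coords x) \<noteq> 0"
    and P: "\<And>p. (\<And>F. F \<in> \<F> \<Longrightarrow> F (coords p) \<noteq> 0) \<Longrightarrow> P p"
  shows "very_general P"
proof -
  obtain Fs where Fs: "set Fs = \<F>" using finite_list[OF assms(1)] by blast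
  \<comment> \<open>Finitely many forms are enough; the countable family is completed by empty
    sets.\<close>
  define Z where "Z n = (if n < length Fs then {x. (Fs ! n) (coords x) = 0} else {})" for n
  have "zariski_closed (Z n) \<and> Z n \<noteq> UNIV" for n
  proof (cases "n < length Fs")
    case True
    then have F: "Fs ! n \<in> \<F>" using Fs by auto
    then obtain d where "multiform d (Fs ! n)" using assms(2) by blast
    then have "zariski_closed {x. (Fs ! n) (coords x) = 0}" by (rule zariski_closed_form)
    moreover obtain x where "(Fs ! n) (coords x) \<noteq> 0" using assms(3)[OF F] by blast
    then have "x \<notin> {x. (Fs ! n) (coords x) = 0}" by simp
    ultimately show ?thesis using True by (auto simp: Z_def)
  next
    case False
    then show ?thesis using zariski_closed_empty by (simp add: Z_def)
  qed
  moreover have "P p" if p: "p \<notin> (\<Union>n. Z n)" for p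
  proof (rule P)
    fix F assume "F \<in> \<F>"
    then obtain n where "n < length Fs" "F = Fs ! n" using Fs by (metis in_set_conv_nth)
    then show "F (coords p) \<noteq> 0" using p by (auto simp: Z_def)
  qed
  ultimately show ?thesis unfolding very_general_def by blast
qed

text \<open>The line on which nonics are compared. That no \<open>p i\<close> lies on it, as
  \<open>no_common_component\<close> requires, is one of the genericity conditions.\<close>

definition infty :: "complex^3" where
  "infty = vector [0, 0, 1]"

lemma dot_infty: "dot infty v = v$3"
  by (simp add: dot_def infty_def)

text \<open>The third component of \<open>cross (v i) (v j)\<close>. Its nonvanishing implies that
  the points are distinct and is a condition on a single form.\<close>

definition separation :: "'i \<Rightarrow> 'i \<Rightarrow> ('i \<Rightarrow> complex^3) \<Rightarrow> complex" where
  "separation i j v = v i $ 1 * v j $ 2 - v i $ 2 * v j $ 1"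

lemma multiform_separation:
  fixes i j :: "'i::finite"
  shows "multiform (\<lambda>k. unit_deg i k + unit_deg j k) (separation i j)"
  unfolding separation_def by (intro multiform_diff multiform_mult multiform_component)

text \<open>The orderings of the ten points. The first two entries will be the double points of the
  nonic.\<close>

definition labellings :: "10 list set" where
  "labellings = {es. length es = 10 \<and> distinct es}"

lemma finite_labellings: "finite labellings"
  by (rule finite_subset[OF _ finite_lists_length_eq[of "UNIV :: 10 set" 10]]) (auto simp: labellings_def)

lemma labelling_set: "es \<in> labellings \<Longrightarrow> set es = UNIV"
proof -
  assume "es \<in> labellings"
  then have "card (set es) = CARD(10)" by (simp add: labellings_def distinct_card)
  then show ?thesis by (metis card_subset_eq finite_class.finite_UNIV subset_UNIV)
qed

definition general_forms :: "((10 \<Rightarrow> complex^3) \<Rightarrow> complex) set" where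
  "general_forms = range (\<lambda>i v. dot infty (v i))
     \<union> (\<lambda>(i, j). separation i j) ` {(i, j). i \<noteq> j}
     \<union> (\<lambda>es v. resultant9 (\<lambda>k. trip (v (es ! k)))) ` labellings"

lemma general_forms_cases:
  assumes "F \<in> general_forms"
  obtains i where "F = (\<lambda>v. dot infty (v i))" | i j where "i \<noteq> j" "F = separation i j"
    | es where "es \<in> labellings" "F = (\<lambda>v. resultant9 (\<lambda>k. trip (v (es ! k))))"
  using assms unfolding general_forms_def by (elim UnE imageE) auto

lemma finite_general_forms: "finite general_forms"
proof -
  have "finite {(i, j). i \<noteq> (j :: 10)}" by (rule finite_subset[of _ UNIV]) auto
  then show ?thesis by (simp add: general_forms_def finite_labellings)
qed

lemma general_forms_multiform: "F \<in> general_forms \<Longrightarrow> \<exists>d. multiform d F"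
proof (erule general_forms_cases)
  show "\<exists>d. multiform d F" if "F = (\<lambda>v. dot infty (v i))" for i
    unfolding that using multiform_dot by blast
  show "\<exists>d. multiform d F" if "F = separation i j" for i j
    unfolding that using multiform_separation by blast
  show "\<exists>d. multiform d F" if "F = (\<lambda>v. resultant9 (\<lambda>k. trip (v (es ! k))))" for es
    unfolding that by (rule multiform_resultant9)
qed

definition triple_vec :: "int \<times> int \<times> int \<Rightarrow> complex^3" where
  "triple_vec t = (case embed t of (x, y, z) \<Rightarrow> vector [x, y, z])"

lemma trip_triple_vec: "trip (triple_vec t) = embed t"
  by (cases t) (simp add: trip_def triple_vec_def)

lemma general_forms_nonzero:
  assumes F: "F \<in> general_forms"
  shows "\<exists>x. F (coords x) \<noteq> 0"
proof -
  obtain d where d: "multiform d F" using general_forms_multiform[OF F] by blast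
  have ex: "\<exists>x. F (coords x) \<noteq> 0" if u: "\<And>k. u k \<noteq> 0" and Fu: "F u \<noteq> 0" for u
    using form_point_of_0_iff[OF d, of u] u Fu by blast
  show ?thesis using F
  proof (cases rule: general_forms_cases)
    case (1 i)
    have i0: "infty \<noteq> 0" by (simp add: infty_def vec3_eq_iff)
    show ?thesis by (rule ex[of "\<lambda>_. infty"]) (simp_all add: i0 1 dot_infty, simp add: infty_def)
  next
    case (2 i j)
    define u where "u k = (if k = i then vector [1, 0, 0] else vector [0, 1, 0] :: complex^3)" for k
    show ?thesis
      by (rule ex[of u]) (use 2 in \<open>auto simp: u_def separation_def vec3_eq_iff\<close>)
  next
    case (3 es)
    have es: "length es = 10" "distinct es" "set es = UNIV"
      using 3(1) labelling_set by (auto simp: labellings_def)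
    \<comment> \<open>The special points are distributed according to \<open>es\<close>, so the one
      certified resultant serves for every labelling.\<close>
    define ix where "ix i = (THE k. k < 10 \<and> es ! k = i)" for i
    have ix: "ix (es ! k) = k" if "k < 10" for k
      unfolding ix_def using that es by (intro the_equality) (auto simp: nth_eq_iff_index_eq)
    define u where "u i = triple_vec (points ! ix i)" for i
    have "u i \<noteq> 0" for i
    proof -
      have "i \<in> set es" using es(3) by simp
      then obtain k where k: "k < 10" "i = es ! k" using es(1) by (metis in_set_conv_nth)
      have "\<forall>t\<in>set points. snd (snd t) = 1" by (simp add: points_def)
      moreover have "points ! k \<in> set points" using k(1) by (intro nth_mem) (simp add: points_def)
      ultimately have "snd (snd (points ! k)) = 1" by blast
      then have "u i $ 3 = 1" using ix[OF k(1)] k(2) by (cases "points ! k") (simp add: u_def triple_vec_def)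
      then show ?thesis by auto
    qed
    moreover have "resultant9 (\<lambda>k. trip (u (es ! k))) = resultant9 (\<lambda>k. embed (points ! k))"
      by (rule resultant9_local) (simp add: u_def ix trip_triple_vec)
    then have "F u \<noteq> 0" unfolding 3(2) using resultant9_points_nonzero by simp
    ultimately show ?thesis by (rule ex)
  qed
qed

section \<open>Families of pairwise intersecting pairs\<close>

lemma pairs_card: "card {P :: 10 set. card P = 2} = 45"
  using n_subsets[of "UNIV :: 10 set" 2] by (simp add: choose_two)

lemma pairs_degree_le:
  fixes A :: "10 set"
  assumes "j \<notin> A"
  shows "card {P :: 10 set. card P = 2 \<and> j \<in> P \<and> P \<inter> A = {}} \<le> 9 - card A"
proof -
  have "{P :: 10 set. card P = 2 \<and> j \<in> P \<and> P \<inter> A = {}} \<subseteq> (\<lambda>x. {j, x}) ` (- insert j A)"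
    by (auto simp: card_2_iff)
  then have "card {P :: 10 set. card P = 2 \<and> j \<in> P \<and> P \<inter> A = {}} \<le> card (- insert j A)"
    by (rule surj_card_le[rotated]) simp
  also have "card (- insert j A) = 9 - card A" using assms by (simp add: Compl_eq_Diff_UNIV card_Diff_subset)
  finally show ?thesis .
qed

lemma pair_other:
  assumes "card P = 2" "a \<in> P"
  obtains b where "b \<noteq> a" "P = {a, b}"
proof -
  obtain x y where xy: "P = {x, y}" "x \<noteq> y" using assms(1) unfolding card_2_iff by blast
  show ?thesis
  proof (cases "a = x")
    case True
    show ?thesis by (rule that[of y]) (use xy True in auto)
  next
    case False
    then have "a = y" using assms(2) xy by simp
    then show ?thesis using that[of x] xy by (simp add: insert_commute)
  qed
qed

text \<open>Without a common point, pairs that avoid \<open>a\<close> and \<open>b\<close> complete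
  \<open>{a, b}\<close> to the three sides of a triangle; a pair that meets all three sides lies in
  the triangle.\<close>

lemma intersecting_pairs:
  fixes Bad :: "'a set set"
  assumes card2: "\<And>P. P \<in> Bad \<Longrightarrow> card P = 2" and meet: "\<And>P Q. P \<in> Bad \<Longrightarrow> Q \<in> Bad \<Longrightarrow> P \<inter> Q \<noteq> {}"
  shows "(\<exists>c. \<forall>P\<in>Bad. c \<in> P) \<or> (\<exists>T. card T = 3 \<and> (\<forall>P\<in>Bad. P \<subseteq> T))"
proof (cases "\<exists>c. \<forall>P\<in>Bad. c \<in> P")
  case False
  then have avoid: "\<exists>P\<in>Bad. c \<notin> P" for c by simp
  then obtain P where P: "P \<in> Bad" by blast
  obtain a b where ab: "P = {a, b}" "a \<noteq> b" using card2[OF P] unfolding card_2_iff by blast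
  obtain Q where Q: "Q \<in> Bad" "a \<notin> Q" using avoid[of a] ..
  have "b \<in> Q" using meet[OF P Q(1)] Q(2) unfolding ab by simp
  then obtain c where c: "c \<noteq> b" "Q = {b, c}" using pair_other[OF card2[OF Q(1)]] by metis
  have ac: "a \<noteq> c" using Q(2) c by simp
  obtain R where R: "R \<in> Bad" "b \<notin> R" using avoid[of b] ..
  have "a \<in> R" using meet[OF P R(1)] R(2) unfolding ab by simp
  then obtain d where d: "d \<noteq> a" "R = {a, d}" using pair_other[OF card2[OF R(1)]] by metis
  have "c \<in> R" using meet[OF Q(1) R(1)] R(2) unfolding c by simp
  then have R_eq: "R = {a, c}" using d ac by simp
  have "S \<subseteq> {a, b, c}" if S: "S \<in> Bad" for S
  proof (cases "a \<in> S")
    case True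
    then obtain y where y: "S = {a, y}" using pair_other[OF card2[OF S]] by metis
    show ?thesis using meet[OF Q(1) S] ac ab(2) unfolding c y by simp
  next
    case False
    have "b \<in> S" using meet[OF P S] False unfolding ab by simp
    then obtain y where y: "S = {b, y}" using pair_other[OF card2[OF S]] by metis
    show ?thesis using meet[OF R(1) S] False ab(2) c(1) unfolding R_eq y by simp
  qed
  moreover have "card {a, b, c} = 3" using ab c ac by simp
  ultimately show ?thesis by blast
qed simp

text \<open>If \<open>j\<close> lies in \<open>k\<close> members of the family, the multiplicities
  at \<open>j\<close> add up to at least \<open>3 * card \<G> - k\<close>. This is at least 36/13
  per member exactly when \<open>13 * k \<le> 3 * card \<G>\<close>. For a common point the check is
  13 * 8 = 104 against 3 * 36 = 108, for a triangle 13 * 9 = 117 against 3 * 42 = 126.\<close>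

lemma good_pairs:
  fixes Bad :: "10 set set"
  assumes card2: "\<And>P. P \<in> Bad \<Longrightarrow> card P = 2" and meet: "\<And>P Q. P \<in> Bad \<Longrightarrow> Q \<in> Bad \<Longrightarrow> P \<inter> Q \<noteq> {}"
  shows "\<exists>\<G>. \<G> \<subseteq> {P. card P = 2} - Bad \<and> \<G> \<noteq> {} \<and> (\<forall>j. 13 * card {P \<in> \<G>. j \<in> P} \<le> 3 * card \<G>)"
proof -
  have "(\<exists>c. \<forall>P\<in>Bad. c \<in> P) \<or> (\<exists>T. card T = 3 \<and> (\<forall>P\<in>Bad. P \<subseteq> T))"
    by (rule intersecting_pairs) (fact card2, fact meet)
  then show ?thesis
  proof (elim disjE exE conjE)
    fix c assume c: "\<forall>P\<in>Bad. c \<in> P"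
    define \<G> where "\<G> = {P :: 10 set. card P = 2 \<and> c \<notin> P}"
    have "\<G> = {P. P \<subseteq> - {c} \<and> card P = 2}" by (auto simp: \<G>_def)
    then have G: "card \<G> = 36" using n_subsets[of "- {c}" 2] by (simp add: Compl_eq_Diff_UNIV card_Diff_subset choose_two)
    have "13 * card {P \<in> \<G>. j \<in> P} \<le> 3 * card \<G>" for j
    proof (cases "j = c")
      case True
      then have "{P \<in> \<G>. j \<in> P} = {}" by (auto simp: \<G>_def)
      then show ?thesis by (simp only: card.empty mult_0_right le0)
    next
      case False
      have "{P \<in> \<G>. j \<in> P} = {P. card P = 2 \<and> j \<in> P \<and> P \<inter> {c} = {}}" by (auto simp: \<G>_def)
      then have "card {P \<in> \<G>. j \<in> P} \<le> 8" using pairs_degree_le[of j "{c}"] False by simp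
      then show ?thesis using G by simp
    qed
    moreover have "\<G> \<noteq> {}" using G by auto
    moreover have "\<G> \<subseteq> {P. card P = 2} - Bad" using c by (auto simp: \<G>_def)
    ultimately show ?thesis by blast
  next
    fix T assume T: "card T = 3" "\<forall>P\<in>Bad. P \<subseteq> T"
    define \<G> where "\<G> = {P :: 10 set. card P = 2} - {P. P \<subseteq> T \<and> card P = 2}"
    have "card \<G> = card {P :: 10 set. card P = 2} - card {P. P \<subseteq> T \<and> card P = 2}"
      unfolding \<G>_def by (rule card_Diff_subset) auto
    then have G: "card \<G> = 42" using n_subsets[of T 2] T(1) by (simp add: pairs_card choose_two)
    have "13 * card {P \<in> \<G>. j \<in> P} \<le> 3 * card \<G>" for j
    proof -
      have "card {P \<in> \<G>. j \<in> P} \<le> card {P. card P = 2 \<and> j \<in> P \<and> P \<inter> {} = {}}"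
        by (rule card_mono) (auto simp: \<G>_def)
      then have "card {P \<in> \<G>. j \<in> P} \<le> 9" using pairs_degree_le[of j "{}"] by simp
      then show ?thesis using G by simp
    qed
    moreover have "\<G> \<noteq> {}" using G by auto
    moreover have "\<G> \<subseteq> {P. card P = 2} - Bad" using T by (auto simp: \<G>_def)
    ultimately show ?thesis by blast
  qed
qed

section \<open>Nefness\<close>

lemma separation_inj:
  assumes "\<And>i j. i \<noteq> j \<Longrightarrow> separation i j (coords p) \<noteq> 0"
  shows "inj p"
proof (rule injI, rule ccontr)
  fix i j assume "p i = p j" "i \<noteq> j"
  then have "separation i j (coords p) = 0" by (simp add: separation_def coords_def)
  then show False using assms \<open>i \<noteq> j\<close> by blast
qed

text \<open>Listing \<open>P\<close>, then \<open>Q\<close>, then the other points makes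
  \<open>swap4\<close> the exchange of the two pairs, so the two nonics compared by
  \<open>resultant9\<close> belong to \<open>P\<close> and \<open>Q\<close>.\<close>

lemma labelling_of_pairs:
  fixes P Q :: "10 set"
  assumes "card P = 2" "card Q = 2" "P \<inter> Q = {}"
  shows "\<exists>es\<in>labellings. \<exists>es'\<in>labellings. {es ! 0, es ! 1} = P \<and> {es' ! 0, es' ! 1} = Q \<and>
    (\<forall>k<10. es ! swap4 k = es' ! k)"
proof -
  obtain a b where P: "P = {a, b}" "a \<noteq> b" using assms(1) by (meson card_2_iff)
  obtain c d where Q: "Q = {c, d}" "c \<noteq> d" using assms(2) by (meson card_2_iff)
  obtain rs where rs: "set rs = UNIV - {a, b, c, d}" "distinct rs"
    using finite_distinct_list[of "UNIV - {a, b, c, d}"] by auto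
  have d4: "distinct [a, b, c, d]" using P Q assms(3) by auto
  then have "card {a, b, c, d} = 4" using distinct_card[of "[a, b, c, d]"] by simp
  then have "card (UNIV - {a, b, c, d} :: 10 set) = 6" by (simp add: card_Diff_subset)
  then have l: "length rs = 6" using rs distinct_card by metis
  let ?es = "[a, b, c, d] @ rs" and ?es' = "[c, d, a, b] @ rs"
  have "?es \<in> labellings" "?es' \<in> labellings" using d4 rs l by (auto simp: labellings_def)
  moreover have "?es ! swap4 k = ?es' ! k" for k
  proof -
    consider "k = 0" | "k = 1" | "k = 2" | "k = 3" | "k \<ge> 4" by linarith
    then show ?thesis by cases (auto simp: swap4_def nth_append numeral_2_eq_2 numeral_3_eq_3)
  qed
  ultimately show ?thesis using P Q by (intro bexI[of _ ?es] bexI[of _ ?es']) auto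
qed

context blown_up_plane
begin

lemma nonic_E_order:
  assumes "\<not> vanishes (\<lambda>v. nonic c (v None)) X" "m < 9"
    "\<And>b1 b2 b3. b1 + b2 + b3 = m \<Longrightarrow> dnonic c (b1, b2, b3) (w j) = 0"
  shows "Suc m \<le> order_along X (E j) (\<lambda>v. nonic c (v None))"
proof (rule order_along_E_ge[OF multiform_nonic assms(1)])
  show "\<exists>r. \<forall>s. nonic c (gpar (w j + s *s u) None) = s ^ Suc m * poly r s" for u
    using nonic_order[OF assms(2,3)] by simp
qed simp

end

lemma nef_general:
  fixes p :: "10 \<Rightarrow> cp2"
  assumes general: "\<And>F. F \<in> general_forms \<Longrightarrow> F (coords p) \<noteq> 0" and l: "l \<noteq> 0"
  shows "nef (blowup p) (\<lambda>C. form_divisor (blowup p) (\<lambda>v. dot l (v None)) C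
    - 4 / 13 * (\<Sum>i\<in>UNIV. prime_divisor (exceptional p i) C))"
proof -
  have "separation i j (coords p) \<noteq> 0" if "i \<noteq> j" for i j
    using that by (intro general) (auto simp: general_forms_def)
  then interpret blown_up_plane p by unfold_locales (rule separation_inj)
  have cw: "coords p = w" by (rule ext) (simp add: coords_def w_def)
  have inf: "dot infty (w i) \<noteq> 0" for i
    using general[of "\<lambda>v. dot infty (v i)"] unfolding cw by (simp add: general_forms_def)
  have res: "resultant9 (\<lambda>k. trip (w (es ! k))) \<noteq> 0" if "es \<in> labellings" for es
    using general[of "\<lambda>v. resultant9 (\<lambda>k. trip (v (es ! k)))"] that unfolding cw by (simp add: general_forms_def)
  define c where "c es = coef (\<lambda>k. trip (w (es ! k)))" for es
  define B where "B es v = nonic (c es) (v None)" for es and v :: "10 option \<Rightarrow> complex^3"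
  have mB: "multiform (\<lambda>k. 9 * unit_deg None k) (B es)" for es
    unfolding B_def by (rule multiform_nonic)
  have "nef X (\<lambda>C. form_divisor X (\<lambda>v. dot l (v None)) C - 4 / 13 * exceptional_sum C)"
  proof (rule nef_criterion[where I = labellings and B = B and n = 9, OF _ l mB])
    fix C assume C: "irreducible_curve X C" "C \<notin> range E"
    \<comment> \<open>A pair is bad when every labelling that starts with it gives a nonic
      containing \<open>C\<close>. For two disjoint bad pairs the labellings can then be chosen to
      match under \<open>swap4\<close>.\<close>
    define good where "good P es \<longleftrightarrow> es \<in> labellings \<and> {es ! 0, es ! 1} = P \<and> \<not> vanishes (B es) C" for P es
    define Bad where "Bad = {P. card P = 2 \<and> \<not> (\<exists>es. good P es)}"
    have "P \<inter> Q \<noteq> {}" if PQ: "P \<in> Bad" "Q \<in> Bad" for P Q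
    proof
      assume "P \<inter> Q = {}"
      then obtain es es' where es: "es \<in> labellings" "es' \<in> labellings" "{es ! 0, es ! 1} = P" "{es' ! 0, es' ! 1} = Q"
          "\<forall>k<10. es ! swap4 k = es' ! k"
        using labelling_of_pairs[of P Q] PQ by (auto simp: Bad_def)
      have "vanishes (B es) C" "vanishes (B es') C" using PQ es by (auto simp: Bad_def good_def)
      then obtain v where v: "v \<noteq> 0" "dot infty v = 0" "nonic (c es) v = 0" "nonic (c es') v = 0"
        using no_common_component[OF C inf multiform_nonic multiform_nonic] unfolding B_def by blast
      have cc: "c es' j = coef (\<lambda>k. trip (w (es ! swap4 k))) j" if "j < 55" for j
        unfolding c_def using es(5) that by (intro coef_local) auto
      have "nonic (c es') v = nonic (coef (\<lambda>k. trip (w (es ! swap4 k)))) v"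
        unfolding nonic_def by (intro sum.cong refl) (simp add: cc)
      then have "nonic (coef (\<lambda>k. trip (w (es ! swap4 k)))) v = 0" using v(4) by simp
      then show False
        using resultant9_no_common_zero[of "\<lambda>k. w (es ! k)" v] res[OF es(1)] v unfolding c_def dot_infty by blast
    qed
    then obtain \<G> where G: "\<G> \<subseteq> {P. card P = 2} - Bad" "\<G> \<noteq> {}" "\<And>j. 13 * card {P \<in> \<G>. j \<in> P} \<le> 3 * card \<G>"
      using good_pairs[of Bad] by (auto simp: Bad_def)
    have "\<forall>P\<in>\<G>. \<exists>es. good P es" using G(1) by (auto simp: Bad_def)
    from bchoice[OF this] obtain e where e: "\<forall>P\<in>\<G>. good P (e P)" ..
    \<comment> \<open>A labelling determines the pair formed by its first two entries, so distinct
      pairs contribute distinct members to the average.\<close>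
    have inj: "inj_on e \<G>" using e by (intro inj_onI) (metis good_def)
    have fin: "finite \<G>" by simp
    have ord: "(if j \<in> P then 2 else 3) \<le> order_along X (E j) (B (e P))" if P: "P \<in> \<G>" for P j
    proof -
      define es where "es = e P"
      have "good P es" using e P by (auto simp: es_def)
      then have g: "es \<in> labellings" "{es ! 0, es ! 1} = P" "\<not> vanishes (B es) C" unfolding good_def by blast+
      have nv: "\<not> vanishes (\<lambda>v. nonic (c es) (v None)) X"
        using g(3) irreducible_curveD(1)[OF C(1)] by (auto simp: vanishes_def B_def)
      have "j \<in> set es" using labelling_set[OF g(1)] by simp
      then obtain k where k: "k < 10" "j = es ! k" using g(1) by (auto simp: in_set_conv_nth labellings_def)
      have "Suc (if k < 2 then 1 else 2) \<le> order_along X (E j) (\<lambda>v. nonic (c es) (v None))"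
      proof (rule nonic_E_order[OF nv])
        show "dnonic (c es) (b1, b2, b3) (w j) = 0" if "b1 + b2 + b3 = (if k < 2 then 1 else 2)" for b1 b2 b3
          unfolding c_def k(2) by (rule dnonic_coef[OF k(1) that])
      qed simp
      moreover have "j \<in> P \<longleftrightarrow> k < 2"
      proof -
        have "distinct es" "length es = 10" using g(1) by (auto simp: labellings_def)
        then have "es ! k = es ! 0 \<longleftrightarrow> k = 0" "es ! k = es ! 1 \<longleftrightarrow> k = 1"
          using k(1) by (auto simp: nth_eq_iff_index_eq)
        then show ?thesis unfolding g(2)[symmetric] k(2) by auto
      qed
      ultimately show ?thesis unfolding B_def es_def by (simp split: if_splits)
    qed
    have sum: "4 * 9 * card (e ` \<G>) \<le> 13 * (\<Sum>es\<in>e ` \<G>. order_along X (E j) (B es))" for j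
    proof -
      \<comment> \<open>Each pair through \<open>j\<close> lowers the multiplicity from 3 to 2. The
        count is stated as a sum to avoid subtraction of natural numbers.\<close>
      have "(\<Sum>P\<in>\<G>. if j \<in> P then 2 else 3 :: nat) + card {P \<in> \<G>. j \<in> P} = 3 * card \<G>"
      proof -
        have "card {P \<in> \<G>. j \<in> P} = (\<Sum>P\<in>\<G>. if j \<in> P then 1 else 0)"
          by (simp add: sum.If_cases Int_def)
        then have "(\<Sum>P\<in>\<G>. if j \<in> P then 2 else 3 :: nat) + card {P \<in> \<G>. j \<in> P}
            = (\<Sum>P\<in>\<G>. (if j \<in> P then 2 else 3) + (if j \<in> P then 1 else 0))"
          by (simp only: sum.distrib)
        also have "\<dots> = (\<Sum>P\<in>\<G>. 3)" by (intro sum.cong) auto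
        finally show ?thesis by simp
      qed
      moreover have "(\<Sum>P\<in>\<G>. if j \<in> P then 2 else 3 :: nat) \<le> (\<Sum>es\<in>e ` \<G>. order_along X (E j) (B es))"
        unfolding sum.reindex[OF inj] using ord by (intro sum_mono) simp
      ultimately show ?thesis using G(3)[of j] card_image[OF inj] by simp
    qed
    show "\<exists>S. S \<subseteq> labellings \<and> finite S \<and> S \<noteq> {} \<and> (\<forall>s\<in>S. \<not> vanishes (B s) C) \<and>
        (\<forall>j. 4 * 9 * card S \<le> 13 * (\<Sum>s\<in>S. order_along X (E j) (B s)))"
      using e fin G(2) sum by (intro exI[of _ "e ` \<G>"]) (auto simp: good_def)
  qed simp
  then show ?thesis unfolding exceptional_sum_def .
qed

theorem theorem0p6:
  "very_general (\<lambda>p :: 10 \<Rightarrow> cp2. inj p \<and>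
     (\<forall>L. nef (blowup p)
        (\<lambda>C. line_pullback p L C - 4 / 13 * (\<Sum>i\<in>UNIV. prime_divisor (exceptional p i) C))))"
proof (rule very_general_forms[OF finite_general_forms general_forms_multiform general_forms_nonzero])
  fix p :: "10 \<Rightarrow> cp2"
  assume g: "\<And>F. F \<in> general_forms \<Longrightarrow> F (coords p) \<noteq> 0"
  have "separation i j (coords p) \<noteq> 0" if "i \<noteq> j" for i j
    using that by (intro g) (auto simp: general_forms_def)
  then have "inj p" by (rule separation_inj)
  moreover have "nef (blowup p) (\<lambda>C. line_pullback p L C - 4 / 13 * (\<Sum>i\<in>UNIV. prime_divisor (exceptional p i) C))" for L
    unfolding line_pullback_def dot_sum[symmetric] by (rule nef_general) (fact g, rule rep_nonzero)
  ultimately show "inj p \<and> (\<forall>L. nef (blowup p)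
      (\<lambda>C. line_pullback p L C - 4 / 13 * (\<Sum>i\<in>UNIV. prime_divisor (exceptional p i) C)))" by blast
qed

end
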